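(* Let $G$ be a three-dimensional non-unimodular Lie group with Lie algebra $\mathfrak g$ and unimodular kernel $\mathfrak u$, and let $(H,\mathcal G_g,\delta)$ be a generalized Einstein structure on $G$ such that $g|_{\mathfrak u\times\mathfrak u}$ is non-degenerate. Then there exists an orthonormal basis $(v_1,v_2,v_3)$ of $(\mathfrak g,g)$ such that $v_1,v_3\in\mathfrak u$ and $g(v_1,v_1)=g(v_2,v_2)=-g(v_3,v_3)$. Furthermore $\delta_2=\delta_5$. (a) If $\delta_2=\delta_5=0$, then $\delta=0$, $h=0$ and one can choose $v_1$ and $v_3$ such that there is a positive constant $\theta>0$ such that $[v_2,v_1]=\theta v_1-\theta v_3$, $[v_2,v_3]=\theta v_1+\theta v_3$. (b) If $\delta_2=\delta_5\ne0$, then $M:=\mathrm{ad}_{v_2}|_{\mathfrak u}$ is diagonalizable, $h^2=(\mathrm{tr}\,M)^2\ne0$ and $\delta_2=\delta_5=-\mathrm{tr}\,M\neq0$. (b1) In the special case that $M$ has a double eigenvalue, it is diagonalizable by an orthonormal basis. That is, one can choose $v_1$ and $v_3$ such that there exists a positive constant $\theta>0$ such that $[v_2,v_1]=\theta v_1$, $[v_2,v_3]=\theta v_3$. In this case $h^2=(2\theta)^2\neq0$ and $\delta_2=\delta_5=-2\theta\ne0$. Furthermore $\delta_1=\delta_3=\delta_4=\delta_6=0$. (b2) In the case $\delta_2=\delta_5\neq0$ and two distinct real eigenvalues of $M$ there are the following families of solutions of the generalized Einstein equation, where the matrix of $M$ is with respect to $(v_1,v_3)$ and $\varepsilon_a=g(v_a,v_a)$: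 1. $h=\pm2\lambda$, $\delta_2=\delta_5=-2\varepsilon_2\lambda$, $\delta_1=\delta_3=\delta_4=\delta_6=0$, $M=\begin{pmatrix}\varepsilon_1\lambda&-\varepsilon_1\mu\\\varepsilon_3\mu&-\varepsilon_3\lambda\end{pmatrix}$, where $\lambda,\mu\in\mathbb R\setminus\{0\}$, $|\mu|\ne|\lambda|$. 2A. $h=\mu-\nu$, $\delta_2=\delta_5=\varepsilon_2(-\mu+\nu)$, $\delta_4=\delta_6=0$, $\mu\delta_1-\nu\delta_3=0$, $M=\begin{pmatrix}\varepsilon_1\mu&\varepsilon_1\nu\\\varepsilon_3\mu&\varepsilon_3\nu\end{pmatrix}$, where $\mu,\nu\in\mathbb R$, $\mu-\nu\ne0$. 2B. $h=\mu-\nu$, $\delta_2=\delta_5=\varepsilon_2(\mu-\nu)$, $\delta_4=\delta_6=0$, $\mu\delta_1+\nu\delta_3=0$, $M=\begin{pmatrix}-\varepsilon_1\mu&\varepsilon_1\nu\\\varepsilon_3\mu&-\varepsilon_3\nu\end{pmatrix}$, where $\mu,\nu\in\mathbb R$, $\mu-\nu\ne0$. 2C. $h=2\mu$, $\delta_2=\delta_5=2\varepsilon_2\mu$, $\delta_1=\delta_3$, $\delta_4=\delta_6=0$, $M=\begin{pmatrix}-\varepsilon_1\mu&-\varepsilon_1\mu\\\varepsilon_3\mu&\varepsilon_3\mu\end{pmatrix}$, where $\mu\in\mathbb R\setminus\{0\}$. 2D. $h=2\mu$, $\delta_2=\delta_5=-2\varepsilon_2\mu$, $\delta_1=-\delta_3$,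 $\delta_4=\delta_6=0$, $M=\begin{pmatrix}\varepsilon_1\mu&-\varepsilon_1\mu\\\varepsilon_3\mu&-\varepsilon_3\mu\end{pmatrix}$, where $\mu\in\mathbb R\setminus\{0\}$. 3A. $h=\nu-\mu$, $\delta_2=\delta_5=\varepsilon_2(\nu-\mu)$, $\delta_1=\delta_3=0$, $\mu\delta_4-\nu\delta_6=0$, $M=\begin{pmatrix}\varepsilon_1\mu&\varepsilon_1\nu\\\varepsilon_3\mu&\varepsilon_3\nu\end{pmatrix}$, where $\mu,\nu\in\mathbb R$, $\mu-\nu\ne0$. 3B. $h=\nu-\mu$, $\delta_2=\delta_5=\varepsilon_2(\mu-\nu)$, $\delta_1=\delta_3=0$, $\mu\delta_4+\nu\delta_6=0$, $M=\begin{pmatrix}-\varepsilon_1\mu&\varepsilon_1\nu\\\varepsilon_3\mu&-\varepsilon_3\nu\end{pmatrix}$, where $\mu,\nu\in\mathbb R$, $\mu-\nu\ne0$. 3C. $h=-2\mu$, $\delta_2=\delta_5=2\varepsilon_2\mu$, $\delta_1=\delta_3=0$, $\delta_4=\delta_6$, $M=\begin{pmatrix}-\varepsilon_1\mu&-\varepsilon_1\mu\\\varepsilon_3\mu&\varepsilon_3\mu\end{pmatrix}$, where $\mu\in\mathbb R\setminus\{0\}$. 3D. $h=-2\mu$, $\delta_2=\delta_5=-2\varepsilon_2\mu$, $\delta_1=\delta_3=0$, $\delta_4=-\delta_6$, $M=\begin{pmatrix}\varepsilon_1\mu&-\varepsilon_1\mu\\\varepsilon_3\mu&-\varepsilon_3\mu\end{pmatrix}$,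 where $\mu\in\mathbb R\setminus\{0\}$.
   Context: The unimodular kernel is $\mathfrak u=\{X\in\mathfrak g:\mathrm{tr}\,\mathrm{ad}_X=0\}$; $G$ is called non-unimodular here if $\mathfrak u\neq\mathfrak g$. In dimension three $\mathfrak u$ is then a two-dimensional abelian ideal. Left-invariant tensors are identified with tensors on $\mathfrak g$; $g$ is a left-invariant pseudo-Riemannian metric, $H\in\bigwedge^3\mathfrak g^*$, and $h=H(v_1,v_2,v_3)$. Let $E=\mathfrak g\oplus\mathfrak g^*$, with scalar product $\langle X+\xi,Y+\eta\rangle=\frac12(\xi(Y)+\eta(X))$ and Dorfman bracket $[X+\xi,Y+\eta]_H=[X,Y]-\mathrm{ad}_X^*\eta+\mathrm{ad}_Y^*\xi+H(X,Y,\cdot)$, where $\mathrm{ad}_X^*\eta=\eta\circ\mathrm{ad}_X$. Put $gX=g(X,\cdot)$, $\mathcal G_g(X+\xi,Y+\eta)=\frac12(g(X,Y)+g^{-1}(\xi,\eta))$ and $E_\pm=\{X\pm gX:X\in\mathfrak g\}$. For $\delta\in E^*$, $\delta_a=\delta(v_a+gv_a)$ and $\delta_{a+3}=\delta(v_a-gv_a)$, $a=1,2,3$. A left-invariant generalized connection is a linear map $D:E\to\mathfrak{so}(E)$, $u\mapsto D_u$. Its torsion is $T(u,v)=D_uv-D_vu-[u,v]_H+(Du)^*v$, where $Du$ is $w\mapsto D_wu$ and $*$ is the adjoint for $\langle\cdot,\cdot\rangle$. $D$ is Levi-Civita if $T=0$ and $D_uE_\pm\subset E_\pm$ for all $u$.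 Its divergence is $\delta_D(v)=\mathrm{tr}(u\mapsto D_uv)$. Given $\delta\in E^*$, choose a Levi-Civita $D$ with $\delta_D=\delta$ (one exists), put $R(u,v)w=D_uD_vw-D_vD_uw-D_{[u,v]_H}w$ and, for $u_\pm\in E_\pm$, $Ric^+_\delta(u_-,u_+)=\mathrm{tr}(E_+\ni w\mapsto R(w,u_-)u_+\in E_+)$, $Ric^-_\delta(u_+,u_-)=\mathrm{tr}(E_-\ni w\mapsto R(w,u_+)u_-\in E_-)$; these are known to be independent of the choice of $D$. $(H,\mathcal G_g,\delta)$ is a generalized Einstein structure if $Ric^+_\delta=0$ and $Ric^-_\delta=0$. *)

theory Defs
  imports "HOL-Analysis.Analysis"
begin

section \<open>Traces and matrices of endomorphisms\<close>

text \<open>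
  The trace of an endomorphism \<open>f\<close> of a finite-dimensional subspace \<open>V\<close>; the lemma
  \<open>trace_on_eq\<close> shows that the choice of the basis is irrelevant.
\<close>

definition trace_on :: "'b::real_vector set \<Rightarrow> ('b \<Rightarrow> 'b) \<Rightarrow> real" where
  "trace_on V f =
     (let B = (SOME B. independent B \<and> span B = V) in \<Sum>b\<in>B. representation B (f b) b)"

lemma trace_basis_change:
  fixes f :: "'b::real_vector \<Rightarrow> 'b"
  assumes B: "independent B" "span B = V" "finite B"
    and C: "independent C" "span C = V" "finite C"
    and f: "linear f" "f ` V \<subseteq> V"
  shows "(\<Sum>b\<in>B. representation B (f b) b) = (\<Sum>c\<in>C. representation C (f c) c)"
proof -
  have expand: "v = (\<Sum>s\<in>S. representation S v s *\<^sub>R s)"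
    if "independent S" "span S = V" "finite S" "v \<in> V" for S and v :: 'b
    using real_vector.sum_representation_eq[OF that(1) _ that(3) subset_refl] that by simp
  have BV: "b \<in> V" if "b \<in> B" for b using that B(2) by (auto intro: span_base)
  have CV: "c \<in> V" if "c \<in> C" for c using that C(2) by (auto intro: span_base)
  have BVC: "b \<in> span C" if "b \<in> B" for b using BV[OF that] C(2) by simp
  have fV: "f v \<in> V" if "v \<in> V" for v using that f(2) by auto
  have 1: "representation B (f b) b = (\<Sum>c\<in>C. representation C b c * representation B (f c) b)"
    if "b \<in> B" for b
  proof -
    have "f b = (\<Sum>c\<in>C. representation C b c *\<^sub>R f c)"
      by (subst expand[OF C BV[OF that]])
        (simp add: linear_sum[OF f(1)] linear_scale[OF f(1)])
    moreover have "f c \<in> span B" if "c \<in> C" for c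
      using B(2) CV[OF that] fV by simp
    ultimately show ?thesis
      using B(1) by (simp add: real_vector.representation_sum real_vector.representation_scale
          real_vector.span_scale)
  qed
  have 2: "representation C (f c) c = (\<Sum>b\<in>B. representation B (f c) b * representation C b c)"
    if "c \<in> C" for c
  proof -
    have "representation C (f c) c
      = representation C (\<Sum>b\<in>B. representation B (f c) b *\<^sub>R b) c"
      using expand[OF B fV[OF CV[OF that]]] by simp
    also have "\<dots> = (\<Sum>b\<in>B. representation B (f c) b * representation C b c)"
      using C(1) BVC by (simp add: real_vector.representation_sum real_vector.representation_scale
          real_vector.span_scale)
    finally show ?thesis .
  qed
  show ?thesis
    by (simp add: 1 2, subst sum.swap) (simp add: mult.commute)
qed

lemma trace_on_eq:
  fixes f :: "'b::real_vector \<Rightarrow> 'b"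
  assumes "independent B" "span B = V" "finite B" "linear f" "f ` V \<subseteq> V"
  shows "trace_on V f = (\<Sum>b\<in>B. representation B (f b) b)"
proof -
  define C where "C = (SOME C. independent C \<and> span C = V)"
  have C: "independent C" "span C = V"
    unfolding C_def using someI[of "\<lambda>C. independent C \<and> span C = V" B] assms by auto
  have "finite C"
    using real_vector.independent_span_bound[OF assms(3) C(1)] C(2) assms(2) span_superset
    by blast
  then show ?thesis
    unfolding trace_on_def C_def[symmetric] Let_def
    using trace_basis_change[OF C(1,2) _ assms(1,2,3,4,5)] by simp
qed

definition diagonalizable_on :: "'b::real_vector set \<Rightarrow> ('b \<Rightarrow> 'b) \<Rightarrow> bool" where
  "diagonalizable_on V f \<longleftrightarrow>
     (\<exists>B. independent B \<and> span B = V \<and> (\<forall>b\<in>B. \<exists>c. f b = c *\<^sub>R b))"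

definition eigenvalue_on :: "'b::real_vector set \<Rightarrow> ('b \<Rightarrow> 'b) \<Rightarrow> real \<Rightarrow> bool" where
  "eigenvalue_on V f c \<longleftrightarrow> (\<exists>w\<in>V. w \<noteq> 0 \<and> f w = c *\<^sub>R w)"

abbreviation mat22 :: "real \<Rightarrow> real \<Rightarrow> real \<Rightarrow> real \<Rightarrow> real^2^2" where
  "mat22 a b c d \<equiv> vector [vector [a, b], vector [c, d]]"

text \<open>Columns are the coordinates of the images of \<open>w\<^sub>1\<close> and \<open>w\<^sub>2\<close> in the basis \<open>(w\<^sub>1, w\<^sub>2)\<close>.\<close>

definition matrix_wrt :: "'b::real_vector \<Rightarrow> 'b \<Rightarrow> ('b \<Rightarrow> 'b) \<Rightarrow> real^2^2" where
  "matrix_wrt w\<^sub>1 w\<^sub>2 f =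
     (let x = representation {w\<^sub>1, w\<^sub>2}
      in mat22 (x (f w\<^sub>1) w\<^sub>1) (x (f w\<^sub>2) w\<^sub>1)
               (x (f w\<^sub>1) w\<^sub>2) (x (f w\<^sub>2) w\<^sub>2))"

text \<open>Algebraic multiplicity two: the characteristic polynomial is \<open>(x - c)\<^sup>2\<close>.\<close>

definition has_double_eigenvalue :: "real^2^2 \<Rightarrow> bool" where
  "has_double_eigenvalue A \<longleftrightarrow> (\<exists>c. \<forall>x. det (mat x - A) = (x - c)^2)"


section \<open>Lie algebras with metric and three-form\<close>

text \<open>
  The Lie algebra is a finite-dimensional real vector space \<open>'a\<close> with a bracket; the inner
  product that comes with the class \<open>euclidean_space\<close> plays no role. On finite-dimensional
  spaces bounded linear maps are just linear maps, so \<open>'a \<Rightarrow>\<^sub>L real\<close> is the dual space, and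
  multilinear maps are given in curried form. In particular, \<open>br X\<close> is the endomorphism
  \<open>ad\<^sub>X\<close>, \<open>g X\<close> is the one-form \<open>g(X,\<cdot>)\<close> and \<open>H X Y\<close> is the one-form \<open>H(X,Y,\<cdot>)\<close>.
\<close>

definition lie_bracket :: "('a::euclidean_space \<Rightarrow>\<^sub>L 'a \<Rightarrow>\<^sub>L 'a) \<Rightarrow> bool" where
  "lie_bracket br \<longleftrightarrow>
     (\<forall>X. br X X = 0) \<and>
     (\<forall>X Y Z. br X (br Y Z) + br Y (br Z X) + br Z (br X Y) = 0)"

definition unimodular_kernel :: "('a::euclidean_space \<Rightarrow>\<^sub>L 'a \<Rightarrow>\<^sub>L 'a) \<Rightarrow> 'a set" where
  "unimodular_kernel br = {X. trace_on UNIV (br X) = 0}"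

definition nondegenerate_on :: "'a::euclidean_space set \<Rightarrow> ('a \<Rightarrow>\<^sub>L 'a \<Rightarrow>\<^sub>L real) \<Rightarrow> bool" where
  "nondegenerate_on V g \<longleftrightarrow> (\<forall>X\<in>V. (\<forall>Y\<in>V. g X Y = 0) \<longrightarrow> X = 0)"

definition pseudo_metric :: "('a::euclidean_space \<Rightarrow>\<^sub>L 'a \<Rightarrow>\<^sub>L real) \<Rightarrow> bool" where
  "pseudo_metric g \<longleftrightarrow> (\<forall>X Y. g X Y = g Y X) \<and> nondegenerate_on UNIV g"

definition three_form :: "('a::euclidean_space \<Rightarrow>\<^sub>L 'a \<Rightarrow>\<^sub>L 'a \<Rightarrow>\<^sub>L real) \<Rightarrow> bool" where
  "three_form H \<longleftrightarrow> (\<forall>X Y. H X X Y = 0 \<and> H X Y X = 0 \<and> H X Y Y = 0)"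

definition orthonormal_basis :: "('a::euclidean_space \<Rightarrow>\<^sub>L 'a \<Rightarrow>\<^sub>L real) \<Rightarrow> 'a \<Rightarrow> 'a \<Rightarrow> 'a \<Rightarrow> bool" where
  "orthonormal_basis g v\<^sub>1 v\<^sub>2 v\<^sub>3 \<longleftrightarrow>
     distinct [v\<^sub>1, v\<^sub>2, v\<^sub>3] \<and> independent {v\<^sub>1, v\<^sub>2, v\<^sub>3} \<and> span {v\<^sub>1, v\<^sub>2, v\<^sub>3} = UNIV \<and>
     g v\<^sub>1 v\<^sub>2 = 0 \<and> g v\<^sub>1 v\<^sub>3 = 0 \<and> g v\<^sub>2 v\<^sub>3 = 0 \<and>
     \<bar>g v\<^sub>1 v\<^sub>1\<bar> = 1 \<and> \<bar>g v\<^sub>2 v\<^sub>2\<bar> = 1 \<and> \<bar>g v\<^sub>3 v\<^sub>3\<bar> = 1"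

definition adapted_basis ::
  "('a::euclidean_space \<Rightarrow>\<^sub>L 'a \<Rightarrow>\<^sub>L 'a) \<Rightarrow> ('a \<Rightarrow>\<^sub>L 'a \<Rightarrow>\<^sub>L real) \<Rightarrow> 'a \<Rightarrow> 'a \<Rightarrow> 'a \<Rightarrow> bool" where
  "adapted_basis br g v\<^sub>1 v\<^sub>2 v\<^sub>3 \<longleftrightarrow>
     orthonormal_basis g v\<^sub>1 v\<^sub>2 v\<^sub>3 \<and>
     v\<^sub>1 \<in> unimodular_kernel br \<and> v\<^sub>3 \<in> unimodular_kernel br \<and>
     g v\<^sub>1 v\<^sub>1 = g v\<^sub>2 v\<^sub>2 \<and> g v\<^sub>2 v\<^sub>2 = - g v\<^sub>3 v\<^sub>3"


section \<open>Generalized geometry on \<open>E = \<gg> \<oplus> \<gg>\<^sup>*\<close>\<close>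

text \<open>The pair \<open>(X, \<xi>)\<close> stands for \<open>X + \<xi>\<close>.\<close>

type_synonym 'a gen = "'a \<times> ('a \<Rightarrow>\<^sub>L real)"

definition pairing :: "'a::euclidean_space gen \<Rightarrow> 'a gen \<Rightarrow> real" where
  "pairing u v = (snd u (fst v) + snd v (fst u)) / 2"

definition dorfman ::
  "('a::euclidean_space \<Rightarrow>\<^sub>L 'a \<Rightarrow>\<^sub>L 'a) \<Rightarrow> ('a \<Rightarrow>\<^sub>L 'a \<Rightarrow>\<^sub>L 'a \<Rightarrow>\<^sub>L real) \<Rightarrow> 'a gen \<Rightarrow> 'a gen \<Rightarrow> 'a gen" where
  "dorfman br H u v =
     (br (fst u) (fst v),
      - (snd v o\<^sub>L br (fst u)) + (snd u o\<^sub>L br (fst v)) + H (fst u) (fst v))"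

definition E_plus :: "('a::euclidean_space \<Rightarrow>\<^sub>L 'a \<Rightarrow>\<^sub>L real) \<Rightarrow> 'a gen set" where
  "E_plus g = range (\<lambda>X. (X, g X))"

definition E_minus :: "('a::euclidean_space \<Rightarrow>\<^sub>L 'a \<Rightarrow>\<^sub>L real) \<Rightarrow> 'a gen set" where
  "E_minus g = range (\<lambda>X. (X, - g X))"

text \<open>
  For a basis \<open>v\<^sub>1, v\<^sub>2, v\<^sub>3\<close> the components of \<open>\<delta>\<close> are \<open>\<delta>\<^sub>a = delta_plus g \<delta> v\<^sub>a\<close> and
  \<open>\<delta>\<^sub>a\<^sub>+\<^sub>3 = delta_minus g \<delta> v\<^sub>a\<close>.
\<close>

definition delta_plus :: "('a::euclidean_space \<Rightarrow>\<^sub>L 'a \<Rightarrow>\<^sub>L real) \<Rightarrow> ('a gen \<Rightarrow>\<^sub>L real) \<Rightarrow> 'a \<Rightarrow> real" where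
  "delta_plus g \<delta> v = \<delta> (v, g v)"

definition delta_minus :: "('a::euclidean_space \<Rightarrow>\<^sub>L 'a \<Rightarrow>\<^sub>L real) \<Rightarrow> ('a gen \<Rightarrow>\<^sub>L real) \<Rightarrow> 'a \<Rightarrow> real" where
  "delta_minus g \<delta> v = \<delta> (v, - g v)"

definition pairing_adjoint :: "('a::euclidean_space gen \<Rightarrow> 'a gen) \<Rightarrow> 'a gen \<Rightarrow> 'a gen" where
  "pairing_adjoint A = (THE B. \<forall>v w. pairing (B v) w = pairing v (A w))"

definition generalized_connection :: "('a::euclidean_space gen \<Rightarrow>\<^sub>L 'a gen \<Rightarrow>\<^sub>L 'a gen) \<Rightarrow> bool" where
  "generalized_connection D \<longleftrightarrow> (\<forall>u v w. pairing (D u v) w + pairing v (D u w) = 0)"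

definition torsion ::
  "('a::euclidean_space \<Rightarrow>\<^sub>L 'a \<Rightarrow>\<^sub>L 'a) \<Rightarrow> ('a \<Rightarrow>\<^sub>L 'a \<Rightarrow>\<^sub>L 'a \<Rightarrow>\<^sub>L real) \<Rightarrow>
   ('a gen \<Rightarrow>\<^sub>L 'a gen \<Rightarrow>\<^sub>L 'a gen) \<Rightarrow> 'a gen \<Rightarrow> 'a gen \<Rightarrow> 'a gen" where
  "torsion br H D u v = D u v - D v u - dorfman br H u v + pairing_adjoint (\<lambda>w. D w u) v"

definition levi_civita ::
  "('a::euclidean_space \<Rightarrow>\<^sub>L 'a \<Rightarrow>\<^sub>L 'a) \<Rightarrow> ('a \<Rightarrow>\<^sub>L 'a \<Rightarrow>\<^sub>L 'a \<Rightarrow>\<^sub>L real) \<Rightarrow> ('a \<Rightarrow>\<^sub>L 'a \<Rightarrow>\<^sub>L real) \<Rightarrow>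
   ('a gen \<Rightarrow>\<^sub>L 'a gen \<Rightarrow>\<^sub>L 'a gen) \<Rightarrow> bool" where
  "levi_civita br H g D \<longleftrightarrow>
     generalized_connection D \<and> (\<forall>u v. torsion br H D u v = 0) \<and>
     (\<forall>u. D u ` E_plus g \<subseteq> E_plus g \<and> D u ` E_minus g \<subseteq> E_minus g)"

definition divergence :: "('a::euclidean_space gen \<Rightarrow>\<^sub>L 'a gen \<Rightarrow>\<^sub>L 'a gen) \<Rightarrow> 'a gen \<Rightarrow> real" where
  "divergence D v = trace_on UNIV (\<lambda>u. D u v)"

definition curvature ::
  "('a::euclidean_space \<Rightarrow>\<^sub>L 'a \<Rightarrow>\<^sub>L 'a) \<Rightarrow> ('a \<Rightarrow>\<^sub>L 'a \<Rightarrow>\<^sub>L 'a \<Rightarrow>\<^sub>L real) \<Rightarrow>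
   ('a gen \<Rightarrow>\<^sub>L 'a gen \<Rightarrow>\<^sub>L 'a gen) \<Rightarrow> 'a gen \<Rightarrow> 'a gen \<Rightarrow> 'a gen \<Rightarrow> 'a gen" where
  "curvature br H D u v w = D u (D v w) - D v (D u w) - D (dorfman br H u v) w"

definition ricci_plus ::
  "('a::euclidean_space \<Rightarrow>\<^sub>L 'a \<Rightarrow>\<^sub>L 'a) \<Rightarrow> ('a \<Rightarrow>\<^sub>L 'a \<Rightarrow>\<^sub>L 'a \<Rightarrow>\<^sub>L real) \<Rightarrow> ('a \<Rightarrow>\<^sub>L 'a \<Rightarrow>\<^sub>L real) \<Rightarrow>
   ('a gen \<Rightarrow>\<^sub>L 'a gen \<Rightarrow>\<^sub>L 'a gen) \<Rightarrow> 'a gen \<Rightarrow> 'a gen \<Rightarrow> real" where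
  "ricci_plus br H g D u\<^sub>m u\<^sub>p = trace_on (E_plus g) (\<lambda>w. curvature br H D w u\<^sub>m u\<^sub>p)"

definition ricci_minus ::
  "('a::euclidean_space \<Rightarrow>\<^sub>L 'a \<Rightarrow>\<^sub>L 'a) \<Rightarrow> ('a \<Rightarrow>\<^sub>L 'a \<Rightarrow>\<^sub>L 'a \<Rightarrow>\<^sub>L real) \<Rightarrow> ('a \<Rightarrow>\<^sub>L 'a \<Rightarrow>\<^sub>L real) \<Rightarrow>
   ('a gen \<Rightarrow>\<^sub>L 'a gen \<Rightarrow>\<^sub>L 'a gen) \<Rightarrow> 'a gen \<Rightarrow> 'a gen \<Rightarrow> real" where
  "ricci_minus br H g D u\<^sub>p u\<^sub>m = trace_on (E_minus g) (\<lambda>w. curvature br H D w u\<^sub>p u\<^sub>m)"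

text \<open>
  The Ricci tensors do not depend on the Levi-Civita generalized connection with divergence
  \<open>\<delta>\<close>, and such a connection exists, so it is enough to ask for one of them to be Ricci flat.
  The generalized metric enters through its eigenbundles \<open>E_plus g\<close> and \<open>E_minus g\<close> only.
\<close>

definition generalized_einstein ::
  "('a::euclidean_space \<Rightarrow>\<^sub>L 'a \<Rightarrow>\<^sub>L 'a) \<Rightarrow> ('a \<Rightarrow>\<^sub>L 'a \<Rightarrow>\<^sub>L 'a \<Rightarrow>\<^sub>L real) \<Rightarrow> ('a \<Rightarrow>\<^sub>L 'a \<Rightarrow>\<^sub>L real) \<Rightarrow>
   ('a gen \<Rightarrow>\<^sub>L real) \<Rightarrow> bool" where
  "generalized_einstein br H g \<delta> \<longleftrightarrow>
     (\<exists>D. levi_civita br H g D \<and> (\<forall>v. divergence D v = \<delta> v) \<and>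
        (\<forall>u\<^sub>m\<in>E_minus g. \<forall>u\<^sub>p\<in>E_plus g. ricci_plus br H g D u\<^sub>m u\<^sub>p = 0 \<and> ricci_minus br H g D u\<^sub>p u\<^sub>m = 0))"


section \<open>The families of solutions with two distinct real eigenvalues\<close>

definition distinct_eigenvalue_families ::
  "real \<Rightarrow> real \<Rightarrow> real \<Rightarrow> real \<Rightarrow> real \<Rightarrow> real \<Rightarrow> real \<Rightarrow> real \<Rightarrow> real \<Rightarrow> real \<Rightarrow> real^2^2 \<Rightarrow> bool" where
  "distinct_eigenvalue_families \<epsilon>\<^sub>1 \<epsilon>\<^sub>2 \<epsilon>\<^sub>3 h \<delta>\<^sub>1 \<delta>\<^sub>2 \<delta>\<^sub>3 \<delta>\<^sub>4 \<delta>\<^sub>5 \<delta>\<^sub>6 M \<longleftrightarrow>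
     (\<exists>l \<mu>. l \<noteq> 0 \<and> \<mu> \<noteq> 0 \<and> \<bar>\<mu>\<bar> \<noteq> \<bar>l\<bar> \<and>
        (h = 2 * l \<or> h = - 2 * l) \<and> \<delta>\<^sub>2 = - 2 * \<epsilon>\<^sub>2 * l \<and> \<delta>\<^sub>5 = - 2 * \<epsilon>\<^sub>2 * l \<and>
        \<delta>\<^sub>1 = 0 \<and> \<delta>\<^sub>3 = 0 \<and> \<delta>\<^sub>4 = 0 \<and> \<delta>\<^sub>6 = 0 \<and>
        M = mat22 (\<epsilon>\<^sub>1 * l) (- \<epsilon>\<^sub>1 * \<mu>) (\<epsilon>\<^sub>3 * \<mu>) (- \<epsilon>\<^sub>3 * l)) \<or>
     (\<exists>\<mu> \<nu>. \<mu> - \<nu> \<noteq> 0 \<and>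
        h = \<mu> - \<nu> \<and> \<delta>\<^sub>2 = \<epsilon>\<^sub>2 * (- \<mu> + \<nu>) \<and> \<delta>\<^sub>5 = \<epsilon>\<^sub>2 * (- \<mu> + \<nu>) \<and>
        \<delta>\<^sub>4 = 0 \<and> \<delta>\<^sub>6 = 0 \<and> \<mu> * \<delta>\<^sub>1 - \<nu> * \<delta>\<^sub>3 = 0 \<and>
        M = mat22 (\<epsilon>\<^sub>1 * \<mu>) (\<epsilon>\<^sub>1 * \<nu>) (\<epsilon>\<^sub>3 * \<mu>) (\<epsilon>\<^sub>3 * \<nu>)) \<or>
     (\<exists>\<mu> \<nu>. \<mu> - \<nu> \<noteq> 0 \<and>
        h = \<mu> - \<nu> \<and> \<delta>\<^sub>2 = \<epsilon>\<^sub>2 * (\<mu> - \<nu>) \<and> \<delta>\<^sub>5 = \<epsilon>\<^sub>2 * (\<mu> - \<nu>) \<and>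
        \<delta>\<^sub>4 = 0 \<and> \<delta>\<^sub>6 = 0 \<and> \<mu> * \<delta>\<^sub>1 + \<nu> * \<delta>\<^sub>3 = 0 \<and>
        M = mat22 (- \<epsilon>\<^sub>1 * \<mu>) (\<epsilon>\<^sub>1 * \<nu>) (\<epsilon>\<^sub>3 * \<mu>) (- \<epsilon>\<^sub>3 * \<nu>)) \<or>
     (\<exists>\<mu>. \<mu> \<noteq> 0 \<and>
        h = 2 * \<mu> \<and> \<delta>\<^sub>2 = 2 * \<epsilon>\<^sub>2 * \<mu> \<and> \<delta>\<^sub>5 = 2 * \<epsilon>\<^sub>2 * \<mu> \<and>
        \<delta>\<^sub>1 = \<delta>\<^sub>3 \<and> \<delta>\<^sub>4 = 0 \<and> \<delta>\<^sub>6 = 0 \<and>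
        M = mat22 (- \<epsilon>\<^sub>1 * \<mu>) (- \<epsilon>\<^sub>1 * \<mu>) (\<epsilon>\<^sub>3 * \<mu>) (\<epsilon>\<^sub>3 * \<mu>)) \<or>
     (\<exists>\<mu>. \<mu> \<noteq> 0 \<and>
        h = 2 * \<mu> \<and> \<delta>\<^sub>2 = - 2 * \<epsilon>\<^sub>2 * \<mu> \<and> \<delta>\<^sub>5 = - 2 * \<epsilon>\<^sub>2 * \<mu> \<and>
        \<delta>\<^sub>1 = - \<delta>\<^sub>3 \<and> \<delta>\<^sub>4 = 0 \<and> \<delta>\<^sub>6 = 0 \<and>
        M = mat22 (\<epsilon>\<^sub>1 * \<mu>) (- \<epsilon>\<^sub>1 * \<mu>) (\<epsilon>\<^sub>3 * \<mu>) (- \<epsilon>\<^sub>3 * \<mu>)) \<or>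
     (\<exists>\<mu> \<nu>. \<mu> - \<nu> \<noteq> 0 \<and>
        h = \<nu> - \<mu> \<and> \<delta>\<^sub>2 = \<epsilon>\<^sub>2 * (\<nu> - \<mu>) \<and> \<delta>\<^sub>5 = \<epsilon>\<^sub>2 * (\<nu> - \<mu>) \<and>
        \<delta>\<^sub>1 = 0 \<and> \<delta>\<^sub>3 = 0 \<and> \<mu> * \<delta>\<^sub>4 - \<nu> * \<delta>\<^sub>6 = 0 \<and>
        M = mat22 (\<epsilon>\<^sub>1 * \<mu>) (\<epsilon>\<^sub>1 * \<nu>) (\<epsilon>\<^sub>3 * \<mu>) (\<epsilon>\<^sub>3 * \<nu>)) \<or>
     (\<exists>\<mu> \<nu>. \<mu> - \<nu> \<noteq> 0 \<and>
        h = \<nu> - \<mu> \<and> \<delta>\<^sub>2 = \<epsilon>\<^sub>2 * (\<mu> - \<nu>) \<and> \<delta>\<^sub>5 = \<epsilon>\<^sub>2 * (\<mu> - \<nu>) \<and>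
        \<delta>\<^sub>1 = 0 \<and> \<delta>\<^sub>3 = 0 \<and> \<mu> * \<delta>\<^sub>4 + \<nu> * \<delta>\<^sub>6 = 0 \<and>
        M = mat22 (- \<epsilon>\<^sub>1 * \<mu>) (\<epsilon>\<^sub>1 * \<nu>) (\<epsilon>\<^sub>3 * \<mu>) (- \<epsilon>\<^sub>3 * \<nu>)) \<or>
     (\<exists>\<mu>. \<mu> \<noteq> 0 \<and>
        h = - 2 * \<mu> \<and> \<delta>\<^sub>2 = 2 * \<epsilon>\<^sub>2 * \<mu> \<and> \<delta>\<^sub>5 = 2 * \<epsilon>\<^sub>2 * \<mu> \<and>
        \<delta>\<^sub>1 = 0 \<and> \<delta>\<^sub>3 = 0 \<and> \<delta>\<^sub>4 = \<delta>\<^sub>6 \<and>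
        M = mat22 (- \<epsilon>\<^sub>1 * \<mu>) (- \<epsilon>\<^sub>1 * \<mu>) (\<epsilon>\<^sub>3 * \<mu>) (\<epsilon>\<^sub>3 * \<mu>)) \<or>
     (\<exists>\<mu>. \<mu> \<noteq> 0 \<and>
        h = - 2 * \<mu> \<and> \<delta>\<^sub>2 = - 2 * \<epsilon>\<^sub>2 * \<mu> \<and> \<delta>\<^sub>5 = - 2 * \<epsilon>\<^sub>2 * \<mu> \<and>
        \<delta>\<^sub>1 = 0 \<and> \<delta>\<^sub>3 = 0 \<and> \<delta>\<^sub>4 = - \<delta>\<^sub>6 \<and>
        M = mat22 (\<epsilon>\<^sub>1 * \<mu>) (- \<epsilon>\<^sub>1 * \<mu>) (\<epsilon>\<^sub>3 * \<mu>) (- \<epsilon>\<^sub>3 * \<mu>))"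

end

(*
  Identify both E_+ and E_- with g by X |-> (X, s g X), s = 1 or -1. Vanishing torsion determines
  the mixed part of any Levi-Civita D, namely D_u v for u, v in opposite halves: it is the
  connection nabla^s with torsion s H, that is 2 g(nabla^s_X Y, Z) = (Koszul form) + s H(X,Y,Z).
  In the trace that defines Ric, the unknown pure part of D enters through its divergence and
  through a term of the form tr(AB) - tr(BA) only, so that

    Ric_s(X,Y) = delta_s(nabla^s_X Y) - tr(W |-> nabla^s_(nabla^(-s)_W X) Y).

  In an orthonormal basis with v_1, v_3 in the (abelian) kernel, the components of the Einstein
  equation are polynomial equations in the entries of ad v_2, h and delta.
  The (v_2,v_2) component forces the metric on the kernel to be indefinite.
*)
theory Submission
  imports Defs
begin

text \<open>Family list (b2) is an equivalence, and a generalized Einstein structure is defined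
  through the existence of a suitable D. So the formula for Ric is not enough: for every
  \<open>\<delta>\<close> a Levi-Civita D with that divergence has to be constructed.

  The equations for s = 1 and s = -1 are one system in which only the sign of h and the components
  of \<open>\<delta>\<close> differ. Subtracting its two diagonal equations gives (tr M)
  \<open>\<delta>\<^sub>2\<close> = -h^2. This does not see the sign of h, and tr M is nonzero, so
  \<open>\<delta>\<^sub>2 = \<delta>\<^sub>5\<close>, and this number vanishes exactly when h does.
  If h = 0, M has opposite off-diagonal entries and a Lorentz boost of the kernel normalizes it. If
  h is nonzero, h = tr M or h = -tr M, and M either has equal diagonal and equal off-diagonal
  entries or is singular. For singular M the sign of h decides which half may carry nonzero
  components of \<open>\<delta>\<close> along the kernel, which separates families 2 from families
  3.\<close>

section \<open>Orthogonal bases of bilinear forms\<close>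

text \<open>Dividing by \<open>\<beta> b b\<close> makes all formulas independent of the signature.
  The locale is used for \<open>g\<close>, for \<open>pairing\<close> on E and on each half, and for
  the Euclidean inner product.\<close>

locale orthogonal_system =
  fixes \<beta> :: "'b::real_vector \<Rightarrow> 'b \<Rightarrow> real" and B :: "'b set"
  assumes linear_form: "\<And>w. linear (\<lambda>v. \<beta> v w)"
    and finite_B: "finite B"
    and orthogonal: "\<And>b c. b \<in> B \<Longrightarrow> c \<in> B \<Longrightarrow> b \<noteq> c \<Longrightarrow> \<beta> b c = 0"
    and nonnull: "\<And>b. b \<in> B \<Longrightarrow> \<beta> b b \<noteq> 0"
begin

lemma form_sum_scale:
  assumes "c \<in> B"
  shows "\<beta> (\<Sum>b\<in>B. x b *\<^sub>R b) c = x c * \<beta> c c"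
proof -
  have "\<beta> (\<Sum>b\<in>B. x b *\<^sub>R b) c = (\<Sum>b\<in>B. x b * \<beta> b c)"
    by (simp add: linear_sum[OF linear_form] linear_scale[OF linear_form])
  also have "\<dots> = (\<Sum>b\<in>B. if b = c then x c * \<beta> c c else 0)"
    using orthogonal assms by (intro sum.cong) auto
  finally show ?thesis
    using assms finite_B by simp
qed

lemma independent: "independent B"
proof (rule independent_if_scalars_zero[OF finite_B])
  fix x c assume "(\<Sum>b\<in>B. x b *\<^sub>R b) = 0" and c: "c \<in> B"
  then show "x c = 0"
    using form_sum_scale[OF c, of x] nonnull[OF c] linear_0[OF linear_form] by simp
qed

lemma representation_eq:
  assumes "v \<in> span B" "c \<in> B"
  shows "representation B v c = \<beta> v c / \<beta> c c"
proof -
  have "v = (\<Sum>b\<in>B. representation B v b *\<^sub>R b)"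
    using real_vector.sum_representation_eq[OF independent assms(1) finite_B subset_refl] by simp
  then have "\<beta> v c = representation B v c * \<beta> c c"
    using form_sum_scale[OF assms(2), of "representation B v"] by simp
  then show ?thesis
    using nonnull[OF assms(2)] by simp
qed

lemma expansion:
  assumes "v \<in> span B"
  shows "v = (\<Sum>b\<in>B. (\<beta> v b / \<beta> b b) *\<^sub>R b)"
proof -
  have "v = (\<Sum>b\<in>B. representation B v b *\<^sub>R b)"
    using real_vector.sum_representation_eq[OF independent assms(1) finite_B subset_refl] by simp
  then show ?thesis
    using representation_eq[OF assms] by simp
qed

lemma eqI:
  assumes "v \<in> span B" "w \<in> span B" "\<And>b. b \<in> B \<Longrightarrow> \<beta> v b = \<beta> w b"
  shows "v = w"
proof -
  have "(\<Sum>b\<in>B. (\<beta> v b / \<beta> b b) *\<^sub>R b) = (\<Sum>b\<in>B. (\<beta> w b / \<beta> b b) *\<^sub>R b)"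
    using assms(3) by (intro sum.cong) auto
  then show ?thesis
    using expansion assms(1,2) by metis
qed

lemma trace_on_span:
  assumes "linear f" "f ` span B \<subseteq> span B"
  shows "trace_on (span B) f = (\<Sum>b\<in>B. \<beta> (f b) b / \<beta> b b)"
proof -
  have "representation B (f b) b = \<beta> (f b) b / \<beta> b b" if "b \<in> B" for b
    using assms(2) that by (intro representation_eq) (auto simp: span_base)
  then show ?thesis
    using trace_on_eq[OF independent refl finite_B assms] by simp
qed

lemma trace_commute:
  assumes "linear f" "linear k" "f ` span B \<subseteq> span B" "k ` span B \<subseteq> span B"
  shows "(\<Sum>b\<in>B. \<beta> (f (k b)) b / \<beta> b b) = (\<Sum>b\<in>B. \<beta> (k (f b)) b / \<beta> b b)"
proof -
  have *: "\<beta> (f (k b)) b / \<beta> b b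
      = (\<Sum>c\<in>B. (\<beta> (k b) c / \<beta> c c) * (\<beta> (f c) b / \<beta> b b))"
    if "b \<in> B" "linear f" "k ` span B \<subseteq> span B" for f k :: "'b \<Rightarrow> 'b" and b
  proof -
    have "k b \<in> span B"
      using that by (auto simp: span_base)
    have "f (k b) = (\<Sum>c\<in>B. (\<beta> (k b) c / \<beta> c c) *\<^sub>R f c)"
      by (subst expansion[OF \<open>k b \<in> span B\<close>])
        (simp add: linear_sum[OF that(2)] linear_scale[OF that(2)])
    then show ?thesis
      by (simp add: linear_sum[OF linear_form] linear_scale[OF linear_form] sum_divide_distrib)
  qed
  have "(\<Sum>b\<in>B. \<beta> (f (k b)) b / \<beta> b b)
      = (\<Sum>b\<in>B. \<Sum>c\<in>B. (\<beta> (k b) c / \<beta> c c) * (\<beta> (f c) b / \<beta> b b))"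
    using assms * by (intro sum.cong) auto
  also have "\<dots> = (\<Sum>c\<in>B. \<Sum>b\<in>B. (\<beta> (f c) b / \<beta> b b) * (\<beta> (k b) c / \<beta> c c))"
    by (subst sum.swap) (simp add: mult.commute)
  also have "\<dots> = (\<Sum>b\<in>B. \<beta> (k (f b)) b / \<beta> b b)"
    using assms * by (intro sum.cong) auto
  finally show ?thesis .
qed

end

lemma linear_eq_on_spanning:
  assumes "linear f" "linear k" "span B = UNIV" "\<And>b. b \<in> B \<Longrightarrow> f b = k b"
  shows "f v = k v"
  using linear_eq_on_span[of f k B v] assms by auto

lemma linear_blinfun: "linear (blinfun_apply f)"
  by (rule bounded_linear.linear) (rule blinfun.bounded_linear_right)

section \<open>The splitting of the generalized tangent space\<close>

text \<open>The sign \<open>s\<close> lets one argument cover both eigenbundles: X_s stands for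
  \<open>lift g s X\<close>, and the half opposite to s is that of \<open>- s\<close>.\<close>

definition lift :: "('a::euclidean_space \<Rightarrow>\<^sub>L 'a \<Rightarrow>\<^sub>L real) \<Rightarrow> real \<Rightarrow> 'a \<Rightarrow> 'a gen" where
  "lift g s X = (X, s *\<^sub>R g X)"

lemma E_plus_eq: "E_plus g = range (lift g 1)"
  by (simp add: E_plus_def lift_def)

lemma E_minus_eq: "E_minus g = range (lift g (-1))"
  by (simp add: E_minus_def lift_def)

lemma lift_eq_iff [simp]: "lift g s X = lift g s Y \<longleftrightarrow> X = Y"
  by (auto simp: lift_def)

lemma linear_lift: "linear (lift g s)"
  by (rule linearI) (auto simp: lift_def blinfun.bilinear_simps scaleR_add_right)

lemma bounded_bilinear_pairing: "bounded_bilinear (pairing :: 'a::euclidean_space gen \<Rightarrow> _)"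
proof
  fix u v w :: "'a gen" and r :: real
  show "pairing (u + v) w = pairing u w + pairing v w"
    by (simp add: pairing_def blinfun.bilinear_simps field_simps)
  show "pairing u (v + w) = pairing u v + pairing u w"
    by (simp add: pairing_def blinfun.bilinear_simps field_simps)
  show "pairing (r *\<^sub>R u) v = r *\<^sub>R pairing u v"
    by (simp add: pairing_def blinfun.bilinear_simps field_simps)
  show "pairing u (r *\<^sub>R v) = r *\<^sub>R pairing u v"
    by (simp add: pairing_def blinfun.bilinear_simps field_simps)
  show "\<exists>K. \<forall>u v :: 'a gen. norm (pairing u v) \<le> norm u * norm v * K"
  proof (intro exI[of _ 1] allI)
    fix u v :: "'a gen"
    have "norm (snd u (fst v)) \<le> norm u * norm v" for u v :: "'a gen"
    proof -
      have "norm (snd u (fst v)) \<le> norm (snd u) * norm (fst v)"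
        by (rule norm_blinfun)
      also have "\<dots> \<le> norm u * norm v"
        by (metis mult_mono norm_fst_le norm_snd_le norm_ge_zero prod.collapse)
      finally show ?thesis .
    qed
    from this[of u v] this[of v u] show "norm (pairing u v) \<le> norm u * norm v * 1"
      by (simp add: pairing_def mult.commute[of "norm v"])
  qed
qed

interpretation pairing: bounded_bilinear pairing
  by (rule bounded_bilinear_pairing)

lemma pairing_commute: "pairing u v = pairing v u"
  by (simp add: pairing_def)

lemma linear_pairing_left: "linear (\<lambda>u. pairing u v)"
  using pairing.bounded_linear_left by (rule bounded_linear.linear)

lemma linear_pairing_right: "linear (pairing u)"
  using pairing.bounded_linear_right by (rule bounded_linear.linear)

lemma pairing_dorfman:
  "pairing (dorfman br H u v) w
    = (snd w (br (fst u) (fst v)) - snd v (br (fst u) (fst w)) + snd u (br (fst v) (fst w))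
       + H (fst u) (fst v) (fst w)) / 2"
  by (simp add: dorfman_def pairing_def blinfun.bilinear_simps)

lemma linear_dorfman_left: "linear (\<lambda>u. dorfman br H u v)"
  by (rule linearI)
    (auto simp: dorfman_def prod_eq_iff blinfun.bilinear_simps algebra_simps intro!: blinfun_eqI)

lemma linear_dorfman_right: "linear (dorfman br H u)"
  by (rule linearI)
    (auto simp: dorfman_def prod_eq_iff blinfun.bilinear_simps algebra_simps intro!: blinfun_eqI)

lemma lie_bracket_antisym:
  assumes "lie_bracket br" shows "br X Y = - br Y X"
proof -
  have "br (X + Y) (X + Y) = 0" "br X X = 0" "br Y Y = 0"
    using assms by (auto simp: lie_bracket_def)
  then show ?thesis
    by (simp add: blinfun.bilinear_simps eq_neg_iff_add_eq_0 add.commute)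
qed

lemma three_form_antisym:
  assumes "three_form H"
  shows "H X Y Z = - H Y X Z" "H X Y Z = - H X Z Y"
proof -
  have "H (X + Y) (X + Y) Z = 0" "H X X Z = 0" "H Y Y Z = 0"
    using assms by (auto simp: three_form_def)
  then show "H X Y Z = - H Y X Z"
    by (simp add: blinfun.bilinear_simps)
  have "H X (Y + Z) (Y + Z) = 0" "H X Z Z = 0" "H X Y Y = 0"
    using assms unfolding three_form_def by blast+
  then show "H X Y Z = - H X Z Y"
    by (simp add: blinfun.bilinear_simps)
qed

text \<open>A spanning orthogonal set without null vectors encodes that \<open>g\<close> is
  non-degenerate. Dimension and signature stay open, so the Ricci formula is proved without a choice
  of frame in dimension three.\<close>

locale metric_lie_algebra =
  fixes br :: "'a::euclidean_space \<Rightarrow>\<^sub>L 'a \<Rightarrow>\<^sub>L 'a"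
    and g :: "'a \<Rightarrow>\<^sub>L 'a \<Rightarrow>\<^sub>L real"
    and H :: "'a \<Rightarrow>\<^sub>L 'a \<Rightarrow>\<^sub>L 'a \<Rightarrow>\<^sub>L real"
    and B :: "'a set"
  assumes lie: "lie_bracket br"
    and g_commute: "g X Y = g Y X"
    and H_form: "three_form H"
    and span_B: "span B = UNIV"
    and B_finite: "finite B"
    and B_orthogonal: "b \<in> B \<Longrightarrow> c \<in> B \<Longrightarrow> b \<noteq> c \<Longrightarrow> g b c = 0"
    and B_nonnull: "b \<in> B \<Longrightarrow> g b b \<noteq> 0"
begin

sublocale base: orthogonal_system "\<lambda>X Y. g X Y" B
proof (rule orthogonal_system.intro)
  show "\<And>w. linear (\<lambda>v. g v w)"
    by (rule linearI) (auto simp: blinfun.bilinear_simps)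
qed (use B_finite B_orthogonal B_nonnull in auto)

lemma pairing_lift: "pairing (lift g s X) (lift g t Y) = (s + t) / 2 * g X Y"
  by (simp add: pairing_def lift_def blinfun.bilinear_simps g_commute[of Y X] field_simps)

lemma pairing_lift_opp [simp]:
  "pairing (lift g s X) (lift g (- s) Y) = 0" "pairing (lift g (- s) X) (lift g s Y) = 0"
  by (simp_all add: pairing_lift)

lemma pairing_lift_same [simp]: "pairing (lift g s X) (lift g s Y) = s * g X Y"
  by (simp add: pairing_lift)

section \<open>An orthogonal basis of E adapted to its two halves\<close>

definition E_basis :: "'a gen set" where
  "E_basis = lift g 1 ` B \<union> lift g (-1) ` B"

lemma one_form_eq:
  fixes \<xi> :: "'a \<Rightarrow>\<^sub>L real"
  shows "\<xi> = g (\<Sum>b\<in>B. (\<xi> b / g b b) *\<^sub>R b)"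
proof (rule blinfun_eqI)
  fix X
  show "\<xi> X = g (\<Sum>b\<in>B. (\<xi> b / g b b) *\<^sub>R b) X"
    by (rule linear_eq_on_spanning[OF _ _ span_B])
      (simp_all add: linear_blinfun base.form_sum_scale B_nonnull)
qed

lemma span_lift: "span (lift g s ` B) = range (lift g s)"
  by (simp add: linear_span_image[OF linear_lift] span_B)

lemma span_E_basis: "span E_basis = UNIV"
proof -
  have "u \<in> span E_basis" for u
  proof -
    obtain X \<xi> where u: "u = (X, \<xi>)"
      by force
    define Y where "Y = (\<Sum>b\<in>B. (\<xi> b / g b b) *\<^sub>R b)"
    have \<xi>: "\<xi> = g Y"
      unfolding Y_def by (rule one_form_eq)
    \<comment> \<open>Every element is X + gY, and its parts in the two halves have base vectors (X
      + Y)/2 and (X - Y)/2.\<close>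
    have "u = lift g 1 ((1/2) *\<^sub>R (X + Y)) + lift g (-1) ((1/2) *\<^sub>R (X - Y))"
      unfolding u \<xi> lift_def by (simp add: blinfun.bilinear_simps algebra_simps flip: scaleR_add_left)
    moreover have "lift g s Z \<in> span E_basis" if "s \<in> {1, -1}" for s Z
      using that span_lift[of s] span_mono[of "lift g s ` B" E_basis] by (auto simp: E_basis_def)
    ultimately show ?thesis
      by (auto intro: span_add)
  qed
  then show ?thesis
    by auto
qed

sublocale E: orthogonal_system pairing E_basis
proof (rule orthogonal_system.intro)
  show "linear (\<lambda>u. pairing u v)" for v :: "'a gen"
    by (rule linear_pairing_left)
  show "finite E_basis"
    by (simp add: E_basis_def B_finite)
  show "pairing e f = 0" if "e \<in> E_basis" "f \<in> E_basis" "e \<noteq> f" for e f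
    using that by (auto simp: E_basis_def pairing_lift intro: B_orthogonal)
  show "pairing e e \<noteq> 0" if "e \<in> E_basis" for e
    using that B_nonnull by (auto simp: E_basis_def)
qed

lemma half_orthogonal_system:
  assumes "s \<in> {1, -1}" shows "orthogonal_system pairing (lift g s ` B)"
proof (rule orthogonal_system.intro)
  show "linear (\<lambda>u. pairing u v)" for v :: "'a gen"
    by (rule linear_pairing_left)
  show "finite (lift g s ` B)"
    by (simp add: B_finite)
  show "pairing e f = 0" if "e \<in> lift g s ` B" "f \<in> lift g s ` B" "e \<noteq> f" for e f
    using that by (auto intro: B_orthogonal)
  show "pairing e e \<noteq> 0" if "e \<in> lift g s ` B" for e
    using that assms B_nonnull by auto
qed

lemma E_eqI:
  assumes "\<And>w. w \<in> E_basis \<Longrightarrow> pairing u w = pairing v w" shows "u = v"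
  using E.eqI span_E_basis assms by auto

section \<open>The connections with torsion and the mixed Dorfman brackets\<close>

definition kappa :: "real \<Rightarrow> 'a \<Rightarrow> 'a \<Rightarrow> 'a \<Rightarrow> real" where
  "kappa s X Y Z = (g (br X Y) Z - g (br X Z) Y - g X (br Y Z) + s * H X Y Z) / 2"

definition nabla :: "real \<Rightarrow> 'a \<Rightarrow> 'a \<Rightarrow> 'a" where
  "nabla s X Y = (\<Sum>b\<in>B. (kappa s X Y b / g b b) *\<^sub>R b)"

lemma linear_kappa:
  "linear (\<lambda>X. kappa s X Y Z)" "linear (\<lambda>Y. kappa s X Y Z)" "linear (\<lambda>Z. kappa s X Y Z)"
  by (rule linearI; simp add: kappa_def blinfun.bilinear_simps algebra_simps add_divide_distrib
      diff_divide_distrib)+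

lemma g_nabla: "g (nabla s X Y) Z = kappa s X Y Z"
  by (rule linear_eq_on_spanning[OF linear_blinfun linear_kappa(3) span_B])
    (simp add: nabla_def base.form_sum_scale B_nonnull)

lemma linear_nabla: "linear (\<lambda>X. nabla s X Y)" "linear (nabla s X)"
  by (rule linearI; simp add: nabla_def linear_add[OF linear_kappa(1)] linear_add[OF linear_kappa(2)]
      linear_scale[OF linear_kappa(1)] linear_scale[OF linear_kappa(2)] add_divide_distrib
      scaleR_add_left sum.distrib scaleR_sum_right)+

text \<open>Pairings of left-invariant sections are constant, so the derivative terms that spoil
  skewness of a Dorfman bracket vanish and the associated trilinear form is totally skew.\<close>

lemma pairing_dorfman_antisym:
  "pairing (dorfman br H u v) w = - pairing (dorfman br H v u) w"
  "pairing (dorfman br H u v) w = - pairing (dorfman br H u w) v"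
  using lie_bracket_antisym[OF lie, of "fst v" "fst w"] lie_bracket_antisym[OF lie, of "fst u" "fst v"]
    three_form_antisym[OF H_form, of "fst u" "fst v" "fst w"]
  by (simp_all add: pairing_dorfman blinfun.bilinear_simps field_simps)

text \<open>Here the Dorfman bracket becomes Koszul's formula with torsion: the part in E_s of the
  bracket of X_(-s) and Y_s is \<open>nabla s X Y\<close>.\<close>

lemma pairing_dorfman_lift:
  assumes "s \<in> {1, -1}"
  shows "pairing (dorfman br H (lift g (- s) X) (lift g s Y)) (lift g s Z) = s * kappa s X Y Z"
  using assms
  by (auto simp: pairing_dorfman kappa_def lift_def blinfun.bilinear_simps g_commute[of Z] g_commute[of Y]
      field_simps)

lemma dorfman_lift:
  assumes "s \<in> {1, -1}"
  shows "dorfman br H (lift g s X) (lift g (- s) Y)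
    = lift g s (- nabla s Y X) + lift g (- s) (nabla (- s) X Y)"
proof (rule E_eqI)
  fix w assume "w \<in> E_basis"
  then obtain t Z where "w = lift g t Z" "t \<in> {1, -1}"
    by (auto simp: E_basis_def)
  then consider "w = lift g s Z" | "w = lift g (- s) Z"
    using assms by force
  then show "pairing (dorfman br H (lift g s X) (lift g (- s) Y)) w
    = pairing (lift g s (- nabla s Y X) + lift g (- s) (nabla (- s) X Y)) w"
  proof cases
    case 1
    then show ?thesis
      using pairing_dorfman_lift[OF assms, of Y X Z]
        pairing_dorfman_antisym(1)[of "lift g s X" "lift g (- s) Y" w]
      by (simp add: pairing.add_left g_nabla blinfun.bilinear_simps)
  next
    case 2
    have "- s \<in> {1, -1}"
      using assms by auto
    then show ?thesis
      using pairing_dorfman_lift[of "- s" X Y Z] 2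
      by (simp add: pairing.add_left g_nabla)
  qed
qed

text \<open>\<open>pairing_adjoint\<close> is a definite description. The map \<open>T\<close> below
  gives existence, and non-degeneracy of the pairing, in the form of \<open>E_eqI\<close>, gives
  uniqueness.\<close>

lemma pairing_pairing_adjoint:
  fixes A :: "'a gen \<Rightarrow> 'a gen"
  assumes "linear A"
  shows "pairing (pairing_adjoint A v) w = pairing v (A w)"
proof -
  define T where "T v = (\<Sum>e\<in>E_basis. (pairing v (A e) / pairing e e) *\<^sub>R e)" for v :: "'a gen"
  have T: "pairing (T v) w = pairing v (A w)" for v w
  proof (rule linear_eq_on_spanning[OF linear_pairing_right _ span_E_basis])
    show "linear (\<lambda>w. pairing v (A w))"
      using linear_compose[OF assms linear_pairing_right] by (simp add: o_def)
  qed (simp add: T_def E.form_sum_scale E.nonnull)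
  have "pairing_adjoint A = T"
    unfolding pairing_adjoint_def
  proof (rule the_equality)
    fix T' assume "\<forall>v w. pairing (T' v) w = pairing v (A w)"
    then show "T' = T"
      using T by (intro ext E_eqI) metis
  qed (use T in blast)
  then show ?thesis
    using T by simp
qed

lemma pairing_torsion:
  "pairing (torsion br H D u v) w
    = pairing (D u v) w - pairing (D v u) w - pairing (dorfman br H u v) w + pairing v (D w u)"
proof -
  have "linear (\<lambda>w. D w u)"
    by (rule linearI) (auto simp: blinfun.bilinear_simps)
  then show ?thesis
    by (simp add: torsion_def pairing.add_left pairing.diff_left pairing_pairing_adjoint)
qed

lemma trace_on_half:
  assumes "s \<in> {1, -1}" "linear f" "f ` range (lift g s) \<subseteq> range (lift g s)"
  shows "trace_on (range (lift g s)) f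
    = (\<Sum>b\<in>B. pairing (f (lift g s b)) (lift g s b) / (s * g b b))"
  using orthogonal_system.trace_on_span[OF half_orthogonal_system[OF assms(1)] assms(2)] assms(3)
  by (simp add: span_lift sum.reindex inj_on_def)

lemma trace_on_E:
  assumes "linear f"
  shows "trace_on UNIV f
    = (\<Sum>s\<in>{1, -1}. \<Sum>b\<in>B. pairing (f (lift g s b)) (lift g s b) / (s * g b b))"
proof -
  have "lift g 1 ` B \<inter> lift g (- 1) ` B = {}"
  proof -
    \<comment> \<open>Elements of both images have the same base vector when they agree; such an
      element would be orthogonal to itself, against \<open>B_nonnull\<close>.\<close>
    have False if "b \<in> B" "lift g 1 b = lift g (- 1) b" for b
    proof -
      have "pairing (lift g 1 b) (lift g 1 b) = pairing (lift g 1 b) (lift g (- 1) b)"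
        using that(2) by simp
      then show False
        using B_nonnull[OF that(1)] by (simp add: pairing_lift)
    qed
    then show ?thesis
      by (auto simp: lift_def)
  qed
  then show ?thesis
    using E.trace_on_span[OF assms] span_E_basis
    by (simp add: E_basis_def sum.union_disjoint B_finite sum.reindex inj_on_def)
qed

end

section \<open>Ricci curvature\<close>

locale levi_civita_connection = metric_lie_algebra +
  fixes D :: "'a gen \<Rightarrow>\<^sub>L 'a gen \<Rightarrow>\<^sub>L 'a gen"
  assumes levi_civita: "levi_civita br H g D"
begin

lemma preserves_half:
  assumes "s \<in> {1, -1}"
  obtains Z where "D u (lift g s Y) = lift g s Z"
proof -
  have "D u ` range (lift g s) \<subseteq> range (lift g s)"
    using levi_civita assms unfolding levi_civita_def E_plus_eq E_minus_eq by blast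
  then show ?thesis
    using that by blast
qed

lemma lift_fst:
  assumes "s \<in> {1, -1}"
  shows "lift g s (fst (D u (lift g s Y))) = D u (lift g s Y)"
  using preserves_half[OF assms, of u Y] by (metis fst_conv lift_def)

text \<open>Pair the torsion of X_(-s) and Y_s with W_s. The two terms that differentiate X_(-s)
  stay in the opposite half and drop out, so the derivative equals the E_s part of the
  bracket.\<close>

lemma mixed:
  assumes "s \<in> {1, -1}"
  shows "D (lift g (- s) X) (lift g s Y) = lift g s (nabla s X Y)"
proof -
  let ?Z = "fst (D (lift g (- s) X) (lift g s Y))"
  note Z = lift_fst[OF assms, of "lift g (- s) X" Y]
  have "?Z = nabla s X Y"
  proof (rule base.eqI)
    fix W
    have "- s \<in> {1, -1}"
      using assms by auto
    then have opposite: "pairing (D u (lift g (- s) X)) (lift g s V) = 0" for V u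
      by (subst lift_fst[symmetric]) auto
    have "0 = pairing (torsion br H D (lift g (- s) X) (lift g s Y)) (lift g s W)"
      using levi_civita unfolding levi_civita_def by (metis pairing.zero_left)
    also have "\<dots> = pairing (lift g s ?Z) (lift g s W) - s * kappa s X Y W"
      using opposite[of "lift g s Y" W] opposite[of "lift g s W" Y]
      by (simp add: pairing_torsion pairing_dorfman_lift[OF assms] Z pairing_commute[of "lift g s Y"])
    finally show "g ?Z W = g (nabla s X Y) W"
      using assms by (auto simp: g_nabla)
  qed (simp_all add: span_B)
  then show ?thesis
    using Z by simp
qed

lemma divergence_lift:
  assumes "s \<in> {1, -1}"
  shows "divergence D (lift g s Y)
    = (\<Sum>b\<in>B. pairing (D (lift g s b) (lift g s Y)) (lift g s b) / (s * g b b))"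
proof -
  have lin: "linear (\<lambda>w. D w (lift g s Y))"
    by (rule linearI) (auto simp: blinfun.bilinear_simps)
  \<comment> \<open>The half opposite to s contributes nothing to the trace, because
    \<open>D u\<close> preserves E_s.\<close>
  have "pairing (D u (lift g s Y)) (lift g (- s) W) = 0" for u W
    by (subst lift_fst[OF assms, symmetric]) simp
  from this[of "lift g (- s) _"] show ?thesis
    unfolding divergence_def trace_on_E[OF lin] using assms by auto
qed

lemma ricci_half:
  assumes s: "s \<in> {1, -1}"
  shows "trace_on (range (lift g s)) (\<lambda>w. curvature br H D w (lift g (- s) X) (lift g s Y))
    = divergence D (lift g s (nabla s X Y))
      - (\<Sum>b\<in>B. kappa s (nabla (- s) b X) Y b / g b b)"
proof -
  let ?u = "lift g (- s) X" and ?v = "lift g s Y"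
  define A where "A Z = fst (D (lift g s Z) ?v)" for Z
  have A: "D (lift g s Z) ?v = lift g s (A Z)" for Z
    unfolding A_def using lift_fst[OF s] by simp
  have lin_A: "linear A"
    by (rule linearI) (simp_all add: A_def linear_add[OF linear_lift] linear_scale[OF linear_lift]
        blinfun.bilinear_simps)
  have lin: "linear (\<lambda>w. curvature br H D w ?u ?v)"
    by (rule linearI) (simp_all add: curvature_def linear_add[OF linear_dorfman_left]
        linear_scale[OF linear_dorfman_left] blinfun.bilinear_simps algebra_simps)
  have "\<exists>Z. curvature br H D w ?u ?v = lift g s Z" for w
  proof -
    have "D u (lift g s Z) \<in> range (lift g s)" for u Z
      using lift_fst[OF s, of u Z, symmetric] by blast
    moreover have "w - w' \<in> range (lift g s)"
      if "w \<in> range (lift g s)" "w' \<in> range (lift g s)" for w w' :: "'a gen"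
      using that by (auto simp: linear_diff[OF linear_lift, symmetric])
    ultimately have "curvature br H D w ?u ?v \<in> range (lift g s)"
      unfolding curvature_def by (metis imageE)
    then show ?thesis
      by blast
  qed
  then have *: "trace_on (range (lift g s)) (\<lambda>w. curvature br H D w ?u ?v)
    = (\<Sum>b\<in>B. pairing (curvature br H D (lift g s b) ?u ?v) (lift g s b) / (s * g b b))"
    by (intro trace_on_half[OF s lin]) blast
  have curv: "pairing (curvature br H D (lift g s b) ?u ?v) (lift g s b) / (s * g b b)
      = pairing (D (lift g s b) (lift g s (nabla s X Y))) (lift g s b) / (s * g b b)
        - g (nabla s X (A b)) b / g b b + g (A (nabla s X b)) b / g b b
        - kappa s (nabla (- s) b X) Y b / g b b" for b
  proof -
    \<comment> \<open>By \<open>dorfman_lift\<close> the bracket has parts in both halves: the part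
      in E_s brings back the unknown \<open>A\<close>, the other gives a mixed derivative. The terms
      with \<open>A\<close> then form a commutator with \<open>nabla s X\<close>.\<close>
    have "curvature br H D (lift g s b) ?u ?v
      = D (lift g s b) (lift g s (nabla s X Y)) - lift g s (nabla s X (A b))
        - (lift g s (A (- nabla s X b)) + lift g s (nabla s (nabla (- s) b X) Y))"
      by (simp add: curvature_def A mixed[OF s] dorfman_lift[OF s] blinfun.bilinear_simps)
    then show ?thesis
      using s
      by (auto simp: pairing.diff_left pairing.add_left linear_neg[OF lin_A] g_nabla
          blinfun.bilinear_simps diff_divide_distrib add_divide_distrib)
  qed
  have "(\<Sum>b\<in>B. g (nabla s X (A b)) b / g b b) = (\<Sum>b\<in>B. g (A (nabla s X b)) b / g b b)"
    by (rule base.trace_commute[OF linear_nabla(2) lin_A]) (simp_all add: span_B)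
  then show ?thesis
    unfolding * curv divergence_lift[OF s] by (simp add: sum.distrib sum_subtractf)
qed

end

section \<open>Existence of a Levi-Civita connection with prescribed divergence\<close>

context metric_lie_algebra
begin

lemma in_range_lift:
  assumes "s \<in> {1, -1}" "\<And>c. c \<in> B \<Longrightarrow> pairing u (lift g (- s) c) = 0"
  shows "u \<in> range (lift g s)"
proof -
  define X where "X = (\<Sum>b\<in>B. (s * pairing u (lift g s b) / g b b) *\<^sub>R b)"
  have X: "g X c = s * pairing u (lift g s c)" if "c \<in> B" for c
    using that by (simp add: X_def base.form_sum_scale B_nonnull)
  have "u = lift g s X"
  proof (rule E_eqI)
    fix w assume "w \<in> E_basis"
    then obtain c where "c \<in> B" "w = lift g s c \<or> w = lift g (- s) c"
      using assms(1) by (auto simp: E_basis_def)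
    then show "pairing u w = pairing (lift g s X) w"
      using assms X by auto
  qed
  then show ?thesis
    by blast
qed

lemma exists_bilinear_extension:
  fixes d :: "'a gen \<Rightarrow> 'a gen \<Rightarrow> 'a gen"
  obtains D :: "'a gen \<Rightarrow>\<^sub>L 'a gen \<Rightarrow>\<^sub>L 'a gen"
  where "\<And>e f. e \<in> E_basis \<Longrightarrow> f \<in> E_basis \<Longrightarrow> D e f = d e f"
proof -
  \<comment> \<open>The basis dual to \<open>E_basis\<close>; the extension is a sum of rank-one
    maps built from it.\<close>
  define \<rho> where "\<rho> e = Blinfun (\<lambda>u. pairing u e / pairing e e)" for e :: "'a gen"
  have \<rho>: "\<rho> e u = pairing u e / pairing e e" for e u
    unfolding \<rho>_def
    by (intro fun_cong[OF bounded_linear_Blinfun_apply] bounded_linear_divide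
        bounded_linear_compose[OF bounded_linear_divide pairing.bounded_linear_left])
  define T where "T e = (\<Sum>f\<in>E_basis. blinfun_scaleR_left (d e f) o\<^sub>L \<rho> f)" for e
  define D where "D = (\<Sum>e\<in>E_basis. blinfun_scaleR_left (T e) o\<^sub>L \<rho> e)"
  have sum_\<rho>: "(\<Sum>f\<in>E_basis. \<rho> f e *\<^sub>R x f) = x e" if "e \<in> E_basis"
    for x :: "'a gen \<Rightarrow> 'c::real_vector" and e
  proof -
    have "(\<Sum>f\<in>E_basis. \<rho> f e *\<^sub>R x f) = (\<Sum>f\<in>E_basis. if f = e then x e else 0)"
      using that E.orthogonal E.nonnull by (intro sum.cong) (auto simp: \<rho>)
    then show ?thesis
      using that E.finite_B by simp
  qed
  show ?thesis
  proof (rule that[of D])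
    fix e f assume "e \<in> E_basis" "f \<in> E_basis"
    then show "D e f = d e f"
      by (simp add: D_def T_def blinfun.sum_left sum_\<rho>)
  qed
qed

text \<open>The summand of \<open>\<tau>\<close> with the factor \<open>\<gamma>\<close> is skew in its last two arguments and has vanishing
  cyclic sum, so it affects neither metricity nor torsion, but it has trace \<open>\<delta>\<close>. This fails if \<open>dim \<gg> = 1\<close>.\<close>

lemma exists_levi_civita_with_divergence:
  fixes \<delta> :: "'a gen \<Rightarrow>\<^sub>L real"
  assumes "card B \<noteq> 1"
  obtains D where "levi_civita br H g D" "\<And>v. divergence D v = \<delta> v"
proof -
  define \<beta> where "\<beta> u v w = pairing (dorfman br H u v) w" for u v w
  define side where "side e \<longleftrightarrow> e \<in> range (lift g 1)" for e
  \<comment> \<open>On one half, with n basis vectors, the trace of the added summand without its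
    factor is (1 - n) \<open>\<delta>\<close>, so \<open>\<gamma>\<close> normalizes the
    divergence.\<close>
  define \<gamma> where "\<gamma> = 1 / (1 - real (card B))"
  \<comment> \<open>\<open>\<tau>\<close> prescribes the pairing of \<open>D e f\<close> with
    \<open>k\<close>. Metricity and preservation of the halves force the zeros, \<open>mixed\<close>
    forces the second case. If all three arguments lie in one half, zero torsion only fixes the
    cyclic sum of \<open>\<tau>\<close> to be \<open>\<beta>\<close>; since \<open>\<beta>\<close>
    is totally skew, a third of it in each place does this.\<close>
  define \<tau> where "\<tau> e f k =
    (if side f \<noteq> side k then 0 else if side e \<noteq> side f then \<beta> e f k
     else \<beta> e f k / 3 + \<gamma> * (pairing e f * \<delta> k - pairing e k * \<delta> f))" for e f k
  have \<beta>: "\<beta> u v w = - \<beta> v u w" "\<beta> u v w = - \<beta> u w v" for u v w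
    unfolding \<beta>_def by (rule pairing_dorfman_antisym)+
  have side: "side (lift g s b) \<longleftrightarrow> s = 1" if "s \<in> {1, -1}" "b \<in> B" for s b
  proof -
    have False if "lift g (-1) b = lift g 1 c" for c
    proof -
      have "pairing (lift g (-1) b) (lift g (-1) b) = pairing (lift g 1 c) (lift g (-1) b)"
        using that by simp
      then show False
        using B_nonnull[OF \<open>b \<in> B\<close>] by (simp add: pairing_lift)
    qed
    then show ?thesis
      using that by (auto simp: side_def)
  qed
  define d where "d e f = (\<Sum>k\<in>E_basis. (\<tau> e f k / pairing k k) *\<^sub>R k)" for e f
  obtain D :: "'a gen \<Rightarrow>\<^sub>L 'a gen \<Rightarrow>\<^sub>L 'a gen"
    where D: "\<And>e f. e \<in> E_basis \<Longrightarrow> f \<in> E_basis \<Longrightarrow> D e f = d e f"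
    using exists_bilinear_extension[of d] by blast
  have D_\<tau>: "pairing (D e f) k = \<tau> e f k" if "e \<in> E_basis" "f \<in> E_basis" "k \<in> E_basis" for e f k
    using that by (simp add: D d_def E.form_sum_scale E.nonnull)
  have trilinear: "F u v w = (0::real)"
    if "\<And>v w. linear (\<lambda>u. F u v w)" "\<And>u w. linear (\<lambda>v. F u v w)" "\<And>u v. linear (\<lambda>w. F u v w)"
      and "\<And>e f k. e \<in> E_basis \<Longrightarrow> f \<in> E_basis \<Longrightarrow> k \<in> E_basis \<Longrightarrow> F e f k = 0"
    for F and u v w :: "'a gen"
    by (rule linear_eq_on_spanning[OF that(1) linear_zero span_E_basis],
        rule linear_eq_on_spanning[OF that(2) linear_zero span_E_basis],
        rule linear_eq_on_spanning[OF that(3) linear_zero span_E_basis], rule that(4))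
  have connection: "pairing (D u v) w + pairing v (D u w) = 0" for u v w
  proof (rule trilinear[of "\<lambda>u v w. pairing (D u v) w + pairing v (D u w)"])
    fix e f k assume "e \<in> E_basis" "f \<in> E_basis" "k \<in> E_basis"
    then show "pairing (D e f) k + pairing f (D e k) = 0"
      using \<beta>(2)[of e f k] by (auto simp: pairing_commute[of f] D_\<tau> \<tau>_def algebra_simps)
  qed (rule linearI; simp add: blinfun.bilinear_simps pairing.add_left pairing.add_right
        pairing.scaleR_left pairing.scaleR_right algebra_simps)+
  have "pairing (torsion br H D u v) w = 0" for u v w
    unfolding pairing_torsion
  proof (rule trilinear[of "\<lambda>u v w. pairing (D u v) w - pairing (D v u) w
      - pairing (dorfman br H u v) w + pairing v (D w u)"])
    fix e f k assume "e \<in> E_basis" "f \<in> E_basis" "k \<in> E_basis"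
    moreover have "\<tau> e f k - \<tau> f e k - \<beta> e f k + \<tau> k e f = 0"
      using \<beta>(1)[of f e k] \<beta>(1)[of k e f] \<beta>(2)[of e k f]
        pairing_commute[of f e] pairing_commute[of k f] pairing_commute[of k e]
      by (auto simp: \<tau>_def algebra_simps)
    ultimately show "pairing (D e f) k - pairing (D f e) k - pairing (dorfman br H e f) k
        + pairing f (D k e) = 0"
      by (simp add: pairing_commute[of f] D_\<tau> \<beta>_def)
  qed (rule linearI; simp add: blinfun.bilinear_simps pairing.add_left pairing.add_right
        linear_add[OF linear_dorfman_left] linear_add[OF linear_dorfman_right]
        linear_scale[OF linear_dorfman_left] linear_scale[OF linear_dorfman_right]
        pairing.scaleR_left pairing.scaleR_right algebra_simps)+
  then have torsion: "torsion br H D u v = 0" for u v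
    by (intro E_eqI) (simp add: pairing.zero_left)
  have half: "D u (lift g s Y) \<in> range (lift g s)" if s: "s \<in> {1, -1}" for u s Y
  proof (rule in_range_lift[OF s])
    fix c assume c: "c \<in> B"
    show "pairing (D u (lift g s Y)) (lift g (- s) c) = 0"
    proof (rule linear_eq_on_spanning[OF _ linear_zero span_E_basis, of _ u])
      fix e assume e: "e \<in> E_basis"
      show "pairing (D e (lift g s Y)) (lift g (- s) c) = 0"
      proof (rule linear_eq_on_spanning[OF _ linear_zero span_B, of _ Y])
        fix b assume b: "b \<in> B"
        have "side (lift g s b) \<noteq> side (lift g (- s) c)"
          using s side[of s b] side[of "- s" c] b c by auto
        moreover have "lift g s b \<in> E_basis" "lift g (- s) c \<in> E_basis"
          using s b c by (auto simp: E_basis_def)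
        ultimately show "pairing (D e (lift g s b)) (lift g (- s) c) = 0"
          using e by (simp add: D_\<tau> \<tau>_def)
      qed (rule linearI; simp add: linear_add[OF linear_lift] linear_scale[OF linear_lift]
          blinfun.bilinear_simps pairing.add_left pairing.scaleR_left)
    qed (rule linearI; simp add: blinfun.bilinear_simps pairing.add_left pairing.scaleR_left)
  qed
  have lc: "levi_civita br H g D"
    unfolding levi_civita_def generalized_connection_def E_plus_eq E_minus_eq
    using connection torsion half[of 1] half[of "-1"] by blast
  interpret levi_civita_connection br g H B D
    by unfold_locales (rule lc)
  have "divergence D v = \<delta> v" for v
  proof (rule linear_eq_on_spanning[of "divergence D" "blinfun_apply \<delta>",
        OF _ linear_blinfun span_E_basis])
    fix e assume "e \<in> E_basis"
    then obtain s c where s: "s \<in> {1, -1}" and c: "c \<in> B" and e: "e = lift g s c"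
      by (auto simp: E_basis_def)
    have in_basis: "lift g s b \<in> E_basis" if "b \<in> B" for b
      using that s by (auto simp: E_basis_def)
    have "divergence D e = (\<Sum>b\<in>B. \<tau> (lift g s b) (lift g s c) (lift g s b) / (s * g b b))"
      unfolding e divergence_lift[OF s] using c by (intro sum.cong) (simp_all add: D_\<tau> in_basis)
    also have "\<dots> = (\<Sum>b\<in>B. (if b = c then \<gamma> * \<delta> e else 0) - \<gamma> * \<delta> e)"
    proof (rule sum.cong[OF refl])
      fix b assume b: "b \<in> B"
      have "\<beta> (lift g s b) (lift g s c) (lift g s b) = 0"
        using \<beta>[of "lift g s b" "lift g s c" "lift g s b"] \<beta>[of "lift g s b" "lift g s b" "lift g s c"]
        by linarith
      moreover have "side (lift g s b) \<longleftrightarrow> side (lift g s c)"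
        using side[OF s] b c by simp
      ultimately have \<tau>: "\<tau> (lift g s b) (lift g s c) (lift g s b)
          = \<gamma> * (s * g b c * \<delta> (lift g s b) - s * g b b * \<delta> e)"
        by (simp add: \<tau>_def e)
      have "s * g b b \<noteq> 0"
        using s B_nonnull[OF b] by auto
      then show "\<tau> (lift g s b) (lift g s c) (lift g s b) / (s * g b b)
          = (if b = c then \<gamma> * \<delta> e else 0) - \<gamma> * \<delta> e"
        using B_orthogonal[OF b c] unfolding \<tau> by (cases "b = c") (simp_all add: e)
    qed
    also have "\<dots> = \<gamma> * \<delta> e * (1 - real (card B))"
      using c B_finite by (simp add: sum_subtractf algebra_simps)
    also have "\<dots> = \<delta> e"
      using assms by (simp add: \<gamma>_def)
    finally show "divergence D e = \<delta> e" .
  next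
    have *: "linear (\<lambda>u. D u v)" for v
      by (rule linearI) (simp_all add: blinfun.bilinear_simps)
    have div: "divergence D v
      = (\<Sum>s\<in>{1, -1}. \<Sum>b\<in>B. pairing (D (lift g s b) v) (lift g s b) / (s * g b b))" for v
      unfolding divergence_def by (rule trace_on_E[OF *])
    show "linear (divergence D)"
      unfolding div by (rule linearI)
        (simp_all add: blinfun.bilinear_simps pairing.add_left pairing.scaleR_left
          add_divide_distrib sum.distrib sum_distrib_left sum_negf algebra_simps)
  qed
  then show ?thesis
    using that lc by blast
qed

text \<open>The value found in \<open>ricci_half\<close> with \<open>\<delta>\<close> in place of
  the divergence. No D occurs in it, which is the independence of the Ricci tensors of the choice of
  D.\<close>

definition ricci_form :: "('a gen \<Rightarrow>\<^sub>L real) \<Rightarrow> real \<Rightarrow> 'a \<Rightarrow> 'a \<Rightarrow> real" where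
  "ricci_form \<delta> s X Y = \<delta> (lift g s (nabla s X Y)) - (\<Sum>b\<in>B. kappa s (nabla (- s) b X) Y b / g b b)"

text \<open>From left to right any witness D serves; from right to left a D with divergence
  \<open>\<delta>\<close> must exist, whence the condition on \<open>card B\<close>.\<close>

lemma generalized_einstein_iff:
  assumes "card B \<noteq> 1"
  shows "generalized_einstein br H g \<delta> \<longleftrightarrow> (\<forall>s\<in>{1, -1}. \<forall>X Y. ricci_form \<delta> s X Y = 0)"
proof -
  have *: "(\<forall>u\<in>E_minus g. \<forall>v\<in>E_plus g. ricci_plus br H g D u v = 0 \<and> ricci_minus br H g D v u = 0)
    \<longleftrightarrow> (\<forall>s\<in>{1, -1}. \<forall>X Y. ricci_form \<delta> s X Y = 0)"
    if D: "levi_civita br H g D" "\<forall>v. divergence D v = \<delta> v" for D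
  proof -
    interpret levi_civita_connection br g H B D
      by unfold_locales (rule D(1))
    have "ricci_plus br H g D (lift g (-1) X) (lift g 1 Y) = ricci_form \<delta> 1 X Y"
      "ricci_minus br H g D (lift g 1 X) (lift g (-1) Y) = ricci_form \<delta> (-1) X Y" for X Y
      using ricci_half[of 1 X Y] ricci_half[of "-1" X Y] D(2)
      by (simp_all add: ricci_plus_def ricci_minus_def E_plus_eq E_minus_eq ricci_form_def)
    then show ?thesis
      unfolding E_plus_eq E_minus_eq by auto
  qed
  obtain D\<^sub>0 where D\<^sub>0: "levi_civita br H g D\<^sub>0" "\<And>v. divergence D\<^sub>0 v = \<delta> v"
    using exists_levi_civita_with_divergence[OF assms, of \<delta>] by blast
  show ?thesis
    unfolding generalized_einstein_def using * D\<^sub>0 by (intro iffI) (elim exE conjE, simp, intro exI[of _ D\<^sub>0], simp)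
qed

end

section \<open>The unimodular kernel and the Ricci form in a basis\<close>

lemma linear_trace_ad:
  fixes br :: "'a::euclidean_space \<Rightarrow>\<^sub>L 'a \<Rightarrow>\<^sub>L 'a"
  shows "linear (\<lambda>X. trace_on UNIV (br X))"
proof -
  \<comment> \<open>Any basis computes the trace. With the Euclidean one the result does not depend
    on a metric \<open>g\<close>.\<close>
  interpret orthogonal_system "\<lambda>X Y :: 'a. X \<bullet> Y" Basis
  proof (rule orthogonal_system.intro)
    show "linear (\<lambda>X. X \<bullet> Y)" for Y :: 'a
      by (rule linearI) (simp_all add: inner_add_left)
  qed (auto simp: inner_not_same_Basis)
  have trace: "trace_on UNIV (br X) = (\<Sum>b\<in>Basis. br X b \<bullet> b)" for X
    using trace_on_span[OF linear_blinfun, of "br X"] by simp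
  show ?thesis
    unfolding trace by (rule linearI) (simp_all add: blinfun.bilinear_simps inner_add_left sum.distrib sum_distrib_left)
qed

lemma subspace_unimodular_kernel: "subspace (unimodular_kernel br)"
  unfolding unimodular_kernel_def by (rule linear_subspace_kernel[OF linear_trace_ad])

context metric_lie_algebra
begin

lemma ricci_form_eq:
  "ricci_form \<delta> s X Y = (\<Sum>c\<in>B. kappa s X Y c / g c c * \<delta> (lift g s c))
    - (\<Sum>b\<in>B. \<Sum>c\<in>B. kappa (- s) b X c / g c c * kappa s c Y b / g b b)"
proof -
  have "\<delta> (lift g s (nabla s X Y)) = (\<Sum>c\<in>B. kappa s X Y c / g c c * \<delta> (lift g s c))"
    by (simp add: nabla_def linear_sum[OF linear_lift] linear_scale[OF linear_lift]
        blinfun.sum_right blinfun.scaleR_right)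
  moreover have "kappa s (nabla (- s) b X) Y b
      = (\<Sum>c\<in>B. kappa (- s) b X c / g c c * kappa s c Y b)" for b
    unfolding nabla_def
    by (simp add: linear_sum[OF linear_kappa(1)] linear_scale[OF linear_kappa(1)])
  ultimately show ?thesis
    by (simp add: ricci_form_def sum_divide_distrib)
qed

lemma ricci_form_zero_iff:
  "(\<forall>X Y. ricci_form \<delta> s X Y = 0) \<longleftrightarrow> (\<forall>b\<in>B. \<forall>c\<in>B. ricci_form \<delta> s b c = 0)"
proof
  assume *: "\<forall>b\<in>B. \<forall>c\<in>B. ricci_form \<delta> s b c = 0"
  have lin: "linear (\<lambda>X. ricci_form \<delta> s X Y)" "linear (ricci_form \<delta> s X)" for X Y
    by (rule linearI; simp add: ricci_form_eq linear_add[OF linear_kappa(1)]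
        linear_add[OF linear_kappa(2)] linear_scale[OF linear_kappa(1)]
        linear_scale[OF linear_kappa(2)] algebra_simps add_divide_distrib sum.distrib
        sum_distrib_left)+
  show "\<forall>X Y. ricci_form \<delta> s X Y = 0"
  proof (intro allI)
    fix X Y
    show "ricci_form \<delta> s X Y = 0"
      by (rule linear_eq_on_spanning[OF lin(1) linear_zero span_B],
          rule linear_eq_on_spanning[OF lin(2) linear_zero span_B]) (use * in blast)
  qed
qed simp

lemma trace_br: "trace_on UNIV (br X) = (\<Sum>b\<in>B. g (br X b) b / g b b)"
  using base.trace_on_span[OF linear_blinfun, of "br X"] by (simp add: span_B)

text \<open>\<open>ad [X,Y]\<close> is a commutator of endomorphisms and so has trace zero.\<close>

lemma br_in_unimodular_kernel: "br X Y \<in> unimodular_kernel br"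
proof -
  have "br (br X Y) Z = br X (br Y Z) - br Y (br X Z)" for Z
  proof -
    have "br X (br Y Z) + br Y (br Z X) + br Z (br X Y) = 0"
      using lie by (auto simp: lie_bracket_def)
    then show ?thesis
      using lie_bracket_antisym[OF lie, of Z X] lie_bracket_antisym[OF lie, of Z "br X Y"]
      by (simp add: blinfun.bilinear_simps algebra_simps)
  qed
  moreover have "(\<Sum>b\<in>B. g (br X (br Y b)) b / g b b) = (\<Sum>b\<in>B. g (br Y (br X b)) b / g b b)"
    by (rule base.trace_commute) (simp_all add: linear_blinfun span_B)
  ultimately show ?thesis
    by (simp add: unimodular_kernel_def trace_br blinfun.bilinear_simps diff_divide_distrib
        sum_subtractf)
qed

end

section \<open>Three-dimensional non-unimodular Lie algebras\<close>

lemma metric_lie_algebra_orthonormal: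
  assumes "lie_bracket br" "pseudo_metric g" "three_form H" "orthonormal_basis g v\<^sub>1 v\<^sub>2 v\<^sub>3"
  shows "metric_lie_algebra br g H {v\<^sub>1, v\<^sub>2, v\<^sub>3}"
proof
  have comm: "g X Y = g Y X" for X Y
    using assms(2) by (simp add: pseudo_metric_def)
  show "g X Y = g Y X" for X Y
    by (rule comm)
  show "g b c = 0" if "b \<in> {v\<^sub>1, v\<^sub>2, v\<^sub>3}" "c \<in> {v\<^sub>1, v\<^sub>2, v\<^sub>3}" "b \<noteq> c" for b c
    using that assms(4) comm[of v\<^sub>2 v\<^sub>1] comm[of v\<^sub>3 v\<^sub>1] comm[of v\<^sub>3 v\<^sub>2] by (auto simp: orthonormal_basis_def)
  show "g b b \<noteq> 0" if "b \<in> {v\<^sub>1, v\<^sub>2, v\<^sub>3}" for b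
    using that assms(4) by (auto simp: orthonormal_basis_def)
qed (use assms in \<open>auto simp: orthonormal_basis_def\<close>)

lemma orthonormal_basisI:
  fixes g :: "'a::euclidean_space \<Rightarrow>\<^sub>L 'a \<Rightarrow>\<^sub>L real"
  assumes "DIM('a) = 3" "pseudo_metric g" "g v\<^sub>1 v\<^sub>2 = 0" "g v\<^sub>1 v\<^sub>3 = 0" "g v\<^sub>2 v\<^sub>3 = 0"
    and "\<bar>g v\<^sub>1 v\<^sub>1\<bar> = 1" "\<bar>g v\<^sub>2 v\<^sub>2\<bar> = 1" "\<bar>g v\<^sub>3 v\<^sub>3\<bar> = 1"
  shows "orthonormal_basis g v\<^sub>1 v\<^sub>2 v\<^sub>3"
proof -
  have comm: "g X Y = g Y X" for X Y
    using assms(2) by (simp add: pseudo_metric_def)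
  have distinct: "distinct [v\<^sub>1, v\<^sub>2, v\<^sub>3]"
    using assms by auto
  interpret orthogonal_system "\<lambda>X Y. g X Y" "{v\<^sub>1, v\<^sub>2, v\<^sub>3}"
  proof (rule orthogonal_system.intro)
    show "linear (\<lambda>v. g v w)" for w
      by (rule linearI) (auto simp: blinfun.bilinear_simps)
    show "g b c = 0" if "b \<in> {v\<^sub>1, v\<^sub>2, v\<^sub>3}" "c \<in> {v\<^sub>1, v\<^sub>2, v\<^sub>3}" "b \<noteq> c" for b c
      using that assms comm[of v\<^sub>2 v\<^sub>1] comm[of v\<^sub>3 v\<^sub>1] comm[of v\<^sub>3 v\<^sub>2] by auto
  qed (use assms in auto)
  have "span {v\<^sub>1, v\<^sub>2, v\<^sub>3} = UNIV"
    using card_ge_dim_independent[of "{v\<^sub>1, v\<^sub>2, v\<^sub>3}" UNIV] independent distinct assms(1) by auto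
  then show ?thesis
    using assms distinct independent by (simp add: orthonormal_basis_def)
qed

locale kernel_frame =
  fixes br :: "'a::euclidean_space \<Rightarrow>\<^sub>L 'a \<Rightarrow>\<^sub>L 'a"
    and g :: "'a \<Rightarrow>\<^sub>L 'a \<Rightarrow>\<^sub>L real"
    and H :: "'a \<Rightarrow>\<^sub>L 'a \<Rightarrow>\<^sub>L 'a \<Rightarrow>\<^sub>L real"
    and v\<^sub>1 v\<^sub>2 v\<^sub>3 :: 'a
  assumes lie_algebra: "lie_bracket br"
    and metric: "pseudo_metric g"
    and form: "three_form H"
    and frame: "orthonormal_basis g v\<^sub>1 v\<^sub>2 v\<^sub>3"
    and kernel: "v\<^sub>1 \<in> unimodular_kernel br" "v\<^sub>3 \<in> unimodular_kernel br"
    and non_unimodular: "unimodular_kernel br \<noteq> UNIV"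
begin

sublocale metric_lie_algebra br g H "{v\<^sub>1, v\<^sub>2, v\<^sub>3}"
  by (rule metric_lie_algebra_orthonormal[OF lie_algebra metric form frame])

lemma distinct: "v\<^sub>1 \<noteq> v\<^sub>2" "v\<^sub>2 \<noteq> v\<^sub>3" "v\<^sub>1 \<noteq> v\<^sub>3"
  using frame by (auto simp: orthonormal_basis_def)

lemma card_frame: "card {v\<^sub>1, v\<^sub>2, v\<^sub>3} = 3"
  using distinct by simp

lemma metric_table [simp]:
  "g v\<^sub>1 v\<^sub>2 = 0" "g v\<^sub>1 v\<^sub>3 = 0" "g v\<^sub>2 v\<^sub>3 = 0" "g v\<^sub>2 v\<^sub>1 = 0" "g v\<^sub>3 v\<^sub>1 = 0" "g v\<^sub>3 v\<^sub>2 = 0"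
  using frame g_commute[of v\<^sub>2 v\<^sub>1] g_commute[of v\<^sub>3 v\<^sub>1] g_commute[of v\<^sub>3 v\<^sub>2]
  by (auto simp: orthonormal_basis_def)

lemma sign: "\<bar>g v\<^sub>1 v\<^sub>1\<bar> = 1" "\<bar>g v\<^sub>2 v\<^sub>2\<bar> = 1" "\<bar>g v\<^sub>3 v\<^sub>3\<bar> = 1"
  using frame by (auto simp: orthonormal_basis_def)

lemma sign_nonzero [simp]: "g v\<^sub>1 v\<^sub>1 \<noteq> 0" "g v\<^sub>2 v\<^sub>2 \<noteq> 0" "g v\<^sub>3 v\<^sub>3 \<noteq> 0"
  using sign by auto

lemma frame_expansion:
  "v = (g v v\<^sub>1 / g v\<^sub>1 v\<^sub>1) *\<^sub>R v\<^sub>1 + (g v v\<^sub>2 / g v\<^sub>2 v\<^sub>2) *\<^sub>R v\<^sub>2 + (g v v\<^sub>3 / g v\<^sub>3 v\<^sub>3) *\<^sub>R v\<^sub>3"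
  using base.expansion[of v] distinct by (simp add: span_B add.assoc)

text \<open>The trace of ad is a linear form that vanishes on \<open>v\<^sub>1\<close> and
  \<open>v\<^sub>3\<close> but not on \<open>v\<^sub>2\<close>, hence a nonzero multiple of g(.,
  \<open>v\<^sub>2\<close>).\<close>

lemma kernel_orthogonal: "w \<in> unimodular_kernel br \<longleftrightarrow> g w v\<^sub>2 = 0"
proof -
  have mem: "x *\<^sub>R v\<^sub>1 + y *\<^sub>R v\<^sub>3 \<in> unimodular_kernel br" for x y
    using subspace_add subspace_scale subspace_unimodular_kernel kernel by metis
  have "v\<^sub>2 \<notin> unimodular_kernel br"
  proof
    assume "v\<^sub>2 \<in> unimodular_kernel br"
    then have "span {v\<^sub>1, v\<^sub>2, v\<^sub>3} \<subseteq> unimodular_kernel br"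
      using kernel by (intro span_minimal subspace_unimodular_kernel) auto
    then show False
      using non_unimodular span_B by auto
  qed
  then have t: "trace_on UNIV (br v\<^sub>2) \<noteq> 0"
    by (simp add: unimodular_kernel_def)
  define u where "u = (g w v\<^sub>1 / g v\<^sub>1 v\<^sub>1) *\<^sub>R v\<^sub>1 + (g w v\<^sub>3 / g v\<^sub>3 v\<^sub>3) *\<^sub>R v\<^sub>3"
  have w: "w = u + (g w v\<^sub>2 / g v\<^sub>2 v\<^sub>2) *\<^sub>R v\<^sub>2"
    using frame_expansion[of w] by (simp add: u_def algebra_simps)
  have "trace_on UNIV (br u) = 0"
    using mem by (simp add: unimodular_kernel_def u_def)
  then have "trace_on UNIV (br w) = g w v\<^sub>2 / g v\<^sub>2 v\<^sub>2 * trace_on UNIV (br v\<^sub>2)"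
    by (subst w) (simp add: linear_add[OF linear_trace_ad] linear_scale[OF linear_trace_ad])
  then show ?thesis
    using t sign(2) by (auto simp: unimodular_kernel_def)
qed

lemma kernel_expansion:
  assumes "w \<in> unimodular_kernel br"
  shows "w = (g w v\<^sub>1 / g v\<^sub>1 v\<^sub>1) *\<^sub>R v\<^sub>1 + (g w v\<^sub>3 / g v\<^sub>3 v\<^sub>3) *\<^sub>R v\<^sub>3"
  using frame_expansion[of w] assms by (simp add: kernel_orthogonal)

lemma kernel_span: "unimodular_kernel br = span {v\<^sub>1, v\<^sub>3}"
proof
  show "unimodular_kernel br \<subseteq> span {v\<^sub>1, v\<^sub>3}"
  proof
    fix w assume "w \<in> unimodular_kernel br"
    from kernel_expansion[OF this] show "w \<in> span {v\<^sub>1, v\<^sub>3}"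
      using span_add span_scale span_base by (metis insertI1 insertI2)
  qed
  show "span {v\<^sub>1, v\<^sub>3} \<subseteq> unimodular_kernel br"
    using kernel by (intro span_minimal subspace_unimodular_kernel) auto
qed

lemma br_self [simp]: "br X X = 0"
  using lie by (auto simp: lie_bracket_def)

text \<open>The kernel is an ideal, so \<open>[v\<^sub>1,v\<^sub>3]\<close> lies in it; vanishing of the traces of \<open>ad v\<^sub>1\<close>
  and \<open>ad v\<^sub>3\<close> then kills both of its components.\<close>

lemma kernel_abelian: "br v\<^sub>1 v\<^sub>3 = 0" "br v\<^sub>3 v\<^sub>1 = 0"
proof -
  have orth: "g (br X Y) v\<^sub>2 = 0" for X Y
    using br_in_unimodular_kernel kernel_orthogonal by blast
  have "g (br v\<^sub>1 v\<^sub>3) v\<^sub>3 = 0"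
    using kernel(1) distinct orth sign(3) by (simp add: unimodular_kernel_def trace_br)
  moreover have "g (br v\<^sub>3 v\<^sub>1) v\<^sub>1 = 0"
    using kernel(2) distinct orth sign(1) by (simp add: unimodular_kernel_def trace_br)
  moreover have anti: "br v\<^sub>3 v\<^sub>1 = - br v\<^sub>1 v\<^sub>3"
    by (rule lie_bracket_antisym[OF lie])
  ultimately show "br v\<^sub>1 v\<^sub>3 = 0"
    using frame_expansion[of "br v\<^sub>1 v\<^sub>3"] orth by (simp add: blinfun.bilinear_simps)
  then show "br v\<^sub>3 v\<^sub>1 = 0"
    using anti by simp
qed

definition "m\<^sub>1\<^sub>1 = g (br v\<^sub>2 v\<^sub>1) v\<^sub>1 / g v\<^sub>1 v\<^sub>1"
definition "m\<^sub>1\<^sub>3 = g (br v\<^sub>2 v\<^sub>3) v\<^sub>1 / g v\<^sub>1 v\<^sub>1"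
definition "m\<^sub>3\<^sub>1 = g (br v\<^sub>2 v\<^sub>1) v\<^sub>3 / g v\<^sub>3 v\<^sub>3"
definition "m\<^sub>3\<^sub>3 = g (br v\<^sub>2 v\<^sub>3) v\<^sub>3 / g v\<^sub>3 v\<^sub>3"

lemma br_table:
  "br v\<^sub>2 v\<^sub>1 = m\<^sub>1\<^sub>1 *\<^sub>R v\<^sub>1 + m\<^sub>3\<^sub>1 *\<^sub>R v\<^sub>3" "br v\<^sub>2 v\<^sub>3 = m\<^sub>1\<^sub>3 *\<^sub>R v\<^sub>1 + m\<^sub>3\<^sub>3 *\<^sub>R v\<^sub>3"
  "br v\<^sub>1 v\<^sub>2 = - (m\<^sub>1\<^sub>1 *\<^sub>R v\<^sub>1 + m\<^sub>3\<^sub>1 *\<^sub>R v\<^sub>3)" "br v\<^sub>3 v\<^sub>2 = - (m\<^sub>1\<^sub>3 *\<^sub>R v\<^sub>1 + m\<^sub>3\<^sub>3 *\<^sub>R v\<^sub>3)"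
proof -
  show 1: "br v\<^sub>2 v\<^sub>1 = m\<^sub>1\<^sub>1 *\<^sub>R v\<^sub>1 + m\<^sub>3\<^sub>1 *\<^sub>R v\<^sub>3"
    using kernel_expansion[OF br_in_unimodular_kernel] by (simp add: m\<^sub>1\<^sub>1_def m\<^sub>3\<^sub>1_def)
  show 3: "br v\<^sub>2 v\<^sub>3 = m\<^sub>1\<^sub>3 *\<^sub>R v\<^sub>1 + m\<^sub>3\<^sub>3 *\<^sub>R v\<^sub>3"
    using kernel_expansion[OF br_in_unimodular_kernel] by (simp add: m\<^sub>1\<^sub>3_def m\<^sub>3\<^sub>3_def)
  show "br v\<^sub>1 v\<^sub>2 = - (m\<^sub>1\<^sub>1 *\<^sub>R v\<^sub>1 + m\<^sub>3\<^sub>1 *\<^sub>R v\<^sub>3)"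
    using lie_bracket_antisym[OF lie, of v\<^sub>1 v\<^sub>2] 1 by simp
  show "br v\<^sub>3 v\<^sub>2 = - (m\<^sub>1\<^sub>3 *\<^sub>R v\<^sub>1 + m\<^sub>3\<^sub>3 *\<^sub>R v\<^sub>3)"
    using lie_bracket_antisym[OF lie, of v\<^sub>3 v\<^sub>2] 3 by simp
qed

lemma trace_ad_v2: "m\<^sub>1\<^sub>1 + m\<^sub>3\<^sub>3 \<noteq> 0"
proof -
  have "v\<^sub>2 \<notin> unimodular_kernel br"
    by (simp add: kernel_orthogonal)
  then show ?thesis
    using distinct by (simp add: unimodular_kernel_def trace_br m\<^sub>1\<^sub>1_def m\<^sub>3\<^sub>3_def)
qed

lemma H_zero [simp]: "H X X Y = 0" "H X Y X = 0" "H X Y Y = 0"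
  using H_form by (auto simp: three_form_def)

lemma H_table:
  "H v\<^sub>2 v\<^sub>3 v\<^sub>1 = H v\<^sub>1 v\<^sub>2 v\<^sub>3" "H v\<^sub>3 v\<^sub>1 v\<^sub>2 = H v\<^sub>1 v\<^sub>2 v\<^sub>3" "H v\<^sub>2 v\<^sub>1 v\<^sub>3 = - H v\<^sub>1 v\<^sub>2 v\<^sub>3"
  "H v\<^sub>1 v\<^sub>3 v\<^sub>2 = - H v\<^sub>1 v\<^sub>2 v\<^sub>3" "H v\<^sub>3 v\<^sub>2 v\<^sub>1 = - H v\<^sub>1 v\<^sub>2 v\<^sub>3"
  using three_form_antisym(1)[OF H_form, of v\<^sub>2 v\<^sub>1 v\<^sub>3] three_form_antisym(2)[OF H_form, of v\<^sub>1 v\<^sub>3 v\<^sub>2]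
    three_form_antisym(2)[OF H_form, of v\<^sub>2 v\<^sub>3 v\<^sub>1] three_form_antisym(1)[OF H_form, of v\<^sub>3 v\<^sub>1 v\<^sub>2]
    three_form_antisym(1)[OF H_form, of v\<^sub>3 v\<^sub>2 v\<^sub>1]
  by simp_all

text \<open>The diagonal entries and half sums belong to the symmetric part of
  \<open>br v\<^sub>2\<close> with respect to \<open>g\<close>, which is the second fundamental form
  of the kernel; the half differences are its skew part. H only shifts off-diagonal terms.\<close>

lemma kappa_table [simp]:
  "kappa s v\<^sub>1 v\<^sub>1 v\<^sub>1 = 0"
  "kappa s v\<^sub>1 v\<^sub>1 v\<^sub>2 = g v\<^sub>1 v\<^sub>1 * m\<^sub>1\<^sub>1"
  "kappa s v\<^sub>1 v\<^sub>1 v\<^sub>3 = 0"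
  "kappa s v\<^sub>1 v\<^sub>2 v\<^sub>1 = - (g v\<^sub>1 v\<^sub>1 * m\<^sub>1\<^sub>1)"
  "kappa s v\<^sub>1 v\<^sub>2 v\<^sub>2 = 0"
  "kappa s v\<^sub>1 v\<^sub>2 v\<^sub>3 = - ((g v\<^sub>3 v\<^sub>3 * m\<^sub>3\<^sub>1 + g v\<^sub>1 v\<^sub>1 * m\<^sub>1\<^sub>3) / 2 - s * H v\<^sub>1 v\<^sub>2 v\<^sub>3 / 2)"
  "kappa s v\<^sub>1 v\<^sub>3 v\<^sub>1 = 0"
  "kappa s v\<^sub>1 v\<^sub>3 v\<^sub>2 = (g v\<^sub>3 v\<^sub>3 * m\<^sub>3\<^sub>1 + g v\<^sub>1 v\<^sub>1 * m\<^sub>1\<^sub>3) / 2 - s * H v\<^sub>1 v\<^sub>2 v\<^sub>3 / 2"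
  "kappa s v\<^sub>1 v\<^sub>3 v\<^sub>3 = 0"
  "kappa s v\<^sub>2 v\<^sub>1 v\<^sub>1 = 0"
  "kappa s v\<^sub>2 v\<^sub>1 v\<^sub>2 = 0"
  "kappa s v\<^sub>2 v\<^sub>1 v\<^sub>3 = (g v\<^sub>3 v\<^sub>3 * m\<^sub>3\<^sub>1 - g v\<^sub>1 v\<^sub>1 * m\<^sub>1\<^sub>3) / 2 - s * H v\<^sub>1 v\<^sub>2 v\<^sub>3 / 2"
  "kappa s v\<^sub>2 v\<^sub>2 v\<^sub>1 = 0"
  "kappa s v\<^sub>2 v\<^sub>2 v\<^sub>2 = 0"
  "kappa s v\<^sub>2 v\<^sub>2 v\<^sub>3 = 0"
  "kappa s v\<^sub>2 v\<^sub>3 v\<^sub>1 = - ((g v\<^sub>3 v\<^sub>3 * m\<^sub>3\<^sub>1 - g v\<^sub>1 v\<^sub>1 * m\<^sub>1\<^sub>3) / 2 - s * H v\<^sub>1 v\<^sub>2 v\<^sub>3 / 2)"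
  "kappa s v\<^sub>2 v\<^sub>3 v\<^sub>2 = 0"
  "kappa s v\<^sub>2 v\<^sub>3 v\<^sub>3 = 0"
  "kappa s v\<^sub>3 v\<^sub>1 v\<^sub>1 = 0"
  "kappa s v\<^sub>3 v\<^sub>1 v\<^sub>2 = (g v\<^sub>3 v\<^sub>3 * m\<^sub>3\<^sub>1 + g v\<^sub>1 v\<^sub>1 * m\<^sub>1\<^sub>3) / 2 + s * H v\<^sub>1 v\<^sub>2 v\<^sub>3 / 2"
  "kappa s v\<^sub>3 v\<^sub>1 v\<^sub>3 = 0"
  "kappa s v\<^sub>3 v\<^sub>2 v\<^sub>1 = - ((g v\<^sub>3 v\<^sub>3 * m\<^sub>3\<^sub>1 + g v\<^sub>1 v\<^sub>1 * m\<^sub>1\<^sub>3) / 2 + s * H v\<^sub>1 v\<^sub>2 v\<^sub>3 / 2)"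
  "kappa s v\<^sub>3 v\<^sub>2 v\<^sub>2 = 0"
  "kappa s v\<^sub>3 v\<^sub>2 v\<^sub>3 = - (g v\<^sub>3 v\<^sub>3 * m\<^sub>3\<^sub>3)"
  "kappa s v\<^sub>3 v\<^sub>3 v\<^sub>1 = 0"
  "kappa s v\<^sub>3 v\<^sub>3 v\<^sub>2 = g v\<^sub>3 v\<^sub>3 * m\<^sub>3\<^sub>3"
  "kappa s v\<^sub>3 v\<^sub>3 v\<^sub>3 = 0"
  by (simp_all add: kappa_def br_table kernel_abelian H_table blinfun.bilinear_simps field_simps)

text \<open>Since \<open>nabla s v\<^sub>2 v\<^sub>2\<close> is zero, \<open>\<delta>\<close> drops
  out, and this component restricts the algebra, \<open>g\<close> and H alone. It is computed before
  the signs of \<open>g\<close> are known in order to determine them.\<close>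

lemma ricci_form_22:
  "ricci_form \<delta> s v\<^sub>2 v\<^sub>2 = - (m\<^sub>1\<^sub>1\<^sup>2 + m\<^sub>3\<^sub>3\<^sup>2
    + ((g v\<^sub>3 v\<^sub>3 * m\<^sub>3\<^sub>1 + g v\<^sub>1 v\<^sub>1 * m\<^sub>1\<^sub>3)\<^sup>2 + (s * H v\<^sub>1 v\<^sub>2 v\<^sub>3)\<^sup>2) / (2 * g v\<^sub>1 v\<^sub>1 * g v\<^sub>3 v\<^sub>3))"
  using distinct sign
  by (simp add: ricci_form_eq field_simps power2_eq_square)

lemma generalized_einstein_ricci_zero:
  assumes "generalized_einstein br H g \<delta>" "s \<in> {1, -1}"
  shows "ricci_form \<delta> s X Y = 0"
  using assms generalized_einstein_iff[of \<delta>] card_frame by auto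

text \<open>Up to sign, \<open>ricci_form_22\<close> is a sum of squares if \<open>g\<close> is definite on the kernel.\<close>

lemma einstein_opposite_signs:
  assumes "generalized_einstein br H g \<delta>"
  shows "g v\<^sub>1 v\<^sub>1 = - g v\<^sub>3 v\<^sub>3"
proof (rule ccontr)
  assume "g v\<^sub>1 v\<^sub>1 \<noteq> - g v\<^sub>3 v\<^sub>3"
  then have "g v\<^sub>1 v\<^sub>1 * g v\<^sub>3 v\<^sub>3 = 1"
    using sign(1,3) by (auto simp: abs_if split: if_splits)
  then have "ricci_form \<delta> 1 v\<^sub>2 v\<^sub>2 = - (m\<^sub>1\<^sub>1\<^sup>2 + m\<^sub>3\<^sub>3\<^sup>2
      + ((g v\<^sub>3 v\<^sub>3 * m\<^sub>3\<^sub>1 + g v\<^sub>1 v\<^sub>1 * m\<^sub>1\<^sub>3)\<^sup>2 + (H v\<^sub>1 v\<^sub>2 v\<^sub>3)\<^sup>2) / 2)"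
    unfolding ricci_form_22 by (simp add: mult.assoc)
  moreover have "ricci_form \<delta> 1 v\<^sub>2 v\<^sub>2 = 0"
    using generalized_einstein_ricci_zero[OF assms] by simp
  moreover have "0 \<le> ((g v\<^sub>3 v\<^sub>3 * m\<^sub>3\<^sub>1 + g v\<^sub>1 v\<^sub>1 * m\<^sub>1\<^sub>3)\<^sup>2 + (H v\<^sub>1 v\<^sub>2 v\<^sub>3)\<^sup>2) / 2"
    by simp
  ultimately have "m\<^sub>1\<^sub>1\<^sup>2 + m\<^sub>3\<^sub>3\<^sup>2 \<le> 0"
    by linarith
  then have "m\<^sub>1\<^sub>1 = 0" "m\<^sub>3\<^sub>3 = 0"
    by (simp_all add: sum_power2_le_zero_iff)
  then show False
    using trace_ad_v2 by simp
qed

end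

section \<open>The Einstein equation in an adapted basis\<close>

locale adapted_frame = kernel_frame +
  assumes signs: "g v\<^sub>2 v\<^sub>2 = g v\<^sub>1 v\<^sub>1" "g v\<^sub>3 v\<^sub>3 = - g v\<^sub>1 v\<^sub>1"

text \<open>The Ricci equations of one of the two signs, in suitable linear combinations; \<open>x\<^sub>1, x\<^sub>2, x\<^sub>3\<close>
  are the components of \<open>\<delta>\<close> on the corresponding half, and \<open>h\<close> changes its sign with the half.\<close>

definition einstein_half ::
  "real \<Rightarrow> real \<Rightarrow> real \<Rightarrow> real \<Rightarrow> real \<Rightarrow> real \<Rightarrow> real \<Rightarrow> real \<Rightarrow> real \<Rightarrow> bool" where
  "einstein_half \<epsilon> a b c d h x\<^sub>1 x\<^sub>2 x\<^sub>3 \<longleftrightarrow>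
     2 * a\<^sup>2 + 2 * d\<^sup>2 = (b - c)\<^sup>2 + h\<^sup>2 \<and>
     2 * a * x\<^sub>2 = b\<^sup>2 - c\<^sup>2 - h\<^sup>2 \<and> - 2 * d * x\<^sub>2 = b\<^sup>2 - c\<^sup>2 + h\<^sup>2 \<and>
     (b - c) * x\<^sub>2 = (b + c) * (a - d) \<and> h * x\<^sub>2 = - h * (a + d) \<and>
     (b + c + \<epsilon> * h) * x\<^sub>1 = 0 \<and> (b + c + \<epsilon> * h) * x\<^sub>3 = 0 \<and>
     2 * a * x\<^sub>1 = (b - c - \<epsilon> * h) * x\<^sub>3 \<and> (b - c + \<epsilon> * h) * x\<^sub>1 + 2 * d * x\<^sub>3 = 0"

context adapted_frame
begin

lemma ricci_half_iff:
  assumes "s \<in> {1, -1}"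
  shows "(\<forall>X Y. ricci_form \<delta> s X Y = 0) \<longleftrightarrow>
    einstein_half (g v\<^sub>1 v\<^sub>1) m\<^sub>1\<^sub>1 m\<^sub>1\<^sub>3 m\<^sub>3\<^sub>1 m\<^sub>3\<^sub>3 (s * H v\<^sub>1 v\<^sub>2 v\<^sub>3)
      (\<delta> (lift g s v\<^sub>1)) (\<delta> (lift g s v\<^sub>2)) (\<delta> (lift g s v\<^sub>3))"
proof -
  define \<epsilon> a b c d h x\<^sub>1 x\<^sub>2 x\<^sub>3 where defs: "\<epsilon> = g v\<^sub>1 v\<^sub>1" "a = m\<^sub>1\<^sub>1" "b = m\<^sub>1\<^sub>3" "c = m\<^sub>3\<^sub>1" "d = m\<^sub>3\<^sub>3"
    "h = H v\<^sub>1 v\<^sub>2 v\<^sub>3" "x\<^sub>1 = \<delta> (lift g s v\<^sub>1)" "x\<^sub>2 = \<delta> (lift g s v\<^sub>2)" "x\<^sub>3 = \<delta> (lift g s v\<^sub>3)"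
  note fold = defs[symmetric]
  have \<epsilon>: "\<epsilon> = 1 \<or> \<epsilon> = -1"
    using sign(1) by (auto simp: defs)
  have s: "s = 1 \<or> s = -1"
    using assms by auto
  note expand = ricci_form_eq signs fold distinct
  \<comment> \<open>With opposite signs on the kernel, the off-diagonal symmetric part of
    \<open>br v\<^sub>2\<close> is proportional to b - c and the skew part to b + c.\<close>
  have R: "ricci_form \<delta> s v\<^sub>1 v\<^sub>1 = a * x\<^sub>2 + (c\<^sup>2 - b\<^sup>2 + h\<^sup>2) / 2"
    "ricci_form \<delta> s v\<^sub>3 v\<^sub>3 = - d * x\<^sub>2 + (c\<^sup>2 - b\<^sup>2 - h\<^sup>2) / 2"
    "ricci_form \<delta> s v\<^sub>2 v\<^sub>2 = ((b - c)\<^sup>2 + h\<^sup>2) / 2 - a\<^sup>2 - d\<^sup>2"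
    "ricci_form \<delta> s v\<^sub>1 v\<^sub>3
      = ((b - c) * x\<^sub>2 - (b + c) * (a - d) - \<epsilon> * (s * h * x\<^sub>2 + s * h * (a + d))) / 2"
    "ricci_form \<delta> s v\<^sub>3 v\<^sub>1
      = ((b - c) * x\<^sub>2 - (b + c) * (a - d) + \<epsilon> * (s * h * x\<^sub>2 + s * h * (a + d))) / 2"
    "ricci_form \<delta> s v\<^sub>2 v\<^sub>1 = (b + c + \<epsilon> * s * h) * x\<^sub>3 / 2"
    "ricci_form \<delta> s v\<^sub>2 v\<^sub>3 = (b + c + \<epsilon> * s * h) * x\<^sub>1 / 2"
    "ricci_form \<delta> s v\<^sub>1 v\<^sub>2 = - a * x\<^sub>1 + (b - c - \<epsilon> * s * h) * x\<^sub>3 / 2"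
    "ricci_form \<delta> s v\<^sub>3 v\<^sub>2 = - (b - c + \<epsilon> * s * h) * x\<^sub>1 / 2 - d * x\<^sub>3"
    using s \<epsilon> by (auto simp: expand power2_eq_square field_simps)
  have h2: "(s * h)\<^sup>2 = h\<^sup>2"
    using s by auto
  have "ricci_form \<delta> s v\<^sub>1 v\<^sub>1 = 0 \<longleftrightarrow> 2 * a * x\<^sub>2 = b\<^sup>2 - c\<^sup>2 - (s * h)\<^sup>2"
    "ricci_form \<delta> s v\<^sub>3 v\<^sub>3 = 0 \<longleftrightarrow> - 2 * d * x\<^sub>2 = b\<^sup>2 - c\<^sup>2 + (s * h)\<^sup>2"
    "ricci_form \<delta> s v\<^sub>2 v\<^sub>2 = 0 \<longleftrightarrow> 2 * a\<^sup>2 + 2 * d\<^sup>2 = (b - c)\<^sup>2 + (s * h)\<^sup>2"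
    "ricci_form \<delta> s v\<^sub>1 v\<^sub>2 = 0 \<longleftrightarrow> 2 * a * x\<^sub>1 = (b - c - \<epsilon> * (s * h)) * x\<^sub>3"
    "ricci_form \<delta> s v\<^sub>3 v\<^sub>2 = 0 \<longleftrightarrow> (b - c + \<epsilon> * (s * h)) * x\<^sub>1 + 2 * d * x\<^sub>3 = 0"
    unfolding R h2 mult.assoc by argo+
  moreover have "ricci_form \<delta> s v\<^sub>2 v\<^sub>1 = 0 \<longleftrightarrow> (b + c + \<epsilon> * (s * h)) * x\<^sub>3 = 0"
    "ricci_form \<delta> s v\<^sub>2 v\<^sub>3 = 0 \<longleftrightarrow> (b + c + \<epsilon> * (s * h)) * x\<^sub>1 = 0"
    unfolding R by (simp_all add: mult.assoc)
  moreover have "ricci_form \<delta> s v\<^sub>1 v\<^sub>3 = 0 \<and> ricci_form \<delta> s v\<^sub>3 v\<^sub>1 = 0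
    \<longleftrightarrow> (b - c) * x\<^sub>2 = (b + c) * (a - d) \<and> s * h * x\<^sub>2 = - (s * h) * (a + d)"
  proof -
    \<comment> \<open>The components (1,3) and (3,1) differ only in the sign of the term with
      \<open>\<epsilon>\<close>, so together they split into the equation without
      \<open>\<epsilon>\<close> and the one with it.\<close>
    have "(u - \<epsilon> * w) / 2 = 0 \<and> (u + \<epsilon> * w) / 2 = 0 \<longleftrightarrow> u = 0 \<and> w = 0" for u w
      using \<epsilon> by auto
    then show ?thesis
      unfolding R by (simp add: eq_neg_iff_add_eq_0)
  qed
  ultimately have "(\<forall>X Y. ricci_form \<delta> s X Y = 0) \<longleftrightarrow> einstein_half \<epsilon> a b c d (s * h) x\<^sub>1 x\<^sub>2 x\<^sub>3"
    unfolding ricci_form_zero_iff einstein_half_def by blast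
  then show ?thesis
    by (simp add: defs)
qed

end
section \<open>Solving the Einstein equations\<close>

text \<open>The difference of the two diagonal equations. Its right side is even in h, so both
  halves give the same \<open>x\<^sub>2\<close>.\<close>

lemma einstein_half_trace:
  assumes "einstein_half \<epsilon> a b c d h x\<^sub>1 x\<^sub>2 x\<^sub>3"
  shows "(a + d) * x\<^sub>2 = - h\<^sup>2"
  using assms by (simp add: einstein_half_def algebra_simps)

text \<open>With h = 0 the diagonal equations reduce to b^2 = c^2, and b = c would force a = d =
  0.\<close>

lemma einstein_half_zero:
  assumes "einstein_half \<epsilon> a b c d h x\<^sub>1 0 x\<^sub>3" "a + d \<noteq> 0"
  shows "h = 0" "c = - b" "a\<^sup>2 + d\<^sup>2 = 2 * b\<^sup>2" "x\<^sub>1 = 0" "x\<^sub>3 = 0"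
proof -
  show h: "h = 0"
    using einstein_half_trace[OF assms(1)] by simp
  have eqs: "2 * a\<^sup>2 + 2 * d\<^sup>2 = (b - c)\<^sup>2" "b\<^sup>2 = c\<^sup>2" "2 * a * x\<^sub>1 = (b - c) * x\<^sub>3"
      "(b - c) * x\<^sub>1 + 2 * d * x\<^sub>3 = 0"
    using assms(1) h by (simp_all add: einstein_half_def)
  have "b \<noteq> c"
  proof
    assume "b = c"
    then have "a\<^sup>2 + d\<^sup>2 \<le> 0"
      using eqs(1) by simp
    then show False
      using assms(2) by (simp add: sum_power2_le_zero_iff)
  qed
  then show c: "c = - b"
    using eqs(2) by (auto simp: power2_eq_iff)
  show b: "a\<^sup>2 + d\<^sup>2 = 2 * b\<^sup>2"
    using eqs(1) c by (simp add: power2_eq_square)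
  have x: "a * x\<^sub>1 = b * x\<^sub>3" "b * x\<^sub>1 = - d * x\<^sub>3"
    using eqs(3,4) c by simp_all
  \<comment> \<open>The two linear equations for \<open>x\<^sub>1\<close> and
    \<open>x\<^sub>3\<close> have determinant a d + b^2, which is (a + d)^2 / 2 by the relation just
    shown.\<close>
  have "(a + d)\<^sup>2 * x\<^sub>1 = 2 * (b\<^sup>2 * x\<^sub>1 + d * (a * x\<^sub>1))"
    "(a + d)\<^sup>2 * x\<^sub>3 = 2 * (b * (b * x\<^sub>3) + a * d * x\<^sub>3)"
    using b by algebra+
  moreover have "b\<^sup>2 * x\<^sub>1 + d * (a * x\<^sub>1) = 0" "b * (b * x\<^sub>3) + a * d * x\<^sub>3 = 0"
    using x by algebra+
  ultimately show "x\<^sub>1 = 0" "x\<^sub>3 = 0"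
    using assms(2) by simp_all
qed

text \<open>As h is nonzero, h can be cancelled in the equation for h \<open>x\<^sub>2\<close>. Then
  h^2 = (a + d)^2 turns the quadratic equation into (a - d)^2 = (b - c)^2, and for either sign the
  equation for (b - c) \<open>x\<^sub>2\<close> factors. Matrices of the second alternative are
  singular.\<close>

lemma einstein_half_nonzero:
  assumes half: "einstein_half \<epsilon> a b c d h x\<^sub>1 x\<^sub>2 x\<^sub>3" and t: "a + d \<noteq> 0" and "x\<^sub>2 \<noteq> 0"
  shows "x\<^sub>2 = - (a + d)" "h\<^sup>2 = (a + d)\<^sup>2"
    and "a = d \<and> b = c \<or> (\<exists>\<sigma>\<in>{1, -1}. b = - \<sigma> * d \<and> c = - \<sigma> * a)"
proof -
  have h: "h \<noteq> 0"
    using einstein_half_trace[OF half] assms(2,3) by auto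
  have "h * (x\<^sub>2 + (a + d)) = 0"
    using half by (simp add: einstein_half_def algebra_simps)
  then show x: "x\<^sub>2 = - (a + d)"
    using h by simp
  show h2: "h\<^sup>2 = (a + d)\<^sup>2"
    using einstein_half_trace[OF half] x by algebra
  have "2 * a\<^sup>2 + 2 * d\<^sup>2 = (b - c)\<^sup>2 + (a + d)\<^sup>2" and bc: "(b - c) * x\<^sub>2 = (b + c) * (a - d)"
    using half h2 by (simp_all add: einstein_half_def)
  then have "(a - d)\<^sup>2 = (b - c)\<^sup>2"
    by algebra
  then consider "a - d = b - c" | "a - d = - (b - c)"
    by (auto simp: power2_eq_iff)
  then show "a = d \<and> b = c \<or> (\<exists>\<sigma>\<in>{1, -1}. b = - \<sigma> * d \<and> c = - \<sigma> * a)"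
  proof cases
    case 1
    then have "(b - c) * (b + c + (a + d)) = 0"
      using bc x by algebra
    then show ?thesis
      using 1 by auto
  next
    case 2
    then have "(b - c) * (b + c - (a + d)) = 0"
      using bc x by algebra
    then show ?thesis
      using 2 by auto
  qed
qed

section \<open>The nine families as two patterns of matrices\<close>

lemma mat22_eq_iff: "mat22 a b c d = mat22 a' b' c' d' \<longleftrightarrow> a = a' \<and> b = b' \<and> c = c' \<and> d = d'"
  by (auto simp: vec_eq_iff forall_2)

text \<open>The sign \<open>\<sigma>\<close> separates A from B, and the sign of h separates 2 from
  3. The one-parameter families are the cases \<open>\<nu> = - \<mu>\<close> of the others: C lies
  in B and D in A. Hence the converse only produces families 1, 2A, 2B, 3A and 3B, with parameters
  read off the matrix entries.\<close>

lemma distinct_eigenvalue_families_iff: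
  assumes \<epsilon>: "\<epsilon> \<in> {1, -1}"
  shows "distinct_eigenvalue_families \<epsilon> \<epsilon> (- \<epsilon>) h x\<^sub>1 x\<^sub>2 x\<^sub>3 x\<^sub>4 x\<^sub>5 x\<^sub>6 (mat22 a b c d) \<longleftrightarrow>
    (a = d \<and> b = c \<and> a \<noteq> 0 \<and> b \<noteq> 0 \<and> \<bar>b\<bar> \<noteq> \<bar>a\<bar> \<and> (h = 2 * a \<or> h = - 2 * a) \<and>
      x\<^sub>2 = - 2 * a \<and> x\<^sub>5 = - 2 * a \<and> x\<^sub>1 = 0 \<and> x\<^sub>3 = 0 \<and> x\<^sub>4 = 0 \<and> x\<^sub>6 = 0) \<or>
    (\<exists>\<sigma>\<in>{1, -1}. b = - \<sigma> * d \<and> c = - \<sigma> * a \<and> a + d \<noteq> 0 \<and> x\<^sub>2 = - (a + d) \<and> x\<^sub>5 = - (a + d) \<and>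
      (h = \<sigma> * \<epsilon> * (a + d) \<and> x\<^sub>4 = 0 \<and> x\<^sub>6 = 0 \<and> a * x\<^sub>1 = - \<sigma> * d * x\<^sub>3 \<or>
       h = - \<sigma> * \<epsilon> * (a + d) \<and> x\<^sub>1 = 0 \<and> x\<^sub>3 = 0 \<and> a * x\<^sub>4 = - \<sigma> * d * x\<^sub>6))"
    (is "?F \<longleftrightarrow> ?A \<or> ?B")
proof
  have "\<epsilon> = 1 \<or> \<epsilon> = -1"
    using \<epsilon> by auto
  moreover assume ?F
  ultimately show "?A \<or> ?B"
    unfolding distinct_eigenvalue_families_def mat22_eq_iff
    by (elim disjE exE conjE) simp_all
next
  assume "?A \<or> ?B"
  then show ?F
  proof
    assume ?A
    with \<epsilon> show ?F
      unfolding distinct_eigenvalue_families_def mat22_eq_iff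
      by (intro disjI1 exI[of _ "\<epsilon> * a"] exI[of _ "- \<epsilon> * b"]) auto
  next
    assume ?B
    then obtain \<sigma> where \<sigma>: "\<sigma> = 1 \<or> \<sigma> = -1" and bc: "b = - \<sigma> * d" "c = - \<sigma> * a" "a + d \<noteq> 0"
      "x\<^sub>2 = - (a + d)" "x\<^sub>5 = - (a + d)"
      and cases: "h = \<sigma> * \<epsilon> * (a + d) \<and> x\<^sub>4 = 0 \<and> x\<^sub>6 = 0 \<and> a * x\<^sub>1 = - \<sigma> * d * x\<^sub>3 \<or>
       h = - \<sigma> * \<epsilon> * (a + d) \<and> x\<^sub>1 = 0 \<and> x\<^sub>3 = 0 \<and> a * x\<^sub>4 = - \<sigma> * d * x\<^sub>6"
      by blast
    note unf = distinct_eigenvalue_families_def mat22_eq_iff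
    from cases \<sigma> show ?F
    proof (elim disjE)
      assume "h = \<sigma> * \<epsilon> * (a + d) \<and> x\<^sub>4 = 0 \<and> x\<^sub>6 = 0 \<and> a * x\<^sub>1 = - \<sigma> * d * x\<^sub>3" "\<sigma> = 1"
      then show ?F
        unfolding unf using bc \<epsilon>
        by (intro disjI2[OF disjI1] exI[of _ "\<epsilon> * a"] exI[of _ "- \<epsilon> * d"]) auto
    next
      assume "h = \<sigma> * \<epsilon> * (a + d) \<and> x\<^sub>4 = 0 \<and> x\<^sub>6 = 0 \<and> a * x\<^sub>1 = - \<sigma> * d * x\<^sub>3" "\<sigma> = -1"
      then show ?F
        unfolding unf using bc \<epsilon>
        by (intro disjI2[OF disjI2[OF disjI1]] exI[of _ "- \<epsilon> * a"] exI[of _ "\<epsilon> * d"]) auto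
    next
      assume "h = - \<sigma> * \<epsilon> * (a + d) \<and> x\<^sub>1 = 0 \<and> x\<^sub>3 = 0 \<and> a * x\<^sub>4 = - \<sigma> * d * x\<^sub>6" "\<sigma> = 1"
      then show ?F
        unfolding unf using bc \<epsilon>
        by (intro disjI2[OF disjI2[OF disjI2[OF disjI2[OF disjI2[OF disjI1]]]]]
            exI[of _ "\<epsilon> * a"] exI[of _ "- \<epsilon> * d"]) auto
    next
      assume "h = - \<sigma> * \<epsilon> * (a + d) \<and> x\<^sub>1 = 0 \<and> x\<^sub>3 = 0 \<and> a * x\<^sub>4 = - \<sigma> * d * x\<^sub>6" "\<sigma> = -1"
      then show ?F
        unfolding unf using bc \<epsilon>
        by (intro disjI2[OF disjI2[OF disjI2[OF disjI2[OF disjI2[OF disjI2[OF disjI1]]]]]]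
            exI[of _ "- \<epsilon> * a"] exI[of _ "\<epsilon> * d"]) auto
    qed
  qed
qed

lemma einstein_half_symmetric:
  assumes "h = 2 * a \<or> h = - 2 * a"
  shows "einstein_half \<epsilon> a b b a h 0 (- 2 * a) 0"
  using assms by (auto simp: einstein_half_def power2_eq_square)

text \<open>For the first sign of h the factor \<open>b + c + \<epsilon> * h\<close> vanishes, and
  both equations that couple \<open>x\<^sub>1\<close> and \<open>x\<^sub>3\<close> become the same
  linear relation. The two halves see opposite signs of h, so each solution uses the first statement
  on one half and the second on the other.\<close>

lemma einstein_half_singular:
  assumes "\<epsilon> \<in> {1, -1}" "\<sigma> \<in> {1, -1}"
  shows "a * x\<^sub>1 = - \<sigma> * d * x\<^sub>3 \<Longrightarrow>
      einstein_half \<epsilon> a (- \<sigma> * d) (- \<sigma> * a) d (\<sigma> * \<epsilon> * (a + d)) x\<^sub>1 (- (a + d)) x\<^sub>3"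
    and "einstein_half \<epsilon> a (- \<sigma> * d) (- \<sigma> * a) d (- \<sigma> * \<epsilon> * (a + d)) 0 (- (a + d)) 0"
  using assms by (auto simp: einstein_half_def power2_eq_square algebra_simps)

lemma families_iff_einstein_half:
  assumes \<epsilon>: "\<epsilon> \<in> {1, -1}" and t: "a + d \<noteq> 0"
  shows "distinct_eigenvalue_families \<epsilon> \<epsilon> (- \<epsilon>) h x\<^sub>1 x\<^sub>2 x\<^sub>3 x\<^sub>4 x\<^sub>5 x\<^sub>6 (mat22 a b c d) \<longleftrightarrow>
    einstein_half \<epsilon> a b c d h x\<^sub>1 x\<^sub>2 x\<^sub>3 \<and> einstein_half \<epsilon> a b c d (- h) x\<^sub>4 x\<^sub>5 x\<^sub>6 \<and>
    x\<^sub>2 = x\<^sub>5 \<and> x\<^sub>2 \<noteq> 0 \<and> \<not> (a = d \<and> b = 0 \<and> c = 0)"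
    (is "?F \<longleftrightarrow> ?E")
proof
  assume ?F
  then consider (symmetric) "a = d" "b = c" "a \<noteq> 0" "b \<noteq> 0" "h = 2 * a \<or> h = - 2 * a"
      "x\<^sub>2 = - 2 * a" "x\<^sub>5 = - 2 * a" "x\<^sub>1 = 0" "x\<^sub>3 = 0" "x\<^sub>4 = 0" "x\<^sub>6 = 0"
    | (singular) \<sigma> where "\<sigma> \<in> {1, -1}" "b = - \<sigma> * d" "c = - \<sigma> * a" "x\<^sub>2 = - (a + d)" "x\<^sub>5 = - (a + d)"
      "h = \<sigma> * \<epsilon> * (a + d) \<and> x\<^sub>4 = 0 \<and> x\<^sub>6 = 0 \<and> a * x\<^sub>1 = - \<sigma> * d * x\<^sub>3 \<or>
       h = - \<sigma> * \<epsilon> * (a + d) \<and> x\<^sub>1 = 0 \<and> x\<^sub>3 = 0 \<and> a * x\<^sub>4 = - \<sigma> * d * x\<^sub>6"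
    unfolding distinct_eigenvalue_families_iff[OF \<epsilon>] by blast
  then show ?E
  proof cases
    case symmetric
    then show ?thesis
      using einstein_half_symmetric[of h a \<epsilon> b] einstein_half_symmetric[of "- h" a \<epsilon> b] by auto
  next
    case singular
    have "- \<sigma> * (\<epsilon> * (a + d)) = - (\<sigma> * \<epsilon> * (a + d))"
      by simp
    then show ?thesis
      using singular t einstein_half_singular(1)[OF \<epsilon> singular(1), of a x\<^sub>1 d x\<^sub>3]
        einstein_half_singular(1)[OF \<epsilon> singular(1), of a x\<^sub>4 d x\<^sub>6]
        einstein_half_singular(2)[OF \<epsilon> singular(1), of a d] by auto
  qed
next
  assume E: ?E
  then have plus: "einstein_half \<epsilon> a b c d h x\<^sub>1 x\<^sub>2 x\<^sub>3" and minus: "einstein_half \<epsilon> a b c d (- h) x\<^sub>4 x\<^sub>5 x\<^sub>6"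
    and x: "x\<^sub>2 = x\<^sub>5" "x\<^sub>2 \<noteq> 0" and not_scalar: "\<not> (a = d \<and> b = 0 \<and> c = 0)"
    by auto
  note sol = einstein_half_nonzero[OF plus t x(2)]
  have x2: "x\<^sub>2 = - (a + d)" "x\<^sub>5 = - (a + d)"
    using sol(1) x(1) by simp_all
  have h: "h = a + d \<or> h = - (a + d)"
    using sol(2) by (simp add: power2_eq_iff)
  have eqs: "(b + c + \<epsilon> * h) * x\<^sub>1 = 0" "(b + c + \<epsilon> * h) * x\<^sub>3 = 0"
    "(b + c - \<epsilon> * h) * x\<^sub>4 = 0" "(b + c - \<epsilon> * h) * x\<^sub>6 = 0"
    "2 * a * x\<^sub>1 = (b - c - \<epsilon> * h) * x\<^sub>3" "2 * a * x\<^sub>4 = (b - c + \<epsilon> * h) * x\<^sub>6"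
    using plus minus by (simp_all add: einstein_half_def)
  have F: ?F if \<sigma>: "\<sigma> \<in> {1, -1}" and bc: "b = - \<sigma> * d" "c = - \<sigma> * a" for \<sigma>
  proof -
    have bc_sum: "b + c = - \<sigma> * (a + d)"
      using bc by (simp add: algebra_simps)
    \<comment> \<open>Exactly one of \<open>b + c + \<epsilon> * h\<close> and
      \<open>b + c - \<epsilon> * h\<close> vanishes; the nonzero one kills the kernel components of
      \<open>\<delta>\<close> on its half.\<close>
    consider "\<epsilon> * h = \<sigma> * (a + d)" | "\<epsilon> * h = - \<sigma> * (a + d)"
      using h \<epsilon> \<sigma> by auto
    then show ?F
    proof cases
      case 1
      then have "b + c - \<epsilon> * h = - 2 * \<sigma> * (a + d)" "b - c - \<epsilon> * h = - 2 * \<sigma> * d"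
        using bc_sum bc by (simp_all add: algebra_simps)
      then have "x\<^sub>4 = 0" "x\<^sub>6 = 0" "a * x\<^sub>1 = - \<sigma> * d * x\<^sub>3"
        using eqs(3,4,5) t \<sigma> by auto
      moreover have "h = \<sigma> * \<epsilon> * (a + d)"
        using 1 \<epsilon> by auto
      ultimately show ?F
        unfolding distinct_eigenvalue_families_iff[OF \<epsilon>] using \<sigma> bc x2 t by blast
    next
      case 2
      then have "b + c + \<epsilon> * h = - 2 * \<sigma> * (a + d)" "b - c + \<epsilon> * h = - 2 * \<sigma> * d"
        using bc_sum bc by (simp_all add: algebra_simps)
      then have "x\<^sub>1 = 0" "x\<^sub>3 = 0" "a * x\<^sub>4 = - \<sigma> * d * x\<^sub>6"
        using eqs(1,2,6) t \<sigma> by auto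
      moreover have "h = - \<sigma> * \<epsilon> * (a + d)"
        using 2 \<epsilon> by auto
      ultimately show ?F
        unfolding distinct_eigenvalue_families_iff[OF \<epsilon>] using \<sigma> bc x2 t by blast
    qed
  qed
  \<comment> \<open>Symmetric matrices with equal absolute values of a and b also fit the singular
    pattern and are moved there. The factors 1 and -1 display the two values of
    \<open>\<sigma>\<close>.\<close>
  consider (symmetric) "a = d" "b = c" "\<bar>b\<bar> \<noteq> \<bar>a\<bar>"
    | (singular) "b = - 1 * d \<and> c = - 1 * a \<or> b = - (- 1) * d \<and> c = - (- 1) * a"
    using sol(3) by (auto simp: abs_eq_iff)
  then show ?F
  proof cases
    case symmetric
    then have "a \<noteq> 0" "b \<noteq> 0"
      using t not_scalar by auto
    \<comment> \<open>Here b + c has absolute value twice that of b, and h twice that of a.\<close>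
    moreover have "b + c + \<epsilon> * h \<noteq> 0" "b + c - \<epsilon> * h \<noteq> 0"
      using symmetric h \<epsilon> by auto
    ultimately show ?F
      unfolding distinct_eigenvalue_families_iff[OF \<epsilon>] using symmetric eqs h x2 by auto
  next
    case singular
    then show ?F
      using F[of 1] F[of "-1"] by auto
  qed
qed

section \<open>Adapted bases\<close>

text \<open>By polarization, a symmetric form that vanishes on all pairs (X,X) is zero.\<close>

lemma exists_nonnull_vector:
  fixes g :: "'a::euclidean_space \<Rightarrow>\<^sub>L 'a \<Rightarrow>\<^sub>L real"
  assumes V: "subspace V" "V \<noteq> {0}" and g: "nondegenerate_on V g" "\<And>X Y. g X Y = g Y X"
  obtains X where "X \<in> V" "\<bar>g X X\<bar> = 1"
proof -
  have "\<exists>X\<in>V. g X X \<noteq> 0"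
  proof (rule ccontr)
    assume "\<not> (\<exists>X\<in>V. g X X \<noteq> 0)"
    then have null: "g X X = 0" if "X \<in> V" for X
      using that by blast
    have "g X Y = 0" if "X \<in> V" "Y \<in> V" for X Y
      using null[of "X + Y"] null[of X] null[of Y] that subspace_add[OF V(1)] g(2)[of Y X]
      by (simp add: blinfun.bilinear_simps)
    then have "V \<subseteq> {0}"
      using g(1) by (auto simp: nondegenerate_on_def)
    then show False
      using V subspace_0 by blast
  qed
  then obtain X where X: "X \<in> V" "g X X \<noteq> 0"
    by blast
  define r where "r = sqrt \<bar>g X X\<bar>"
  have r: "r * r = \<bar>g X X\<bar>" "r > 0"
    using X(2) by (simp_all add: r_def)
  show ?thesis
  proof (rule that)
    show "(1 / r) *\<^sub>R X \<in> V"
      using X(1) V(1) by (rule subspace_scale[rotated])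
    show "\<bar>g ((1 / r) *\<^sub>R X) ((1 / r) *\<^sub>R X)\<bar> = 1"
      using r X(2) by (simp add: blinfun.bilinear_simps abs_mult flip: r(1))
  qed
qed

lemma span_not_UNIV:
  assumes "card A < DIM('a)" "finite A" shows "span A \<noteq> (UNIV :: 'a::euclidean_space set)"
proof
  assume "span A = UNIV"
  then have "dim A = DIM('a)"
    by (metis dim_UNIV dim_span)
  then show False
    using dim_le_card'[OF assms(2)] assms(1) by simp
qed

text \<open>The induction step of orthogonalization in indefinite signature: non-degeneracy passes
  to the complement of a non-null vector, so a further non-null vector can be found there.\<close>

lemma orthogonal_complement:
  fixes g :: "'a::euclidean_space \<Rightarrow>\<^sub>L 'a \<Rightarrow>\<^sub>L real"
  assumes V: "subspace V" and g: "nondegenerate_on V g" "\<And>X Y. g X Y = g Y X"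
    and v: "v \<in> V" "\<bar>g v v\<bar> = 1"
  shows "subspace {Y \<in> V. g v Y = 0}" "nondegenerate_on {Y \<in> V. g v Y = 0} g"
    and "\<And>W. W \<in> V \<Longrightarrow> W - (g v W / g v v) *\<^sub>R v \<in> {Y \<in> V. g v Y = 0}"
proof -
  show "subspace {Y \<in> V. g v Y = 0}"
    using V by (auto simp: subspace_def blinfun.bilinear_simps)
  show proj: "W - (g v W / g v v) *\<^sub>R v \<in> {Y \<in> V. g v Y = 0}" if "W \<in> V" for W
    using that v V by (auto simp: subspace_diff subspace_scale blinfun.bilinear_simps)
  show "nondegenerate_on {Y \<in> V. g v Y = 0} g"
    unfolding nondegenerate_on_def
  proof (intro ballI impI)
    fix X assume X: "X \<in> {Y \<in> V. g v Y = 0}" "\<forall>Y\<in>{Y \<in> V. g v Y = 0}. g X Y = 0"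
    have "g X W = 0" if "W \<in> V" for W
    proof -
      have "g X (W - (g v W / g v v) *\<^sub>R v) = 0"
        using X(2) proj[OF that] by blast
      then show ?thesis
        using X(1) g(2)[of X v] by (simp add: blinfun.bilinear_simps)
    qed
    then show "X = 0"
      using g(1) X(1) by (auto simp: nondegenerate_on_def)
  qed
qed

lemma exists_kernel_frame:
  fixes br :: "'a::euclidean_space \<Rightarrow>\<^sub>L 'a \<Rightarrow>\<^sub>L 'a"
  assumes dim: "DIM('a) = 3" and nonunimodular: "unimodular_kernel br \<noteq> UNIV"
    and g: "pseudo_metric g" and U_nondeg: "nondegenerate_on (unimodular_kernel br) g"
  obtains v\<^sub>1 v\<^sub>2 v\<^sub>3 where "orthonormal_basis g v\<^sub>1 v\<^sub>2 v\<^sub>3"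
    "v\<^sub>1 \<in> unimodular_kernel br" "v\<^sub>3 \<in> unimodular_kernel br"
proof -
  define U where "U = unimodular_kernel br"
  have U: "subspace U"
    unfolding U_def by (rule subspace_unimodular_kernel)
  have U_nondeg: "nondegenerate_on U g"
    using U_nondeg by (simp add: U_def)
  have comm: "g X Y = g Y X" for X Y
    using g by (simp add: pseudo_metric_def)
  obtain Z where Z: "Z \<notin> U"
    using nonunimodular by (auto simp: U_def)
  have U_decomposition: "\<exists>r. X - r *\<^sub>R Z \<in> U" for X
  proof
    show "X - (trace_on UNIV (br X) / trace_on UNIV (br Z)) *\<^sub>R Z \<in> U"
      using Z by (simp add: U_def unimodular_kernel_def linear_diff[OF linear_trace_ad]
          linear_scale[OF linear_trace_ad])
  qed
  \<comment> \<open>The kernel has dimension at least two, because together with \<open>Z\<close> it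
    spans everything.\<close>
  have large: "\<not> U \<subseteq> span A" if "finite A" "card A \<le> 1" for A
  proof
    assume "U \<subseteq> span A"
    have "X \<in> span (insert Z A)" for X
      using U_decomposition[of X] \<open>U \<subseteq> span A\<close> by (auto simp: span_breakdown_eq)
    moreover have "card (insert Z A) < DIM('a)"
      using card_insert_le_m1[of 2 A Z] that dim by (simp add: card_insert_if)
    ultimately show False
      using span_not_UNIV[of "insert Z A"] that by auto
  qed
  have "U \<noteq> {0}"
    using large[of "{}"] by auto
  then obtain v\<^sub>1 where v1: "v\<^sub>1 \<in> U" "\<bar>g v\<^sub>1 v\<^sub>1\<bar> = 1"
    using exists_nonnull_vector[OF U _ U_nondeg comm] by blast
  note V = orthogonal_complement[OF U U_nondeg comm v1]
  have "{Y \<in> U. g v\<^sub>1 Y = 0} \<noteq> {0}"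
  proof
    assume "{Y \<in> U. g v\<^sub>1 Y = 0} = {0}"
    then have "U \<subseteq> span {v\<^sub>1}"
      using V(3) by (auto simp: span_singleton)
    then show False
      using large[of "{v\<^sub>1}"] by simp
  qed
  then obtain v\<^sub>3 where v3: "v\<^sub>3 \<in> {Y \<in> U. g v\<^sub>1 Y = 0}" "\<bar>g v\<^sub>3 v\<^sub>3\<bar> = 1"
    using exists_nonnull_vector[OF V(1) _ V(2) comm] by blast
  have UNIV_nondeg: "nondegenerate_on UNIV g"
    using g by (simp add: pseudo_metric_def)
  note V1 = orthogonal_complement[OF subspace_UNIV UNIV_nondeg comm UNIV_I v1(2)]
  have "v\<^sub>3 \<in> {Y \<in> UNIV. g v\<^sub>1 Y = 0}"
    using v3(1) by simp
  note V2 = orthogonal_complement[OF V1(1,2) comm this v3(2)]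
  \<comment> \<open>Projecting \<open>Z\<close> off \<open>v\<^sub>1\<close> and
    \<open>v\<^sub>3\<close> shows that their common complement is nonzero: \<open>Z\<close> lies
    outside the kernel, the subtracted part inside.\<close>
  obtain x y where "Z - x *\<^sub>R v\<^sub>1 - y *\<^sub>R v\<^sub>3 \<in> {Y \<in> {Y \<in> UNIV. g v\<^sub>1 Y = 0}. g v\<^sub>3 Y = 0}"
    using V2(3)[OF V1(3)[OF UNIV_I, of Z]] by blast
  moreover have "Z - x *\<^sub>R v\<^sub>1 - y *\<^sub>R v\<^sub>3 \<noteq> 0"
  proof
    assume "Z - x *\<^sub>R v\<^sub>1 - y *\<^sub>R v\<^sub>3 = 0"
    then have "Z = x *\<^sub>R v\<^sub>1 + y *\<^sub>R v\<^sub>3"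
      by (simp add: algebra_simps)
    then show False
      using Z U v1(1) v3(1) by (simp add: subspace_add subspace_scale)
  qed
  ultimately obtain v\<^sub>2 where v2: "g v\<^sub>1 v\<^sub>2 = 0" "g v\<^sub>3 v\<^sub>2 = 0" "\<bar>g v\<^sub>2 v\<^sub>2\<bar> = 1"
    using exists_nonnull_vector[OF V2(1) _ V2(2) comm] by blast
  show ?thesis
  proof (rule that)
    show "orthonormal_basis g v\<^sub>1 v\<^sub>2 v\<^sub>3"
      using orthonormal_basisI[OF dim g] v1 v2 v3 comm[of v\<^sub>2 v\<^sub>3] by auto
  qed (use v1 v3 in \<open>auto simp: U_def\<close>)
qed

lemma exists_adapted_basis:
  fixes br :: "'a::euclidean_space \<Rightarrow>\<^sub>L 'a \<Rightarrow>\<^sub>L 'a"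
  assumes dim: "DIM('a) = 3" and "lie_bracket br" and "unimodular_kernel br \<noteq> UNIV"
    and "pseudo_metric g" and "three_form H" and "nondegenerate_on (unimodular_kernel br) g"
    and einstein: "generalized_einstein br H g \<delta>"
  obtains v\<^sub>1 v\<^sub>2 v\<^sub>3 where "adapted_basis br g v\<^sub>1 v\<^sub>2 v\<^sub>3"
proof -
  obtain v\<^sub>1 v\<^sub>2 v\<^sub>3 where v: "orthonormal_basis g v\<^sub>1 v\<^sub>2 v\<^sub>3"
      "v\<^sub>1 \<in> unimodular_kernel br" "v\<^sub>3 \<in> unimodular_kernel br"
    using exists_kernel_frame[OF dim assms(3,4,6)] by blast
  interpret kernel_frame br g H v\<^sub>1 v\<^sub>2 v\<^sub>3
    by unfold_locales (use assms v in auto)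
  have opposite: "g v\<^sub>1 v\<^sub>1 = - g v\<^sub>3 v\<^sub>3"
    by (rule einstein_opposite_signs[OF einstein])
  then consider "g v\<^sub>1 v\<^sub>1 = g v\<^sub>2 v\<^sub>2" | "g v\<^sub>3 v\<^sub>3 = g v\<^sub>2 v\<^sub>2"
    using sign by (auto simp: abs_if split: if_splits)
  then show ?thesis
  proof cases
    case 1
    then show ?thesis
      using that[of v\<^sub>1 v\<^sub>2 v\<^sub>3] v opposite by (simp add: adapted_basis_def)
  next
    case 2
    \<comment> \<open>Exchange \<open>v\<^sub>1\<close> and \<open>v\<^sub>3\<close>, so that the
      first vector gets the sign of \<open>v\<^sub>2\<close>.\<close>
    have "orthonormal_basis g v\<^sub>3 v\<^sub>2 v\<^sub>1"
      using orthonormal_basisI[OF dim metric] sign by simp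
    then show ?thesis
      using that[of v\<^sub>3 v\<^sub>2 v\<^sub>1] v opposite 2 by (simp add: adapted_basis_def)
  qed
qed

section \<open>The endomorphism \<open>ad v\<^sub>2\<close> of the unimodular kernel\<close>

context kernel_frame
begin

lemma kernel_system: "orthogonal_system (\<lambda>X Y. g X Y) {v\<^sub>1, v\<^sub>3}"
proof (rule orthogonal_system.intro)
  show "linear (\<lambda>v. g v w)" for w
    by (rule base.linear_form)
qed auto

lemma ad_kernel:
  "br v\<^sub>2 (x *\<^sub>R v\<^sub>1 + y *\<^sub>R v\<^sub>3)
    = (m\<^sub>1\<^sub>1 * x + m\<^sub>1\<^sub>3 * y) *\<^sub>R v\<^sub>1 + (m\<^sub>3\<^sub>1 * x + m\<^sub>3\<^sub>3 * y) *\<^sub>R v\<^sub>3"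
  by (simp add: br_table blinfun.bilinear_simps algebra_simps)

lemma kernel_coordinates_eq_iff:
  "x *\<^sub>R v\<^sub>1 + y *\<^sub>R v\<^sub>3 = x' *\<^sub>R v\<^sub>1 + y' *\<^sub>R v\<^sub>3 \<longleftrightarrow> x = x' \<and> y = y'"
proof
  assume *: "x *\<^sub>R v\<^sub>1 + y *\<^sub>R v\<^sub>3 = x' *\<^sub>R v\<^sub>1 + y' *\<^sub>R v\<^sub>3"
  have "g (x *\<^sub>R v\<^sub>1 + y *\<^sub>R v\<^sub>3) v\<^sub>1 = g (x' *\<^sub>R v\<^sub>1 + y' *\<^sub>R v\<^sub>3) v\<^sub>1"
    "g (x *\<^sub>R v\<^sub>1 + y *\<^sub>R v\<^sub>3) v\<^sub>3 = g (x' *\<^sub>R v\<^sub>1 + y' *\<^sub>R v\<^sub>3) v\<^sub>3"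
    by (simp_all add: *)
  then show "x = x' \<and> y = y'"
    by (simp add: blinfun.bilinear_simps)
qed simp

lemma kernel_coordinates: "w \<in> unimodular_kernel br \<longleftrightarrow> (\<exists>x y. w = x *\<^sub>R v\<^sub>1 + y *\<^sub>R v\<^sub>3)"
  using kernel_expansion by (auto simp: kernel_orthogonal blinfun.bilinear_simps)

lemma trace_kernel: "trace_on (unimodular_kernel br) (br v\<^sub>2) = m\<^sub>1\<^sub>1 + m\<^sub>3\<^sub>3"
  using orthogonal_system.trace_on_span[OF kernel_system linear_blinfun, of "br v\<^sub>2"]
    br_in_unimodular_kernel distinct
  by (auto simp: kernel_span[symmetric] br_table blinfun.bilinear_simps)

lemma matrix_kernel: "matrix_wrt v\<^sub>1 v\<^sub>3 (br v\<^sub>2) = mat22 m\<^sub>1\<^sub>1 m\<^sub>1\<^sub>3 m\<^sub>3\<^sub>1 m\<^sub>3\<^sub>3"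
proof -
  have "representation {v\<^sub>1, v\<^sub>3} (br X Y) v = g (br X Y) v / g v v" if "v \<in> {v\<^sub>1, v\<^sub>3}" for X Y v
    using that br_in_unimodular_kernel
    by (intro orthogonal_system.representation_eq[OF kernel_system]) (auto simp: kernel_span[symmetric])
  then show ?thesis
    by (simp add: matrix_wrt_def m\<^sub>1\<^sub>1_def m\<^sub>1\<^sub>3_def m\<^sub>3\<^sub>1_def m\<^sub>3\<^sub>3_def)
qed

lemma eigenvalue_kernel:
  "eigenvalue_on (unimodular_kernel br) (br v\<^sub>2) z \<longleftrightarrow>
    (\<exists>x y. (x \<noteq> 0 \<or> y \<noteq> 0) \<and> m\<^sub>1\<^sub>1 * x + m\<^sub>1\<^sub>3 * y = z * x \<and> m\<^sub>3\<^sub>1 * x + m\<^sub>3\<^sub>3 * y = z * y)"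
proof -
  have *: "x *\<^sub>R v\<^sub>1 + y *\<^sub>R v\<^sub>3 = 0 \<longleftrightarrow> x = 0 \<and> y = 0" for x y
    using kernel_coordinates_eq_iff[of x y 0 0] by simp
  have "br v\<^sub>2 (x *\<^sub>R v\<^sub>1 + y *\<^sub>R v\<^sub>3) = z *\<^sub>R (x *\<^sub>R v\<^sub>1 + y *\<^sub>R v\<^sub>3) \<longleftrightarrow>
      m\<^sub>1\<^sub>1 * x + m\<^sub>1\<^sub>3 * y = z * x \<and> m\<^sub>3\<^sub>1 * x + m\<^sub>3\<^sub>3 * y = z * y" for x y
    unfolding ad_kernel scaleR_add_right scaleR_scaleR by (rule kernel_coordinates_eq_iff)
  then show ?thesis
    unfolding eigenvalue_on_def Bex_def kernel_coordinates using * by metis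
qed

text \<open>(p,q) and (r,u) are the coordinates of eigenvectors for y and z; the first hypothesis is
  their linear independence.\<close>

lemma diagonalizable_kernel:
  assumes "p * u \<noteq> q * r"
    and "m\<^sub>1\<^sub>1 * p + m\<^sub>1\<^sub>3 * q = y * p" "m\<^sub>3\<^sub>1 * p + m\<^sub>3\<^sub>3 * q = y * q"
    and "m\<^sub>1\<^sub>1 * r + m\<^sub>1\<^sub>3 * u = z * r" "m\<^sub>3\<^sub>1 * r + m\<^sub>3\<^sub>3 * u = z * u"
  shows "diagonalizable_on (unimodular_kernel br) (br v\<^sub>2)"
proof -
  define w\<^sub>1 where "w\<^sub>1 = p *\<^sub>R v\<^sub>1 + q *\<^sub>R v\<^sub>3"
  define w\<^sub>2 where "w\<^sub>2 = r *\<^sub>R v\<^sub>1 + u *\<^sub>R v\<^sub>3"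
  have "br v\<^sub>2 w\<^sub>1 = y *\<^sub>R w\<^sub>1" "br v\<^sub>2 w\<^sub>2 = z *\<^sub>R w\<^sub>2"
    unfolding w\<^sub>1_def w\<^sub>2_def ad_kernel assms by (simp_all add: scaleR_add_right)
  have combination: "x *\<^sub>R w\<^sub>1 + x' *\<^sub>R w\<^sub>2 = (x * p + x' * r) *\<^sub>R v\<^sub>1 + (x * q + x' * u) *\<^sub>R v\<^sub>3" for x x'
    by (simp add: w\<^sub>1_def w\<^sub>2_def algebra_simps)
  have "x = 0 \<and> x' = 0" if "x *\<^sub>R w\<^sub>1 + x' *\<^sub>R w\<^sub>2 = 0" for x x'
  proof -
    have "x * p + x' * r = 0" "x * q + x' * u = 0"
      using that kernel_coordinates_eq_iff[of _ _ 0 0] unfolding combination by simp_all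
    then have "x * (p * u - q * r) = 0" "x' * (p * u - q * r) = 0"
      by algebra+
    then show ?thesis
      using assms(1) by simp
  qed
  note zero = this
  have neq: "w\<^sub>1 \<noteq> w\<^sub>2"
    using zero[of 1 "-1"] by auto
  have "independent {w\<^sub>1, w\<^sub>2}"
    by (rule independent_if_scalars_zero) (use zero neq in auto)
  moreover have "span {w\<^sub>1, w\<^sub>2} = unimodular_kernel br"
  proof
    show "span {w\<^sub>1, w\<^sub>2} \<subseteq> unimodular_kernel br"
      by (intro span_minimal subspace_unimodular_kernel) (auto simp: kernel_coordinates w\<^sub>1_def w\<^sub>2_def)
    show "unimodular_kernel br \<subseteq> span {w\<^sub>1, w\<^sub>2}"
    proof
      fix w assume "w \<in> unimodular_kernel br"
      then obtain x y where w: "w = x *\<^sub>R v\<^sub>1 + y *\<^sub>R v\<^sub>3"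
        unfolding kernel_coordinates by blast
      define e where "e = p * u - q * r"
      have "e \<noteq> 0"
        using assms(1) by (simp add: e_def)
      \<comment> \<open>The coefficients come from Cramer's rule.\<close>
      have "w = ((x * u - y * r) / e) *\<^sub>R w\<^sub>1 + ((y * p - x * q) / e) *\<^sub>R w\<^sub>2"
        unfolding combination w kernel_coordinates_eq_iff using \<open>e \<noteq> 0\<close>
        by (simp add: field_simps) (simp add: e_def algebra_simps)
      then show "w \<in> span {w\<^sub>1, w\<^sub>2}"
        using span_add span_scale span_base by (metis insertI1 insertI2)
    qed
  qed
  ultimately show ?thesis
    unfolding diagonalizable_on_def
    using \<open>br v\<^sub>2 w\<^sub>1 = y *\<^sub>R w\<^sub>1\<close> \<open>br v\<^sub>2 w\<^sub>2 = z *\<^sub>R w\<^sub>2\<close> by blast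
qed

end

lemma has_double_eigenvalue_mat22:
  assumes "has_double_eigenvalue (mat22 a b c d)"
  shows "(a + d)\<^sup>2 = 4 * (a * d - b * c)"
proof -
  obtain z where z: "\<And>x. det (mat x - mat22 a b c d) = (x - z)\<^sup>2"
    using assms by (auto simp: has_double_eigenvalue_def)
  have "det (mat x - mat22 a b c d) = (x - a) * (x - d) - b * c" for x
    by (simp add: det_2 mat_def)
  then have "(x - a) * (x - d) - b * c = (x - z)\<^sup>2" for x
    using z by simp
  \<comment> \<open>At 0 the determinant is found to be z^2; at 1 the trace is then 2 z.\<close>
  from this[of 0] this[of 1] show ?thesis
    by algebra
qed

text \<open>Lorentz boosts act on trace-free self-adjoint endomorphisms of the plane with the double
  parameter; \<open>C + S\<close> is a fourth root.\<close>

lemma exists_boost: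
  fixes a b d :: real
  assumes ab: "a\<^sup>2 + d\<^sup>2 = 2 * b\<^sup>2" and t: "a + d \<noteq> 0"
  obtains C S where "C\<^sup>2 - S\<^sup>2 = 1" "a * C\<^sup>2 + 2 * b * C * S - d * S\<^sup>2 = (a + d) / 2"
    "- a * S\<^sup>2 - 2 * b * C * S + d * C\<^sup>2 = (a + d) / 2"
    "(b * (C\<^sup>2 + S\<^sup>2) + (a - d) * C * S)\<^sup>2 = ((a + d) / 2)\<^sup>2"
proof -
  \<comment> \<open>This form of the hypothesis shows that the quotient under the root is
    positive.\<close>
  have "(2 * b + (a - d)) * (2 * b - (a - d)) = (a + d)\<^sup>2"
    using ab by algebra
  then have prod: "(2 * b + (a - d)) * (2 * b - (a - d)) > 0"
    using t by simp
  define r where "r = sqrt (sqrt ((2 * b - (a - d)) / (2 * b + (a - d))))"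
  have pos: "(2 * b - (a - d)) / (2 * b + (a - d)) > 0"
    using prod by (auto simp: zero_less_mult_iff zero_less_divide_iff)
  then have r: "r > 0" "(r\<^sup>2)\<^sup>2 = (2 * b - (a - d)) / (2 * b + (a - d))"
    by (simp_all add: r_def)
  moreover have "2 * b + (a - d) \<noteq> 0"
    using prod by auto
  ultimately have r4: "(2 * b + (a - d)) * (r\<^sup>2)\<^sup>2 = 2 * b - (a - d)"
    by simp
  define q where "q = 1 / r"
  have q: "r * q = 1"
    using r(1) by (simp add: q_def)
  define C where "C = (r + q) / 2"
  define S where "S = (r - q) / 2"
  have 1: "C\<^sup>2 - S\<^sup>2 = 1"
    unfolding C_def S_def using q by (simp add: power2_eq_square field_simps)
  \<comment> \<open>C and S are the hyperbolic cosine and sine of log r. The left side is the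
    difference of the diagonal entries after the boost, and \<open>r\<close> is chosen to make it
    zero.\<close>
  have "(a - d) * (C\<^sup>2 + S\<^sup>2) + 4 * b * C * S = ((2 * b + (a - d)) * r\<^sup>2 - (2 * b - (a - d)) * q\<^sup>2) / 2"
    unfolding C_def S_def by (simp add: power2_eq_square field_simps)
  also have "(2 * b + (a - d)) * r\<^sup>2 = (2 * b - (a - d)) * q\<^sup>2"
    using r4 q by algebra
  finally have diag: "(a - d) * (C\<^sup>2 + S\<^sup>2) + 4 * b * C * S = 0"
    by simp
  have "2 * (a * C\<^sup>2 + 2 * b * C * S - d * S\<^sup>2) = a + d"
    "2 * (- a * S\<^sup>2 - 2 * b * C * S + d * C\<^sup>2) = a + d"
    using 1 diag by algebra+
  \<comment> \<open>Reason: the boost preserves the determinant a d + b^2 = (a + d)^2 / 2. With both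
    diagonal entries equal to (a + d)/2, the square of the off-diagonal entry must be the same as
    theirs.\<close>
  moreover have "4 * (b * (C\<^sup>2 + S\<^sup>2) + (a - d) * C * S)\<^sup>2 = (a + d)\<^sup>2"
    using 1 diag ab by algebra
  ultimately show ?thesis
    using that[of C S] 1 by (simp add: power_divide)
qed

section \<open>The solutions\<close>

text \<open>In the symmetric case (1,1) and (1,-1) are eigenvectors for a + b and a - b. In the
  singular case the eigenvalues are the trace and 0, with eigenvectors (1,\<open>- \<sigma>\<close>)
  and (d,\<open>\<sigma> * a\<close>).\<close>

lemma solution_eigenvectors:
  fixes a b c d :: real
  assumes t: "a + d \<noteq> 0" and sol: "a = d \<and> b = c \<or> (\<exists>\<sigma>\<in>{1, -1}. b = - \<sigma> * d \<and> c = - \<sigma> * a)"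
  obtains p q r u y z where "p * u \<noteq> q * r"
    "a * p + b * q = y * p" "c * p + d * q = y * q" "a * r + b * u = z * r" "c * r + d * u = z * u"
    "y = z \<longrightarrow> a = d \<and> b = 0 \<and> c = 0"
  using sol
proof
  assume "a = d \<and> b = c"
  then show ?thesis
    by (intro that[of 1 "-1" 1 1 "a + b" "a - b"]) auto
next
  assume "\<exists>\<sigma>\<in>{1, -1}. b = - \<sigma> * d \<and> c = - \<sigma> * a"
  then obtain \<sigma> where "\<sigma> \<in> {1, -1}" "b = - \<sigma> * d" "c = - \<sigma> * a"
    by blast
  then show ?thesis
    using t by (intro that[of 1 "\<sigma> * a" "- \<sigma>" d "a + d" 0]) (auto simp: algebra_simps)
qed

context adapted_frame
begin

lemma epsilon: "g v\<^sub>1 v\<^sub>1 \<in> {1, -1}"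
  using sign(1) by auto

lemma einstein_iff:
  "generalized_einstein br H g \<delta> \<longleftrightarrow>
    einstein_half (g v\<^sub>1 v\<^sub>1) m\<^sub>1\<^sub>1 m\<^sub>1\<^sub>3 m\<^sub>3\<^sub>1 m\<^sub>3\<^sub>3 (H v\<^sub>1 v\<^sub>2 v\<^sub>3)
      (delta_plus g \<delta> v\<^sub>1) (delta_plus g \<delta> v\<^sub>2) (delta_plus g \<delta> v\<^sub>3) \<and>
    einstein_half (g v\<^sub>1 v\<^sub>1) m\<^sub>1\<^sub>1 m\<^sub>1\<^sub>3 m\<^sub>3\<^sub>1 m\<^sub>3\<^sub>3 (- H v\<^sub>1 v\<^sub>2 v\<^sub>3)
      (delta_minus g \<delta> v\<^sub>1) (delta_minus g \<delta> v\<^sub>2) (delta_minus g \<delta> v\<^sub>3)"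
  using generalized_einstein_iff[of \<delta>] card_frame ricci_half_iff[of 1 \<delta>] ricci_half_iff[of "-1" \<delta>]
  by (simp add: delta_plus_def delta_minus_def lift_def)

text \<open>The kernel determines \<open>v\<^sub>2\<close> up to sign, so a change of adapted basis
  moves \<open>v\<^sub>1\<close> and \<open>v\<^sub>3\<close> inside the kernel and may flip
  \<open>v\<^sub>2\<close>. The flip negates M, which makes \<open>\<theta>\<close> positive in (a)
  and (b1).\<close>

lemma adapted_basisI:
  assumes "DIM('a) = 3" "w\<^sub>2 \<in> {v\<^sub>2, - v\<^sub>2}" "w\<^sub>1 \<in> unimodular_kernel br" "w\<^sub>3 \<in> unimodular_kernel br"
    and "g w\<^sub>1 w\<^sub>1 = g v\<^sub>1 v\<^sub>1" "g w\<^sub>1 w\<^sub>3 = 0" "g w\<^sub>3 w\<^sub>3 = g v\<^sub>3 v\<^sub>3"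
  shows "adapted_basis br g w\<^sub>1 w\<^sub>2 w\<^sub>3"
proof -
  have w2: "g w\<^sub>2 w\<^sub>2 = g v\<^sub>2 v\<^sub>2" "g w\<^sub>1 w\<^sub>2 = 0" "g w\<^sub>3 w\<^sub>2 = 0"
    using assms(2-4) by (auto simp: kernel_orthogonal blinfun.bilinear_simps)
  have "orthonormal_basis g w\<^sub>1 w\<^sub>2 w\<^sub>3"
    using orthonormal_basisI[OF assms(1) metric] assms w2 sign g_commute[of w\<^sub>2 w\<^sub>3] by simp
  then show ?thesis
    using assms w2 signs by (simp add: adapted_basis_def)
qed

lemma delta_zero:
  assumes "\<And>v. v \<in> {v\<^sub>1, v\<^sub>2, v\<^sub>3} \<Longrightarrow> delta_plus g \<delta> v = 0 \<and> delta_minus g \<delta> v = 0"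
  shows "\<delta> = 0"
proof (rule blinfun_eqI)
  fix u
  have "\<delta> u = (\<lambda>_. 0) u"
    by (rule linear_eq_on_spanning[OF linear_blinfun linear_zero span_E_basis])
      (use assms in \<open>auto simp: E_basis_def lift_def delta_plus_def delta_minus_def\<close>)
  then show "\<delta> u = (0 :: 'a gen \<Rightarrow>\<^sub>L real) u"
    by simp
qed

section \<open>Consequences of the Einstein equation in an adapted basis\<close>

context
  fixes \<delta> :: "'a gen \<Rightarrow>\<^sub>L real"
  assumes dim: "DIM('a) = 3" and einstein: "generalized_einstein br H g \<delta>"
begin

lemma einstein_delta2: "delta_plus g \<delta> v\<^sub>2 = delta_minus g \<delta> v\<^sub>2"
proof -
  have "(m\<^sub>1\<^sub>1 + m\<^sub>3\<^sub>3) * delta_plus g \<delta> v\<^sub>2 = (m\<^sub>1\<^sub>1 + m\<^sub>3\<^sub>3) * delta_minus g \<delta> v\<^sub>2"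
    using einstein einstein_half_trace unfolding einstein_iff by (metis power2_minus)
  then show ?thesis
    using trace_ad_v2 by simp
qed

lemma einstein_delta2_zero:
  assumes zero: "delta_plus g \<delta> v\<^sub>2 = 0"
  shows "\<delta> = 0" "H v\<^sub>1 v\<^sub>2 v\<^sub>3 = 0"
    and "\<exists>w\<^sub>1 w\<^sub>2 w\<^sub>3 \<theta>. adapted_basis br g w\<^sub>1 w\<^sub>2 w\<^sub>3 \<and> w\<^sub>2 \<in> {v\<^sub>2, - v\<^sub>2} \<and> \<theta> > 0 \<and>
      br w\<^sub>2 w\<^sub>1 = \<theta> *\<^sub>R w\<^sub>1 - \<theta> *\<^sub>R w\<^sub>3 \<and> br w\<^sub>2 w\<^sub>3 = \<theta> *\<^sub>R w\<^sub>1 + \<theta> *\<^sub>R w\<^sub>3"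
proof -
  have plus: "einstein_half (g v\<^sub>1 v\<^sub>1) m\<^sub>1\<^sub>1 m\<^sub>1\<^sub>3 m\<^sub>3\<^sub>1 m\<^sub>3\<^sub>3 (H v\<^sub>1 v\<^sub>2 v\<^sub>3) (delta_plus g \<delta> v\<^sub>1) 0 (delta_plus g \<delta> v\<^sub>3)"
    and minus: "einstein_half (g v\<^sub>1 v\<^sub>1) m\<^sub>1\<^sub>1 m\<^sub>1\<^sub>3 m\<^sub>3\<^sub>1 m\<^sub>3\<^sub>3 (- H v\<^sub>1 v\<^sub>2 v\<^sub>3)
      (delta_minus g \<delta> v\<^sub>1) 0 (delta_minus g \<delta> v\<^sub>3)"
    using einstein zero einstein_delta2 by (simp_all add: einstein_iff)
  note sol = einstein_half_zero[OF plus trace_ad_v2]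
  show "H v\<^sub>1 v\<^sub>2 v\<^sub>3 = 0"
    by (rule sol(1))
  show "\<delta> = 0"
    using sol(4,5) einstein_half_zero(4,5)[OF minus trace_ad_v2] zero einstein_delta2
    by (intro delta_zero) auto
  define a b d where abd: "a = m\<^sub>1\<^sub>1" "b = m\<^sub>1\<^sub>3" "d = m\<^sub>3\<^sub>3"
  have c: "m\<^sub>3\<^sub>1 = - b"
    using sol(2) by (simp add: abd)
  obtain C S where CS: "C\<^sup>2 - S\<^sup>2 = 1" "a * C\<^sup>2 + 2 * b * C * S - d * S\<^sup>2 = (a + d) / 2"
    "- a * S\<^sup>2 - 2 * b * C * S + d * C\<^sup>2 = (a + d) / 2"
    "(b * (C\<^sup>2 + S\<^sup>2) + (a - d) * C * S)\<^sup>2 = ((a + d) / 2)\<^sup>2"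
    using exists_boost[of a d b] sol(3) trace_ad_v2 unfolding abd by blast
  define t where "t = (a + d) / 2"
  define \<beta> where "\<beta> = b * (C\<^sup>2 + S\<^sup>2) + (a - d) * C * S"
  have "t \<noteq> 0" "\<beta>\<^sup>2 = t\<^sup>2"
    using trace_ad_v2 CS(4) by (simp_all add: t_def \<beta>_def abd)
  define u\<^sub>1 where "u\<^sub>1 = C *\<^sub>R v\<^sub>1 + S *\<^sub>R v\<^sub>3"
  define u\<^sub>3 where "u\<^sub>3 = S *\<^sub>R v\<^sub>1 + C *\<^sub>R v\<^sub>3"
  have combination: "x *\<^sub>R u\<^sub>1 + y *\<^sub>R u\<^sub>3 = (x * C + y * S) *\<^sub>R v\<^sub>1 + (x * S + y * C) *\<^sub>R v\<^sub>3" for x y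
    by (simp add: u\<^sub>1_def u\<^sub>3_def algebra_simps)
  have "br v\<^sub>2 u\<^sub>1 = t *\<^sub>R u\<^sub>1 + (- \<beta>) *\<^sub>R u\<^sub>3"
    unfolding combination kernel_coordinates_eq_iff unfolding u\<^sub>1_def ad_kernel kernel_coordinates_eq_iff
      c abd(1,3)[symmetric] abd(2)[symmetric] t_def \<beta>_def
    using CS(1,2) by algebra
  moreover have "br v\<^sub>2 u\<^sub>3 = \<beta> *\<^sub>R u\<^sub>1 + t *\<^sub>R u\<^sub>3"
    unfolding combination kernel_coordinates_eq_iff unfolding u\<^sub>3_def ad_kernel kernel_coordinates_eq_iff
      c abd(1,3)[symmetric] abd(2)[symmetric] t_def \<beta>_def
    using CS(1,3) by algebra
  moreover have gu: "g u\<^sub>1 u\<^sub>1 = g v\<^sub>1 v\<^sub>1" "g u\<^sub>1 u\<^sub>3 = 0" "g u\<^sub>3 u\<^sub>3 = g v\<^sub>3 v\<^sub>3"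
  proof -
    have "g u\<^sub>1 u\<^sub>1 = (C\<^sup>2 - S\<^sup>2) * g v\<^sub>1 v\<^sub>1" "g u\<^sub>3 u\<^sub>3 = (C\<^sup>2 - S\<^sup>2) * g v\<^sub>3 v\<^sub>3" "g u\<^sub>1 u\<^sub>3 = 0"
      by (simp_all add: u\<^sub>1_def u\<^sub>3_def blinfun.bilinear_simps signs power2_eq_square algebra_simps)
    then show "g u\<^sub>1 u\<^sub>1 = g v\<^sub>1 v\<^sub>1" "g u\<^sub>1 u\<^sub>3 = 0" "g u\<^sub>3 u\<^sub>3 = g v\<^sub>3 v\<^sub>3"
      using CS(1) by simp_all
  qed
  moreover have u: "u\<^sub>1 \<in> unimodular_kernel br" "u\<^sub>3 \<in> unimodular_kernel br"
    by (auto simp: kernel_coordinates u\<^sub>1_def u\<^sub>3_def)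
  \<comment> \<open>In the boosted basis M has diagonal entries t and off-diagonal entries
    \<open>\<beta>\<close> and \<open>- \<beta>\<close> of the same absolute value. Flipping
    \<open>v\<^sub>2\<close> by \<open>\<tau>\<close> makes t positive, then flipping
    \<open>u\<^sub>3\<close> by \<open>\<sigma>\<close> adjusts the sign of
    \<open>\<beta>\<close>.\<close>
  define \<tau> where "\<tau> = sgn t"
  define \<sigma> where "\<sigma> = \<tau> * sgn \<beta>"
  define w\<^sub>2 where "w\<^sub>2 = \<tau> *\<^sub>R v\<^sub>2"
  define w\<^sub>3 where "w\<^sub>3 = \<sigma> *\<^sub>R u\<^sub>3"
  define \<theta> where "\<theta> = \<bar>t\<bar>"
  have "\<bar>\<beta>\<bar> = \<bar>t\<bar>"
    using \<open>\<beta>\<^sup>2 = t\<^sup>2\<close> by (auto simp: power2_eq_iff)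
  then have signs': "\<tau> * t = \<theta>" "\<tau> * \<beta> = \<sigma> * \<theta>" "\<sigma> * \<sigma> = 1" "\<tau> = 1 \<or> \<tau> = -1" "\<theta> > 0"
    using \<open>t \<noteq> 0\<close> by (auto simp: \<tau>_def \<sigma>_def \<theta>_def sgn_real_def)
  have "adapted_basis br g u\<^sub>1 w\<^sub>2 w\<^sub>3"
  proof (rule adapted_basisI[OF dim])
    show "w\<^sub>3 \<in> unimodular_kernel br"
      unfolding w\<^sub>3_def using u by (intro subspace_scale subspace_unimodular_kernel)
    show "g w\<^sub>3 w\<^sub>3 = g v\<^sub>3 v\<^sub>3"
      using signs'(3) gu(3) by (simp add: w\<^sub>3_def blinfun.bilinear_simps)
  qed (use signs' gu u in \<open>auto simp: w\<^sub>2_def w\<^sub>3_def blinfun.bilinear_simps\<close>)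
  moreover have "w\<^sub>2 \<in> {v\<^sub>2, - v\<^sub>2}"
    using signs'(4) by (auto simp: w\<^sub>2_def)
  moreover have "br w\<^sub>2 u\<^sub>1 = \<theta> *\<^sub>R u\<^sub>1 - \<theta> *\<^sub>R w\<^sub>3"
  proof -
    have "br w\<^sub>2 u\<^sub>1 = (\<tau> * t) *\<^sub>R u\<^sub>1 - (\<tau> * \<beta>) *\<^sub>R u\<^sub>3"
      by (simp add: w\<^sub>2_def blinfun.bilinear_simps \<open>br v\<^sub>2 u\<^sub>1 = _\<close> algebra_simps)
    then show ?thesis
      unfolding signs'(1,2) w\<^sub>3_def by (simp add: mult.commute)
  qed
  moreover have "br w\<^sub>2 w\<^sub>3 = \<theta> *\<^sub>R u\<^sub>1 + \<theta> *\<^sub>R w\<^sub>3"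
  proof -
    have "br w\<^sub>2 w\<^sub>3 = (\<sigma> * (\<tau> * \<beta>)) *\<^sub>R u\<^sub>1 + (\<sigma> * (\<tau> * t)) *\<^sub>R u\<^sub>3"
      by (simp add: w\<^sub>2_def w\<^sub>3_def blinfun.bilinear_simps \<open>br v\<^sub>2 u\<^sub>3 = _\<close> algebra_simps)
    also have "\<sigma> * (\<tau> * \<beta>) = (\<sigma> * \<sigma>) * \<theta>"
      by (simp add: signs'(2))
    finally show ?thesis
      by (simp add: signs'(1,3) w\<^sub>3_def mult.commute)
  qed
  ultimately show "\<exists>w\<^sub>1 w\<^sub>2 w\<^sub>3 \<theta>. adapted_basis br g w\<^sub>1 w\<^sub>2 w\<^sub>3 \<and> w\<^sub>2 \<in> {v\<^sub>2, - v\<^sub>2} \<and> \<theta> > 0 \<and>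
      br w\<^sub>2 w\<^sub>1 = \<theta> *\<^sub>R w\<^sub>1 - \<theta> *\<^sub>R w\<^sub>3 \<and> br w\<^sub>2 w\<^sub>3 = \<theta> *\<^sub>R w\<^sub>1 + \<theta> *\<^sub>R w\<^sub>3"
    using signs'(5) by blast
qed

context
  assumes nonzero: "delta_plus g \<delta> v\<^sub>2 \<noteq> 0"
begin

lemma einstein_plus:
  "einstein_half (g v\<^sub>1 v\<^sub>1) m\<^sub>1\<^sub>1 m\<^sub>1\<^sub>3 m\<^sub>3\<^sub>1 m\<^sub>3\<^sub>3 (H v\<^sub>1 v\<^sub>2 v\<^sub>3)
    (delta_plus g \<delta> v\<^sub>1) (delta_plus g \<delta> v\<^sub>2) (delta_plus g \<delta> v\<^sub>3)"
  using einstein by (simp add: einstein_iff)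

lemmas solution = einstein_half_nonzero[OF einstein_plus trace_ad_v2 nonzero]

lemma einstein_diagonalizable: "diagonalizable_on (unimodular_kernel br) (br v\<^sub>2)"
  using solution_eigenvectors[OF trace_ad_v2 solution(3)] diagonalizable_kernel by metis

text \<open>M is diagonalizable here, so it lacks two distinct eigenvalues only if it is
  scalar.\<close>

lemma einstein_distinct_eigenvalues:
  "(\<exists>x y. x \<noteq> y \<and> eigenvalue_on (unimodular_kernel br) (br v\<^sub>2) x \<and>
      eigenvalue_on (unimodular_kernel br) (br v\<^sub>2) y)
    \<longleftrightarrow> \<not> (m\<^sub>1\<^sub>1 = m\<^sub>3\<^sub>3 \<and> m\<^sub>1\<^sub>3 = 0 \<and> m\<^sub>3\<^sub>1 = 0)" (is "?L \<longleftrightarrow> ?R")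
proof
  assume ?L
  then show ?R
    unfolding eigenvalue_kernel by auto
next
  assume ?R
  obtain p u q r y z where "p * u \<noteq> q * r"
    and eig: "m\<^sub>1\<^sub>1 * p + m\<^sub>1\<^sub>3 * q = y * p" "m\<^sub>3\<^sub>1 * p + m\<^sub>3\<^sub>3 * q = y * q"
      "m\<^sub>1\<^sub>1 * r + m\<^sub>1\<^sub>3 * u = z * r" "m\<^sub>3\<^sub>1 * r + m\<^sub>3\<^sub>3 * u = z * u"
    and neq: "y = z \<longrightarrow> m\<^sub>1\<^sub>1 = m\<^sub>3\<^sub>3 \<and> m\<^sub>1\<^sub>3 = 0 \<and> m\<^sub>3\<^sub>1 = 0"
    by (rule solution_eigenvectors[OF trace_ad_v2 solution(3)])
  have "p \<noteq> 0 \<or> q \<noteq> 0" "r \<noteq> 0 \<or> u \<noteq> 0"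
    using \<open>p * u \<noteq> q * r\<close> by auto
  then show ?L
    unfolding eigenvalue_kernel using eig neq \<open>?R\<close> by blast
qed

lemma einstein_double_eigenvalue:
  assumes "has_double_eigenvalue (matrix_wrt v\<^sub>1 v\<^sub>3 (br v\<^sub>2))"
  shows "\<exists>w\<^sub>1 w\<^sub>2 w\<^sub>3 \<theta>. adapted_basis br g w\<^sub>1 w\<^sub>2 w\<^sub>3 \<and> w\<^sub>2 \<in> {v\<^sub>2, - v\<^sub>2} \<and> \<theta> > 0 \<and>
    br w\<^sub>2 w\<^sub>1 = \<theta> *\<^sub>R w\<^sub>1 \<and> br w\<^sub>2 w\<^sub>3 = \<theta> *\<^sub>R w\<^sub>3 \<and>
    (H w\<^sub>1 w\<^sub>2 w\<^sub>3)^2 = (2 * \<theta>)^2 \<and>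
    delta_plus g \<delta> w\<^sub>2 = - 2 * \<theta> \<and> delta_minus g \<delta> w\<^sub>2 = - 2 * \<theta> \<and>
    delta_plus g \<delta> w\<^sub>1 = 0 \<and> delta_plus g \<delta> w\<^sub>3 = 0 \<and>
    delta_minus g \<delta> w\<^sub>1 = 0 \<and> delta_minus g \<delta> w\<^sub>3 = 0"
proof -
  have disc: "(m\<^sub>1\<^sub>1 + m\<^sub>3\<^sub>3)\<^sup>2 = 4 * (m\<^sub>1\<^sub>1 * m\<^sub>3\<^sub>3 - m\<^sub>1\<^sub>3 * m\<^sub>3\<^sub>1)"
    using has_double_eigenvalue_mat22 assms unfolding matrix_kernel by blast
  \<comment> \<open>The discriminant of the characteristic polynomial is 4 b^2 in the symmetric case
    and the squared trace, which is nonzero, in the singular case.\<close>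
  have scalar: "m\<^sub>1\<^sub>1 = m\<^sub>3\<^sub>3" "m\<^sub>1\<^sub>3 = 0" "m\<^sub>3\<^sub>1 = 0"
    using solution(3) disc trace_ad_v2 by (auto simp: power2_eq_square)
  define a where "a = m\<^sub>1\<^sub>1"
  have a: "a \<noteq> 0" and br: "br v\<^sub>2 v\<^sub>1 = a *\<^sub>R v\<^sub>1" "br v\<^sub>2 v\<^sub>3 = a *\<^sub>R v\<^sub>3"
    using trace_ad_v2 scalar by (simp_all add: a_def br_table)
  have x: "delta_plus g \<delta> v\<^sub>2 = - 2 * a" "delta_minus g \<delta> v\<^sub>2 = - 2 * a" "(H v\<^sub>1 v\<^sub>2 v\<^sub>3)\<^sup>2 = (2 * a)\<^sup>2"
    using solution(1,2) scalar einstein_delta2 by (simp_all add: a_def)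
  have "H v\<^sub>1 v\<^sub>2 v\<^sub>3 \<noteq> 0"
    using x(3) a by auto
  then have zero: "delta_plus g \<delta> v\<^sub>1 = 0" "delta_plus g \<delta> v\<^sub>3 = 0" "delta_minus g \<delta> v\<^sub>1 = 0" "delta_minus g \<delta> v\<^sub>3 = 0"
    using einstein scalar by (simp_all add: einstein_iff einstein_half_def)
  define \<tau> where "\<tau> = sgn a"
  define w\<^sub>2 where "w\<^sub>2 = \<tau> *\<^sub>R v\<^sub>2"
  have \<tau>: "\<tau> = 1 \<or> \<tau> = -1" "\<tau> * a = \<bar>a\<bar>"
    using a by (auto simp: \<tau>_def sgn_real_def)
  have w2: "w\<^sub>2 \<in> {v\<^sub>2, - v\<^sub>2}"
    using \<tau>(1) by (auto simp: w\<^sub>2_def)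
  have "delta_plus g \<delta> w\<^sub>2 = \<tau> * delta_plus g \<delta> v\<^sub>2" "delta_minus g \<delta> w\<^sub>2 = \<tau> * delta_minus g \<delta> v\<^sub>2"
    using \<tau>(1) blinfun.minus_right[of \<delta> "(v\<^sub>2, g v\<^sub>2)"] blinfun.minus_right[of \<delta> "(v\<^sub>2, - g v\<^sub>2)"]
    by (auto simp: w\<^sub>2_def delta_plus_def delta_minus_def blinfun.minus_right)
  then have "delta_plus g \<delta> w\<^sub>2 = - 2 * \<bar>a\<bar>" "delta_minus g \<delta> w\<^sub>2 = - 2 * \<bar>a\<bar>"
    using x(1,2) \<tau>(2) by simp_all
  moreover have "br w\<^sub>2 v\<^sub>1 = \<bar>a\<bar> *\<^sub>R v\<^sub>1" "br w\<^sub>2 v\<^sub>3 = \<bar>a\<bar> *\<^sub>R v\<^sub>3"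
    using br by (simp_all add: w\<^sub>2_def blinfun.bilinear_simps \<tau>(2))
  moreover have "(H v\<^sub>1 w\<^sub>2 v\<^sub>3)\<^sup>2 = (2 * \<bar>a\<bar>)\<^sup>2"
    using x(3) \<tau>(1) by (auto simp: w\<^sub>2_def blinfun.bilinear_simps)
  moreover have "adapted_basis br g v\<^sub>1 w\<^sub>2 v\<^sub>3"
    by (rule adapted_basisI[OF dim w2]) (use kernel in auto)
  moreover have "\<bar>a\<bar> > 0"
    using a by simp
  ultimately show ?thesis
    using w2 zero by blast
qed

end

end

lemma distinct_eigenvalue_einstein_iff:
  assumes "DIM('a) = 3"
  shows "(generalized_einstein br H g \<delta> \<and>
      delta_plus g \<delta> v\<^sub>2 = delta_minus g \<delta> v\<^sub>2 \<and> delta_plus g \<delta> v\<^sub>2 \<noteq> 0 \<and>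
      (\<exists>x y. x \<noteq> y \<and> eigenvalue_on (unimodular_kernel br) (br v\<^sub>2) x \<and>
         eigenvalue_on (unimodular_kernel br) (br v\<^sub>2) y)) \<longleftrightarrow>
    distinct_eigenvalue_families (g v\<^sub>1 v\<^sub>1) (g v\<^sub>2 v\<^sub>2) (g v\<^sub>3 v\<^sub>3) (H v\<^sub>1 v\<^sub>2 v\<^sub>3)
      (delta_plus g \<delta> v\<^sub>1) (delta_plus g \<delta> v\<^sub>2) (delta_plus g \<delta> v\<^sub>3)
      (delta_minus g \<delta> v\<^sub>1) (delta_minus g \<delta> v\<^sub>2) (delta_minus g \<delta> v\<^sub>3)
      (matrix_wrt v\<^sub>1 v\<^sub>3 (br v\<^sub>2))"
  unfolding signs matrix_kernel families_iff_einstein_half[OF epsilon trace_ad_v2]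
  using einstein_distinct_eigenvalues[of \<delta>, OF assms] einstein_iff[of \<delta>] by blast

end

theorem proposition3p15:
  fixes br :: "'a::euclidean_space \<Rightarrow>\<^sub>L 'a \<Rightarrow>\<^sub>L 'a"
    and g :: "'a \<Rightarrow>\<^sub>L 'a \<Rightarrow>\<^sub>L real"
    and H :: "'a \<Rightarrow>\<^sub>L 'a \<Rightarrow>\<^sub>L 'a \<Rightarrow>\<^sub>L real"
    and \<delta> :: "'a gen \<Rightarrow>\<^sub>L real"
  assumes "DIM('a) = 3"
    and "lie_bracket br"
    and "unimodular_kernel br \<noteq> UNIV"
    and "pseudo_metric g"
    and "three_form H"
    and "nondegenerate_on (unimodular_kernel br) g"
  shows
   "(generalized_einstein br H g \<delta> \<longrightarrow> (\<exists>v\<^sub>1 v\<^sub>2 v\<^sub>3. adapted_basis br g v\<^sub>1 v\<^sub>2 v\<^sub>3)) \<and>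
    (\<forall>v\<^sub>1 v\<^sub>2 v\<^sub>3. generalized_einstein br H g \<delta> \<and> adapted_basis br g v\<^sub>1 v\<^sub>2 v\<^sub>3 \<longrightarrow>
       delta_plus g \<delta> v\<^sub>2 = delta_minus g \<delta> v\<^sub>2 \<and>
       \<comment> \<open>(a)\<close>
       (delta_plus g \<delta> v\<^sub>2 = 0 \<longrightarrow>
          \<delta> = 0 \<and> H v\<^sub>1 v\<^sub>2 v\<^sub>3 = 0 \<and>
          (\<exists>w\<^sub>1 w\<^sub>2 w\<^sub>3 \<theta>. adapted_basis br g w\<^sub>1 w\<^sub>2 w\<^sub>3 \<and> w\<^sub>2 \<in> {v\<^sub>2, - v\<^sub>2} \<and> \<theta> > 0 \<and>
             br w\<^sub>2 w\<^sub>1 = \<theta> *\<^sub>R w\<^sub>1 - \<theta> *\<^sub>R w\<^sub>3 \<and> br w\<^sub>2 w\<^sub>3 = \<theta> *\<^sub>R w\<^sub>1 + \<theta> *\<^sub>R w\<^sub>3)) \<and>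
       \<comment> \<open>(b)\<close>
       (delta_plus g \<delta> v\<^sub>2 \<noteq> 0 \<longrightarrow>
          diagonalizable_on (unimodular_kernel br) (br v\<^sub>2) \<and>
          (H v\<^sub>1 v\<^sub>2 v\<^sub>3)^2 = (trace_on (unimodular_kernel br) (br v\<^sub>2))^2 \<and>
          trace_on (unimodular_kernel br) (br v\<^sub>2) \<noteq> 0 \<and>
          delta_plus g \<delta> v\<^sub>2 = - trace_on (unimodular_kernel br) (br v\<^sub>2) \<and>
          \<comment> \<open>(b1)\<close>
          (has_double_eigenvalue (matrix_wrt v\<^sub>1 v\<^sub>3 (br v\<^sub>2)) \<longrightarrow>
             (\<exists>w\<^sub>1 w\<^sub>2 w\<^sub>3 \<theta>. adapted_basis br g w\<^sub>1 w\<^sub>2 w\<^sub>3 \<and> w\<^sub>2 \<in> {v\<^sub>2, - v\<^sub>2} \<and> \<theta> > 0 \<and>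
                br w\<^sub>2 w\<^sub>1 = \<theta> *\<^sub>R w\<^sub>1 \<and> br w\<^sub>2 w\<^sub>3 = \<theta> *\<^sub>R w\<^sub>3 \<and>
                (H w\<^sub>1 w\<^sub>2 w\<^sub>3)^2 = (2 * \<theta>)^2 \<and>
                delta_plus g \<delta> w\<^sub>2 = - 2 * \<theta> \<and> delta_minus g \<delta> w\<^sub>2 = - 2 * \<theta> \<and>
                delta_plus g \<delta> w\<^sub>1 = 0 \<and> delta_plus g \<delta> w\<^sub>3 = 0 \<and>
                delta_minus g \<delta> w\<^sub>1 = 0 \<and> delta_minus g \<delta> w\<^sub>3 = 0)))) \<and>
    \<comment> \<open>(b2)\<close>
    (\<forall>v\<^sub>1 v\<^sub>2 v\<^sub>3. adapted_basis br g v\<^sub>1 v\<^sub>2 v\<^sub>3 \<longrightarrow>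
       ((generalized_einstein br H g \<delta> \<and>
        delta_plus g \<delta> v\<^sub>2 = delta_minus g \<delta> v\<^sub>2 \<and> delta_plus g \<delta> v\<^sub>2 \<noteq> 0 \<and>
        (\<exists>x y. x \<noteq> y \<and> eigenvalue_on (unimodular_kernel br) (br v\<^sub>2) x \<and>
           eigenvalue_on (unimodular_kernel br) (br v\<^sub>2) y)) \<longleftrightarrow>
       distinct_eigenvalue_families (g v\<^sub>1 v\<^sub>1) (g v\<^sub>2 v\<^sub>2) (g v\<^sub>3 v\<^sub>3) (H v\<^sub>1 v\<^sub>2 v\<^sub>3)
         (delta_plus g \<delta> v\<^sub>1) (delta_plus g \<delta> v\<^sub>2) (delta_plus g \<delta> v\<^sub>3)
         (delta_minus g \<delta> v\<^sub>1) (delta_minus g \<delta> v\<^sub>2) (delta_minus g \<delta> v\<^sub>3)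
         (matrix_wrt v\<^sub>1 v\<^sub>3 (br v\<^sub>2))))"
proof -
  have adapted_frame: "adapted_frame br g H v\<^sub>1 v\<^sub>2 v\<^sub>3" if "adapted_basis br g v\<^sub>1 v\<^sub>2 v\<^sub>3" for v\<^sub>1 v\<^sub>2 v\<^sub>3
    by unfold_locales (use assms that in \<open>auto simp: adapted_basis_def\<close>)
  show ?thesis
  proof (intro conjI allI impI; (elim conjE)?)
    assume "generalized_einstein br H g \<delta>"
    then show "\<exists>v\<^sub>1 v\<^sub>2 v\<^sub>3. adapted_basis br g v\<^sub>1 v\<^sub>2 v\<^sub>3"
      using exists_adapted_basis[OF assms] by metis
  next
    fix v\<^sub>1 v\<^sub>2 v\<^sub>3
    assume einstein: "generalized_einstein br H g \<delta>" and "adapted_basis br g v\<^sub>1 v\<^sub>2 v\<^sub>3"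
    then interpret adapted_frame br g H v\<^sub>1 v\<^sub>2 v\<^sub>3
      by (intro adapted_frame)
    note facts = assms(1) einstein
    show "delta_plus g \<delta> v\<^sub>2 = delta_minus g \<delta> v\<^sub>2"
      by (rule einstein_delta2[OF facts])
    {
      assume "delta_plus g \<delta> v\<^sub>2 = 0"
      note facts = facts this
      show "\<delta> = 0" "H v\<^sub>1 v\<^sub>2 v\<^sub>3 = 0"
        "\<exists>w\<^sub>1 w\<^sub>2 w\<^sub>3 \<theta>. adapted_basis br g w\<^sub>1 w\<^sub>2 w\<^sub>3 \<and> w\<^sub>2 \<in> {v\<^sub>2, - v\<^sub>2} \<and> \<theta> > 0 \<and>
          br w\<^sub>2 w\<^sub>1 = \<theta> *\<^sub>R w\<^sub>1 - \<theta> *\<^sub>R w\<^sub>3 \<and> br w\<^sub>2 w\<^sub>3 = \<theta> *\<^sub>R w\<^sub>1 + \<theta> *\<^sub>R w\<^sub>3"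
        by (rule einstein_delta2_zero[OF facts])+
    }
    assume nonzero: "delta_plus g \<delta> v\<^sub>2 \<noteq> 0"
    note facts = facts nonzero
    show "diagonalizable_on (unimodular_kernel br) (br v\<^sub>2)"
      by (rule einstein_diagonalizable[OF facts])
    show "(H v\<^sub>1 v\<^sub>2 v\<^sub>3)\<^sup>2 = (trace_on (unimodular_kernel br) (br v\<^sub>2))\<^sup>2"
      "delta_plus g \<delta> v\<^sub>2 = - trace_on (unimodular_kernel br) (br v\<^sub>2)"
      using solution(1,2)[OF facts] by (simp_all add: trace_kernel)
    show "trace_on (unimodular_kernel br) (br v\<^sub>2) \<noteq> 0"
      using trace_ad_v2 by (simp add: trace_kernel)
    assume "has_double_eigenvalue (matrix_wrt v\<^sub>1 v\<^sub>3 (br v\<^sub>2))"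
    from einstein_double_eigenvalue[OF facts this] show
      "\<exists>w\<^sub>1 w\<^sub>2 w\<^sub>3 \<theta>. adapted_basis br g w\<^sub>1 w\<^sub>2 w\<^sub>3 \<and> w\<^sub>2 \<in> {v\<^sub>2, - v\<^sub>2} \<and> \<theta> > 0 \<and>
        br w\<^sub>2 w\<^sub>1 = \<theta> *\<^sub>R w\<^sub>1 \<and> br w\<^sub>2 w\<^sub>3 = \<theta> *\<^sub>R w\<^sub>3 \<and>
        (H w\<^sub>1 w\<^sub>2 w\<^sub>3)^2 = (2 * \<theta>)^2 \<and>
        delta_plus g \<delta> w\<^sub>2 = - 2 * \<theta> \<and> delta_minus g \<delta> w\<^sub>2 = - 2 * \<theta> \<and>
        delta_plus g \<delta> w\<^sub>1 = 0 \<and> delta_plus g \<delta> w\<^sub>3 = 0 \<and>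
        delta_minus g \<delta> w\<^sub>1 = 0 \<and> delta_minus g \<delta> w\<^sub>3 = 0" .
  next
    fix v\<^sub>1 v\<^sub>2 v\<^sub>3
    assume "adapted_basis br g v\<^sub>1 v\<^sub>2 v\<^sub>3"
    then interpret adapted_frame br g H v\<^sub>1 v\<^sub>2 v\<^sub>3
      by (rule adapted_frame)
    show "(generalized_einstein br H g \<delta> \<and>
        delta_plus g \<delta> v\<^sub>2 = delta_minus g \<delta> v\<^sub>2 \<and> delta_plus g \<delta> v\<^sub>2 \<noteq> 0 \<and>
        (\<exists>x y. x \<noteq> y \<and> eigenvalue_on (unimodular_kernel br) (br v\<^sub>2) x \<and>
           eigenvalue_on (unimodular_kernel br) (br v\<^sub>2) y)) \<longleftrightarrow>
      distinct_eigenvalue_families (g v\<^sub>1 v\<^sub>1) (g v\<^sub>2 v\<^sub>2) (g v\<^sub>3 v\<^sub>3) (H v\<^sub>1 v\<^sub>2 v\<^sub>3)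
        (delta_plus g \<delta> v\<^sub>1) (delta_plus g \<delta> v\<^sub>2) (delta_plus g \<delta> v\<^sub>3)
        (delta_minus g \<delta> v\<^sub>1) (delta_minus g \<delta> v\<^sub>2) (delta_minus g \<delta> v\<^sub>3)
        (matrix_wrt v\<^sub>1 v\<^sub>3 (br v\<^sub>2))"
      by (rule distinct_eigenvalue_einstein_iff[OF assms(1)])
  qed
qed

end
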